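(* Let $\Gamma\subset\mathrm{SL}(2,\mathbb{Z})$ be a subgroup of finite index, $k\in\mathbb{C}$, $v$ a weakly parabolic multiplier system on $\Gamma$ compatible with weight $k$, and $\lambda=\frac14-\nu^2$ with $\nu\in\mathbb{C}$, $\nu\notin\{-\frac12,-1,-\frac32,\dots\}$, and $\pm\frac{k}{2}-\nu\notin\{\frac12,\frac32,\frac52,\dots\}$ for both signs. Let $u\in gM(\Gamma,k,v,\lambda)$, let $q\in\mathcal{C}_\Gamma$ be a cusp of width $l_q$, and let $\kappa\in\mathbb{R}$ be given by $v(\gamma_q)=e^{2\pi i\kappa}$. Then $u_q:=u|_kg_q$ admits a Whittaker-Fourier expansion $$ \begin{aligned} u_q(x+iy)&=\sum_{\substack{n\equiv\kappa \bmod 1\\ n\neq0}}A_n\,|n|^{-\frac12}\,\tilde W_{\mathrm{sign}(n)\frac k2,\nu}\!\left(\frac{4\pi|n|}{l_q}y\right)e^{\frac{2\pi in}{l_q}x}\\ &\quad+\sum_{\substack{n\equiv\kappa \bmod 1\\ n\neq0,\ \frac{2\pi|n|}{l_q}<M}}B_n\,|n|^{-\frac12}\,\tilde M_{\mathrm{sign}(n)\frac k2,\nu}\!\left(\frac{4\pi|n|}{l_q}y\right)e^{\frac{2\pi in}{l_q}x}\\ &\quad+C_+\,y^{\frac12+\nu}+C_-\,y^{\frac12-\nu} \end{aligned} $$ for some $M\in\mathbb{R}$ and some complex coefficients $A_n,B_n,C_+,C_-$, where $n$ runs through real numbers congruent to $\kappa$ modulo $1$. The $0^{\text{th}}$-term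 vanishes (i.e. $C_+=C_-=0$) if $v(\gamma_q)\neq1$.
   Context: $\mathbb{H}=\{z=x+iy\in\mathbb{C}: y>0\}$, on which $\mathrm{SL}(2,\mathbb{R})$ acts by fractional linear transformations. Arguments are normalized by $\arg(w)\in(-\pi,\pi]$ for $w\neq 0$. For $k\in\mathbb{C}$, $\gamma=\begin{pmatrix}a&b\\c&d\end{pmatrix}\in\mathrm{SL}(2,\mathbb{R})$ and $f:\mathbb{H}\to\mathbb{C}$, put $(f|_k\gamma)(z)=e^{-ik\arg(cz+d)}f(\gamma z)$. A multiplier (system) $v$ on $\Gamma$ compatible with weight $k\in\mathbb{C}$ is a function $v:\Gamma\to\mathbb{C}\setminus\{0\}$ such that $f(\gamma z)=v(\gamma)e^{ik\arg(cz+d)}f(z)$ (for all $\gamma=\begin{pmatrix}a&b\\c&d\end{pmatrix}\in\Gamma$, $z\in\mathbb{H}$) allows non-zero solutions $f$. It is weakly parabolic if $|v(\gamma)|=1$ for all parabolic $\gamma\in\Gamma$. $\mathcal{C}_\Gamma$ denotes the (finite) set of inequivalent cusps of $\Gamma$. For each $q\in\mathcal{C}_\Gamma$, the stabilizer of $q$ is $\langle\gamma_q,-\mathbf{1}\rangle$ with $\gamma_q\in\Gamma$, and $g_q\in\mathrm{SL}(2,\mathbb{Z})$ is a scaling matrix: $q=g_q\,i\infty$ and $g_q^{-1}\gamma_qg_q=\begin{pmatrix}1&l_q\\0&1\end{pmatrix}$, where the positive integer $l_q$ is the width of $q$. Laplace operator: $\Delta_k=-y^2(\partial_x^2+\partial_y^2)+iky\,\partial_x$.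 $gM(\Gamma,k,v,\lambda)$ denotes the space of generalized Maass wave forms of weight $k$, multiplier $v$ and eigenvalue $\lambda$ for $\Gamma$, i.e. of real-analytic functions $u:\mathbb{H}\to\mathbb{C}$ with (1) $u|_k\gamma=v(\gamma)u$ for all $\gamma\in\Gamma$; (2) $\Delta_ku=\lambda u$; (3) at each cusp $q\in\mathcal{C}_\Gamma$, $u(g_qz)=O(e^{cy})$ as $y\to\infty$ for some $c\in\mathbb{R}$. Whittaker functions: $M_{\kappa',\nu}(y)$ and $W_{\kappa',\nu}(y)$ are the standard Whittaker functions on $(0,\infty)$, solutions of $G''(y)+\left(-\frac14+\frac{\kappa'}{y}+\frac{\frac14-\nu^2}{y^2}\right)G(y)=0$. For $\kappa'-\nu\notin\{\frac12,\frac32,\frac52,\dots\}$ and $y>0$ set $$\tilde W_{\kappa',\nu}(y)=W_{\kappa',\nu}(y),\qquad \tilde M_{\kappa',\nu}(y)=\frac{\Gamma\left(\frac12+\nu-\kappa'\right)}{\Gamma(1+2\nu)}\,M_{\kappa',\nu}(y)$$ (here $\Gamma(\cdot)$ is the Gamma function).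
   Formalization: For ν = 0 the second zeroth term C_- y^{1/2-ν} is replaced by C_- y^{1/2} log y, since the printed formula fails there (e.g. the derivative at s = 1/2 of the Eisenstein series E(z,s) for SL(2,Z), k = 0, v = 1). *)

theory Defs
  imports
    "HOL-Analysis.Analysis"
    "HOL-Algebra.Coset"
    "HOL-Algebra.Generated_Groups"
    "HOL-Library.Landau_Symbols"
begin

definition SL2R :: "(real^2^2) monoid" where
  "SL2R = \<lparr>carrier = {A. det A = 1}, mult = (**), one = mat 1\<rparr>"

definition SL2Z :: "(real^2^2) monoid" where
  "SL2Z = SL2R\<lparr>carrier := {A \<in> carrier SL2R. \<forall>i j. A $ i $ j \<in> \<int>}\<rparr>"

definition upper_half_plane :: "complex set" where
  "upper_half_plane = {z. Im z > 0}"

definition cocycle :: "real^2^2 \<Rightarrow> complex \<Rightarrow> complex" where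
  "cocycle A z = of_real (A $ 2 $ 1) * z + of_real (A $ 2 $ 2)"

definition moebius :: "real^2^2 \<Rightarrow> complex \<Rightarrow> complex" where
  "moebius A z = (of_real (A $ 1 $ 1) * z + of_real (A $ 1 $ 2)) / cocycle A z"

text \<open>Boundary points of the upper half plane: \<^term>\<open>Some t\<close> is the real number \<open>t\<close> and
  \<^term>\<open>None\<close> is \<open>i\<infinity>\<close>.\<close>

fun moebius_boundary :: "real^2^2 \<Rightarrow> real option \<Rightarrow> real option" where
  "moebius_boundary A None =
     (if A $ 2 $ 1 = 0 then None else Some (A $ 1 $ 1 / A $ 2 $ 1))"
| "moebius_boundary A (Some t) =
     (if A $ 2 $ 1 * t + A $ 2 $ 2 = 0 then None
      else Some ((A $ 1 $ 1 * t + A $ 1 $ 2) / (A $ 2 $ 1 * t + A $ 2 $ 2)))"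

definition parabolic :: "real^2^2 \<Rightarrow> bool" where
  "parabolic A \<longleftrightarrow> \<bar>trace A\<bar> = 2 \<and> A \<noteq> mat 1 \<and> A \<noteq> - mat 1"

definition finite_index_subgroup :: "(real^2^2) set \<Rightarrow> bool" where
  "finite_index_subgroup \<Gamma> \<longleftrightarrow> subgroup \<Gamma> SL2Z \<and> finite (rcosets\<^bsub>SL2Z\<^esub> \<Gamma>)"

definition is_cusp :: "(real^2^2) set \<Rightarrow> real option \<Rightarrow> bool" where
  "is_cusp \<Gamma> q \<longleftrightarrow> (\<exists>A\<in>\<Gamma>. parabolic A \<and> moebius_boundary A q = q)"

text \<open>A set \<open>C\<close> of representatives of the cusps of \<open>\<Gamma>\<close> modulo \<open>\<Gamma>\<close>, with, for each \<open>q \<in> C\<close>, the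
  generator \<open>\<gamma> q \<in> \<Gamma>\<close> of the stabilizer, the scaling matrix \<open>g q\<close> and the width \<open>l q\<close>.
  The stabilizer is taken together with \<open>-1\<close>, so that \<open>\<Gamma>\<close> itself need not contain \<open>-1\<close>; if
  it does, the condition says that the stabilizer of \<open>q\<close> in \<open>\<Gamma>\<close> is generated by \<open>\<gamma> q\<close> and \<open>-1\<close>.\<close>

definition cusp_system ::
    "(real^2^2) set \<Rightarrow> real option set \<Rightarrow> (real option \<Rightarrow> real^2^2) \<Rightarrow>
     (real option \<Rightarrow> real^2^2) \<Rightarrow> (real option \<Rightarrow> nat) \<Rightarrow> bool" where
  "cusp_system \<Gamma> C \<gamma> g l \<longleftrightarrow>
     (\<forall>q\<in>C. is_cusp \<Gamma> q) \<and>
     (\<forall>p. is_cusp \<Gamma> p \<longrightarrow> (\<exists>!q. q \<in> C \<and> (\<exists>A\<in>\<Gamma>. moebius_boundary A p = q))) \<and>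
     (\<forall>q\<in>C. \<gamma> q \<in> \<Gamma> \<and>
        generate SL2Z ({A \<in> \<Gamma>. moebius_boundary A q = q} \<union> {- mat 1})
          = generate SL2Z {\<gamma> q, - mat 1} \<and>
        g q \<in> carrier SL2Z \<and>
        moebius_boundary (g q) None = q \<and>
        l q > 0 \<and>
        matrix_inv (g q) ** \<gamma> q ** g q = vector [vector [1, real (l q)], vector [0, 1]])"

definition slash :: "complex \<Rightarrow> (complex \<Rightarrow> complex) \<Rightarrow> real^2^2 \<Rightarrow> complex \<Rightarrow> complex" where
  "slash k f A z = exp (- \<i> * k * of_real (Arg (cocycle A z))) * f (moebius A z)"

definition multiplier_system ::
    "(real^2^2) set \<Rightarrow> complex \<Rightarrow> (real^2^2 \<Rightarrow> complex) \<Rightarrow> bool" where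
  "multiplier_system \<Gamma> k v \<longleftrightarrow>
     (\<forall>A\<in>\<Gamma>. v A \<noteq> 0) \<and>
     (\<exists>f :: complex \<Rightarrow> complex.
        (\<forall>A\<in>\<Gamma>. \<forall>z\<in>upper_half_plane.
           f (moebius A z) = v A * exp (\<i> * k * of_real (Arg (cocycle A z))) * f z) \<and>
        (\<exists>z\<in>upper_half_plane. f z \<noteq> 0))"

definition weakly_parabolic :: "(real^2^2) set \<Rightarrow> (real^2^2 \<Rightarrow> complex) \<Rightarrow> bool" where
  "weakly_parabolic \<Gamma> v \<longleftrightarrow> (\<forall>A\<in>\<Gamma>. parabolic A \<longrightarrow> norm (v A) = 1)"

text \<open>Real-analyticity as a function of the two real variables \<open>x\<close> and \<open>y\<close> (not to be confused
  with the complex notion \<^const>\<open>analytic_on\<close>): near every point the function is the sum of an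
  unconditionally convergent double power series.\<close>

definition real_analytic_on :: "(complex \<Rightarrow> complex) \<Rightarrow> complex set \<Rightarrow> bool" where
  "real_analytic_on u S \<longleftrightarrow>
     (\<forall>z\<in>S. \<exists>r>0. \<exists>a :: nat \<times> nat \<Rightarrow> complex. \<forall>s t :: real. \<bar>s\<bar> < r \<longrightarrow> \<bar>t\<bar> < r \<longrightarrow>
        ((\<lambda>(m, n). a (m, n) * of_real (s ^ m * t ^ n)) has_sum u (z + Complex s t)) UNIV)"

definition partial_x :: "(complex \<Rightarrow> complex) \<Rightarrow> complex \<Rightarrow> complex" where
  "partial_x u z = vector_derivative (\<lambda>t. u (Complex t (Im z))) (at (Re z))"

definition partial_y :: "(complex \<Rightarrow> complex) \<Rightarrow> complex \<Rightarrow> complex" where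
  "partial_y u z = vector_derivative (\<lambda>t. u (Complex (Re z) t)) (at (Im z))"

definition maass_laplacian :: "complex \<Rightarrow> (complex \<Rightarrow> complex) \<Rightarrow> complex \<Rightarrow> complex" where
  "maass_laplacian k u z =
     - of_real ((Im z)\<^sup>2) * (partial_x (partial_x u) z + partial_y (partial_y u) z)
     + \<i> * k * of_real (Im z) * partial_x u z"

text \<open>Only the values of \<open>u\<close> on the upper half plane matter. The filter
  \<^term>\<open>filtercomap Im at_top\<close> expresses growth as \<open>y \<rightarrow> \<infinity>\<close>, uniformly in \<open>x\<close>.\<close>

definition generalized_maass_forms ::
    "(real^2^2) set \<Rightarrow> real option set \<Rightarrow> (real option \<Rightarrow> real^2^2) \<Rightarrow>
     complex \<Rightarrow> (real^2^2 \<Rightarrow> complex) \<Rightarrow> complex \<Rightarrow> (complex \<Rightarrow> complex) set" where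
  "generalized_maass_forms \<Gamma> C g k v lam = {u.
     real_analytic_on u upper_half_plane \<and>
     (\<forall>A\<in>\<Gamma>. \<forall>z\<in>upper_half_plane. slash k u A z = v A * u z) \<and>
     (\<forall>z\<in>upper_half_plane. maass_laplacian k u z = lam * u z) \<and>
     (\<forall>q\<in>C. \<exists>c :: real.
        (\<lambda>z. u (moebius (g q) z)) \<in> O[filtercomap Im at_top](\<lambda>z. of_real (exp (c * Im z))))}"

definition kummer_M :: "complex \<Rightarrow> complex \<Rightarrow> complex \<Rightarrow> complex" where
  "kummer_M a b z = (\<Sum>n. pochhammer a n / pochhammer b n * z ^ n / fact n)"

definition whittaker_M :: "complex \<Rightarrow> complex \<Rightarrow> real \<Rightarrow> complex" where
  "whittaker_M \<kappa> \<nu> y =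
     of_real (exp (- y / 2)) * of_real y powr (1/2 + \<nu>) *
     kummer_M (1/2 + \<nu> - \<kappa>) (1 + 2 * \<nu>) (of_real y)"

definition whittaker_solution :: "complex \<Rightarrow> complex \<Rightarrow> (real \<Rightarrow> complex) \<Rightarrow> bool" where
  "whittaker_solution \<kappa> \<nu> G \<longleftrightarrow>
     (\<exists>G' G''. \<forall>y>0.
        (G has_vector_derivative G' y) (at y) \<and>
        (G' has_vector_derivative G'' y) (at y) \<and>
        G'' y + (- 1/4 + \<kappa> / of_real y + (1/4 - \<nu>\<^sup>2) / of_real (y\<^sup>2)) * G y = 0)"

text \<open>As usual, \<open>W\<close> is the recessive solution normalized by its asymptotics
  \<open>W(y) \<sim> e\<^sup>-\<^sup>y\<^sup>/\<^sup>2 y\<^sup>\<kappa>\<close> as \<open>y \<rightarrow> \<infinity>\<close>, which determine it uniquely for all complex \<open>\<kappa>\<close>, \<open>\<nu>\<close>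
  (solutions not proportional to it grow like \<open>e\<^sup>y\<^sup>/\<^sup>2 y\<^sup>-\<^sup>\<kappa>\<close>). The description is of the
  value at \<open>y\<close>, not of the function, since \<^term>\<open>G\<close> is unconstrained off the positive axis.\<close>

definition whittaker_W :: "complex \<Rightarrow> complex \<Rightarrow> real \<Rightarrow> complex" where
  "whittaker_W \<kappa> \<nu> y = (THE w. \<exists>G.
     whittaker_solution \<kappa> \<nu> G \<and>
     ((\<lambda>t. G t / (of_real (exp (- t / 2)) * of_real t powr \<kappa>)) \<longlongrightarrow> 1) at_top \<and>
     w = G y)"

definition whittaker_W_tilde :: "complex \<Rightarrow> complex \<Rightarrow> real \<Rightarrow> complex" where
  "whittaker_W_tilde \<kappa> \<nu> y = whittaker_W \<kappa> \<nu> y"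

definition whittaker_M_tilde :: "complex \<Rightarrow> complex \<Rightarrow> real \<Rightarrow> complex" where
  "whittaker_M_tilde \<kappa> \<nu> y =
     Gamma (1/2 + \<nu> - \<kappa>) / Gamma (1 + 2 * \<nu>) * whittaker_M \<kappa> \<nu> y"

text \<open>The index \<open>0\<close>, occurring for integral \<open>\<kappa>\<close>, belongs to the separate zeroth term.\<close>

definition fourier_indices :: "real \<Rightarrow> real set" where
  "fourier_indices \<kappa> = {n. n - \<kappa> \<in> \<int> \<and> n \<noteq> 0}"

end

theory Submission
  imports Defs "HOL-Real_Asymp.Real_Asymp"
begin

text \<open>
  Write \<open>U = u|\<^sub>kg\<^sub>q\<close>.  The slash operator commutes with \<open>\<Delta>\<^sub>k\<close>, and \<open>u|\<^sub>k\<gamma>\<^sub>q = v(\<gamma>\<^sub>q)u\<close>, so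
  \<open>\<Delta>\<^sub>kU = \<lambda>U\<close> and \<open>U(z + l) = e\<^sup>2\<^sup>\<pi>\<^sup>i\<^sup>\<kappa> U(z)\<close> with \<open>l\<close> the width.  For fixed \<open>y\<close> the function \<open>x \<mapsto> U(x + iy)\<close>
  therefore has a Fourier series over the frequencies \<open>n \<equiv> \<kappa> mod 1\<close>, which converges absolutely to \<open>U\<close>
  because \<open>U\<close> is smooth.  Differentiating the coefficient \<open>a\<^sub>n(y)\<close> under the integral sign and integrating
  by parts in \<open>x\<close>, the equation \<open>\<Delta>\<^sub>kU = \<lambda>U\<close> becomes a linear equation of second order for \<open>a\<^sub>n\<close>.  For
  \<open>n = 0\<close> it is Euler's equation, solved by \<open>y\<^sup>1\<^sup>/\<^sup>2\<^sup>\<plusminus>\<^sup>\<nu>\<close>, with a logarithm when \<open>\<nu> = 0\<close>.  For \<open>n \<noteq> 0\<close> it is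
  Whittaker's equation in the variable \<open>t = 4\<pi>|n|y/l\<close>.  If \<open>W\<close> and \<open>M\<close> span its solutions, then
  \<open>a\<^sub>n = \<alpha> W + \<beta> M\<close>; since \<open>U = O(e\<^sup>c\<^sup>y)\<close> while \<open>M\<close> grows like \<open>e\<^sup>t\<^sup>/\<^sup>2\<close> and \<open>e\<^sup>t\<^sup>/\<^sup>2 = e\<^sup>2\<^sup>\<pi>\<^sup>|\<^sup>n\<^sup>|\<^sup>y\<^sup>/\<^sup>l\<close>, the coefficient
  \<open>\<beta>\<close> vanishes as soon as \<open>2\<pi>|n|/l > c\<close>.

  Two parts carry the weight.  The transformation of \<open>\<Delta>\<^sub>k\<close> is a computation with the Wirtinger derivatives,
  in which a Moebius map only contributes the factors \<open>j\<^sup>-\<^sup>2\<close> and their conjugates, \<open>j = cz + d\<close>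
  (\<open>slash_wirtinger2\<close>); that \<open>U\<close> picks up exactly \<open>v(\<gamma>\<^sub>q)\<close> under \<open>z \<mapsto> z + l\<close>, without an extra factor
  \<open>e\<^sup>2\<^sup>\<pi>\<^sup>i\<^sup>k\<^sup>m\<close>, is a statement about arguments (\<open>slash_translation\<close>).

  The other part is the theory of Whittaker's equation (\<open>whittaker_expansion\<close>).  Let now \<open>\<kappa>\<close> be its first
  parameter, which is \<open>\<plusminus>k/2\<close> in the application.  The function \<open>W\<close> is
  characterised by its asymptotics only, so a solution with these asymptotics has to be produced for all
  complex parameters: Tricomi's integral gives it when \<open>Re \<kappa>\<close> is small enough, and the raising
  operator \<open>G \<mapsto> (t/2 - \<kappa>)G - tG'\<close> leads from \<open>\<kappa>\<close> to \<open>\<kappa> + 1\<close> (\<open>whittaker_recessive_exists\<close>).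
  That \<open>W\<close> and \<open>M\<close> are independent is the point where \<open>\<kappa> - \<nu> - 1/2\<close> must not be a natural number.
  If they were dependent, Kummer's series \<open>\<Phi>(a,b,t)\<close> and its derivatives would grow polynomially.  Since
  differentiation raises \<open>a\<close> and \<open>b\<close> by one, their real parts may be taken positive; but the Laplace transform
  of \<open>t\<^sup>b\<^sup>-\<^sup>1\<Phi>(a,b,t)\<close> is \<open>\<Gamma>(b)s\<^sup>-\<^sup>b(1 - 1/s)\<^sup>-\<^sup>a\<close>, which is unbounded as \<open>s\<close> tends to 1
  (\<open>kummer_M_not_poly_bounded\<close>).  Throughout, a constant non-zero Wronskian and Cramer's rule replace the
  uniqueness theorem for linear differential equations.
\<close>


section \<open>Fourier series of periodic functions\<close>

text \<open>
  The characters \<open>t \<mapsto> e\<^sup>2\<^sup>\<pi>\<^sup>i\<^sup>n\<^sup>t\<close>, with real frequency \<open>n\<close>: the multiplier at the cusp shifts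
  the integral frequencies by \<open>\<kappa>\<close>.
\<close>

definition fchar :: "real \<Rightarrow> real \<Rightarrow> complex" where
  "fchar n t = exp (2 * of_real pi * \<i> * of_real n * of_real t)"

lemma fchar_0 [simp]: "fchar n 0 = 1" "fchar 0 t = 1"
  by (simp_all add: fchar_def)

lemma norm_fchar [simp]: "norm (fchar n t) = 1"
  by (simp add: fchar_def)

lemma fchar_nonzero [simp]: "fchar n t \<noteq> 0"
  by (simp add: fchar_def)

lemma fchar_add: "fchar (m + n) t = fchar m t * fchar n t" "fchar n (s + t) = fchar n s * fchar n t"
  by (simp_all add: fchar_def ring_distribs exp_add)

lemma fchar_minus: "fchar (- n) t = inverse (fchar n t)" "fchar n (- t) = inverse (fchar n t)"
  by (simp_all add: fchar_def exp_minus)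

lemma fchar_int [simp]: "fchar (of_int m) 1 = 1"
  using exp_integer_2pi[of "of_int m"] by (simp add: fchar_def mult_ac)

lemma fchar_eq_1_iff: "fchar 1 t = 1 \<longleftrightarrow> t \<in> \<int>"
proof -
  have "fchar 1 t = exp (\<i> * of_real (2 * pi * t))" by (simp add: fchar_def mult_ac)
  also have "\<dots> = 1 \<longleftrightarrow> (\<exists>m::int. 2 * pi * t = of_int (2 * m) * pi)"
    by (simp add: exp_eq_1)
  also have "\<dots> \<longleftrightarrow> t \<in> \<int>" by (auto elim!: Ints_cases)
  finally show ?thesis .
qed

lemma fchar_derivative:
  "(fchar n has_vector_derivative 2 * of_real pi * \<i> * of_real n * fchar n t) (at t within S)"
proof -
  have "((\<lambda>z. exp (2 * of_real pi * \<i> * of_real n * z)) has_field_derivative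
     exp (2 * of_real pi * \<i> * of_real n * of_real t) * (2 * of_real pi * \<i> * of_real n)) (at (of_real t))"
    by (auto intro!: derivative_eq_intros)
  from has_vector_derivative_real_field[OF this, of S] show ?thesis
    by (simp add: fchar_def[abs_def] mult_ac)
qed

lemma continuous_on_fchar [continuous_intros]: "continuous_on S (fchar n)"
  unfolding fchar_def[abs_def] by (intro continuous_intros)

definition fourier_coeff :: "(real \<Rightarrow> complex) \<Rightarrow> real \<Rightarrow> complex" where
  "fourier_coeff f n = integral {0..1} (\<lambda>t. f t * fchar (- n) t)"

lemma fourier_coeff_bound:
  assumes "continuous_on {0..1} f" "\<And>t. t \<in> {0..1} \<Longrightarrow> norm (f t) \<le> B"
  shows "norm (fourier_coeff f n) \<le> B"
proof -
  have "norm (fourier_coeff f n) \<le> B * (1 - 0)"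
    unfolding fourier_coeff_def
    by (rule integral_bound) (auto intro!: continuous_intros assms simp: norm_mult)
  then show ?thesis by simp
qed

text \<open>
  Integration by parts.  The boundary term is kept since it vanishes only for (quasi-)periodic \<open>f\<close>,
  whereas the lemma of Riemann and Lebesgue applies the formula to polynomials.
\<close>

lemma fourier_coeff_derivative:
  assumes f: "\<And>t. t \<in> {0..1} \<Longrightarrow> (f has_vector_derivative f' t) (at t)" and f': "continuous_on {0..1} f'"
  shows "fourier_coeff f' n = 2 * of_real pi * \<i> * of_real n * fourier_coeff f n + (f 1 * fchar (- n) 1 - f 0)"
proof -
  have cf: "continuous_on {0..1} f"
    by (intro continuous_at_imp_continuous_on ballI has_vector_derivative_continuous[OF f])
  have "((\<lambda>t. f t * (2 * of_real pi * \<i> * of_real (- n) * fchar (- n) t) + f' t * fchar (- n) t) has_integral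
     (f 1 * fchar (- n) 1 - f 0 * fchar (- n) 0)) {0..1}"
  proof (rule fundamental_theorem_of_calculus)
    fix t :: real assume "t \<in> {0..1}"
    then show "((\<lambda>t. f t * fchar (- n) t) has_vector_derivative
       f t * (2 * of_real pi * \<i> * of_real (- n) * fchar (- n) t) + f' t * fchar (- n) t) (at t within {0..1})"
      by (intro has_vector_derivative_mult has_vector_derivative_at_within[OF f] fchar_derivative)
  qed simp
  moreover have "((\<lambda>t. f t * (2 * of_real pi * \<i> * of_real (- n) * fchar (- n) t) + f' t * fchar (- n) t) has_integral
     (- (2 * of_real pi * \<i> * of_real n) * fourier_coeff f n + fourier_coeff f' n)) {0..1}"
  proof (rule has_integral_add)
    have "((\<lambda>t. f t * fchar (- n) t) has_integral fourier_coeff f n) {0..1}"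
      unfolding fourier_coeff_def
      by (intro integrable_integral integrable_continuous_interval continuous_intros cf)
    from has_integral_mult_right[OF this, of "- (2 * of_real pi * \<i> * of_real n)"]
    show "((\<lambda>t. f t * (2 * of_real pi * \<i> * of_real (- n) * fchar (- n) t)) has_integral
        - (2 * of_real pi * \<i> * of_real n) * fourier_coeff f n) {0..1}"
      by (simp add: mult_ac)
    show "((\<lambda>t. f' t * fchar (- n) t) has_integral fourier_coeff f' n) {0..1}"
      unfolding fourier_coeff_def
      by (intro integrable_integral integrable_continuous_interval continuous_intros f')
  qed
  ultimately have "- (2 * of_real pi * \<i> * of_real n) * fourier_coeff f n + fourier_coeff f' n
      = f 1 * fchar (- n) 1 - f 0 * fchar (- n) 0"
    by (rule has_integral_unique[rotated])
  then show ?thesis by (simp add: algebra_simps)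
qed

text \<open>
  For a polynomial, integration by parts bounds the coefficient by a constant over the frequency, and
  polynomials are uniformly dense.
\<close>

lemma riemann_lebesgue:
  assumes g: "continuous_on {0..1} g"
  shows "(\<lambda>n. fourier_coeff g (real n)) \<longlonglongrightarrow> 0" "(\<lambda>n. fourier_coeff g (- real n)) \<longlonglongrightarrow> 0"
proof -
  have *: "\<exists>N>0. \<forall>x. \<bar>x\<bar> \<ge> N \<longrightarrow> norm (fourier_coeff g x) < e" if e: "e > 0" for e
  proof -
    obtain p where p: "polynomial_function p" "\<And>t. t \<in> {0..1} \<Longrightarrow> norm (g t - p t) < e / 2"
      using Stone_Weierstrass_polynomial_function[OF _ g, of "e / 2"] e by auto
    obtain p' where p': "polynomial_function p'" "\<And>t. (p has_vector_derivative p' t) (at t)"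
      using has_vector_derivative_polynomial_function[OF p(1)] by metis
    have cp: "continuous_on {0..1} p" "continuous_on {0..1} p'"
      using p(1) p'(1) by (auto intro: continuous_on_polymonial_function)
    have "bounded (p' ` {0..1})" by (intro compact_imp_bounded compact_continuous_image cp) simp
    then obtain B where B: "B > 0" "\<And>t. t \<in> {0..1} \<Longrightarrow> norm (p' t) \<le> B" by (auto simp: bounded_pos)
    define K where "K = B + (norm (p 1) + norm (p 0))"
    have K: "K > 0" using B by (simp add: K_def add_pos_nonneg)
    have bp: "2 * pi * \<bar>x\<bar> * norm (fourier_coeff p x) \<le> K" for x
    proof -
      have "norm (2 * of_real pi * \<i> * of_real x * fourier_coeff p x) = norm (fourier_coeff p' x
          - (p 1 * fchar (- x) 1 - p 0))"
        using fourier_coeff_derivative[of p p' x] p'(2) cp(2) by simp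
      also have "\<dots> \<le> norm (fourier_coeff p' x) + (norm (p 1 * fchar (- x) 1) + norm (p 0))"
        by (meson add_left_mono norm_triangle_ineq4 order_trans)
      also have "\<dots> \<le> K" unfolding K_def using fourier_coeff_bound[OF cp(2) B(2), of x] by (simp add: norm_mult)
      finally show ?thesis by (simp add: norm_mult)
    qed
    have diff: "fourier_coeff g x = fourier_coeff (\<lambda>t. g t - p t) x + fourier_coeff p x" for x
      unfolding fourier_coeff_def
      by (subst integral_add[symmetric])
        (auto intro!: integrable_continuous_interval continuous_intros g cp simp: algebra_simps)
    \<comment> \<open>Beyond this frequency the polynomial contributes at most \<open>e / (2\<pi>)\<close>.\<close>
    show ?thesis
    proof (intro exI[of _ "K / e"] conjI allI impI)
      show "K / e > 0" using K e by simp
      fix x assume x: "\<bar>x\<bar> \<ge> K / e"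
      have "\<bar>x\<bar> > 0" using x K e by (smt (verit) divide_pos_pos)
      have 1: "norm (fourier_coeff (\<lambda>t. g t - p t) x) \<le> e / 2"
        by (rule fourier_coeff_bound[OF _ less_imp_le[OF p(2)]]) (intro continuous_intros g cp)
      have "K \<le> e * \<bar>x\<bar>" using x e by (simp add: field_simps)
      then have "2 * pi * \<bar>x\<bar> * norm (fourier_coeff p x) \<le> e * \<bar>x\<bar>" using bp[of x] by linarith
      then have "\<bar>x\<bar> * (2 * pi * norm (fourier_coeff p x)) \<le> \<bar>x\<bar> * e" by (simp add: mult_ac)
      then have "2 * pi * norm (fourier_coeff p x) \<le> e" using \<open>\<bar>x\<bar> > 0\<close> by simp
      moreover have "6 * norm (fourier_coeff p x) \<le> 2 * pi * norm (fourier_coeff p x)"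
        using pi_gt3 by (intro mult_right_mono) auto
      ultimately have "norm (fourier_coeff p x) < e / 2" using e norm_ge_zero[of "fourier_coeff p x"] by linarith
      then show "norm (fourier_coeff g x) < e"
        unfolding diff using 1 norm_triangle_ineq[of "fourier_coeff (\<lambda>t. g t - p t) x" "fourier_coeff p x"]
            by linarith
    qed
  qed
  have "\<exists>N. \<forall>n\<ge>N. norm (fourier_coeff g (s * real n)) < e" if e: "e > 0" and s: "\<bar>s\<bar> = 1" for e s
  proof -
    obtain N where N: "N > 0" "\<And>x. \<bar>x\<bar> \<ge> N \<Longrightarrow> norm (fourier_coeff g x) < e" using *[OF e] by blast
    show ?thesis
      by (rule exI[of _ "nat \<lceil>N\<rceil>"]) (use s in \<open>auto intro!: N(2) simp: abs_mult nat_ceiling_le_eq\<close>)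
  qed
  from this[of _ 1] this[of _ "-1"]
  show "(\<lambda>n. fourier_coeff g (real n)) \<longlonglongrightarrow> 0" "(\<lambda>n. fourier_coeff g (- real n)) \<longlonglongrightarrow> 0"
    unfolding LIMSEQ_iff by simp_all
qed

lemma difference_quotient_tendsto:
  fixes f :: "real \<Rightarrow> complex"
  assumes "(f has_vector_derivative d) (at x)"
  shows "((\<lambda>t. (f t - f x) / of_real (t - x)) \<longlongrightarrow> d) (at x)"
proof -
  have "((\<lambda>y. (1 / norm (y - x)) *\<^sub>R (f y - (f x + (y - x) *\<^sub>R d))) \<longlongrightarrow> 0) (at x)"
    using assms unfolding has_vector_derivative_def has_derivative_within by blast
  then have "((\<lambda>y. norm ((1 / norm (y - x)) *\<^sub>R (f y - (f x + (y - x) *\<^sub>R d)))) \<longlongrightarrow> 0) (at x)"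
    by (rule tendsto_norm_zero)
  moreover have "\<forall>\<^sub>F y in at x. norm ((1 / norm (y - x)) *\<^sub>R (f y - (f x + (y - x) *\<^sub>R d)))
      = norm ((f y - f x) / of_real (y - x) - d)"
  proof (rule eventually_at_filter[THEN iffD2], rule always_eventually, intro allI impI)
    fix y assume "y \<noteq> x"
    then have "(f y - f x) / of_real (y - x) - d = ((f y - f x) - (y - x) *\<^sub>R d) / of_real (y - x)"
      by (simp add: field_simps scaleR_conv_of_real)
    then show "norm ((1 / norm (y - x)) *\<^sub>R (f y - (f x + (y - x) *\<^sub>R d))) = norm ((f y - f x) / of_real (y - x) - d)"
      by (simp only: norm_divide norm_of_real) (simp add: diff_diff_eq)
  qed
  ultimately have "((\<lambda>y. norm ((f y - f x) / of_real (y - x) - d)) \<longlongrightarrow> 0) (at x)"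
    by (rule Lim_transform_eventually)
  then show ?thesis by (rule LIM_zero_cancel[OF tendsto_norm_zero_cancel])
qed

lemma periodic_int:
  assumes "\<And>t. f (t + 1) = f (t::real)"
  shows "f (t + of_int m) = f t"
proof (induction m rule: int_induct[of _ 0])
  case (step1 i) then show ?case using assms[of "t + of_int i"] by (simp add: add.assoc)
next
  case (step2 i) then show ?case using assms[of "t + of_int (i - 1)"] by (simp add: algebra_simps)
qed simp

text \<open>
  The quotient has removable singularities at the points congruent to \<open>x\<close> modulo 1, where numerator
  and denominator both vanish to first order.
\<close>

lemma chernoff_quotient_continuous:
  fixes f f' :: "real \<Rightarrow> complex" and x :: real
  assumes f: "\<And>t. (f has_vector_derivative f' t) (at t)" and per: "\<And>t. f (t + 1) = f t"
  defines "g \<equiv> \<lambda>t. if fchar 1 (t - x) = 1 then f' t / (2 * of_real pi * \<i>) else (f t - f x) / (fchar 1 (t - x) - 1)"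
  shows "continuous_on UNIV g"
proof (rule continuous_at_imp_continuous_on, rule ballI)
  fix t1 :: real
  have contf: "isCont f t" for t using f by (rule has_vector_derivative_continuous)
  have contc: "isCont (\<lambda>t. fchar 1 (t - x)) t" for t
    unfolding fchar_def by (intro continuous_intros)
  show "isCont g t1"
  proof (cases "fchar 1 (t1 - x) = 1")
    case False
    have "\<forall>\<^sub>F t in nhds t1. fchar 1 (t - x) \<noteq> 1"
      using contc[of t1] False
          by (intro tendsto_imp_eventually_ne) (auto simp: isCont_def intro: tendsto_at_iff_tendsto_nhds[THEN iffD1])
    then have "\<forall>\<^sub>F t in nhds t1. g t = (f t - f x) / (fchar 1 (t - x) - 1)"
      by eventually_elim (simp add: g_def)
    moreover have "isCont (\<lambda>t. (f t - f x) / (fchar 1 (t - x) - 1)) t1"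
      using False by (intro continuous_intros contf contc) auto
    ultimately show ?thesis by (simp cong: isCont_cong)
  next
    case True
    then obtain m :: int where m: "t1 - x = of_int m" by (auto simp: fchar_eq_1_iff elim: Ints_cases)
    have fx: "f x = f t1" using periodic_int[of f x m] per m by (simp add: algebra_simps)
    have ch: "fchar 1 (t - x) = fchar 1 (t - t1)" for t
      using fchar_add(2)[of 1 "t - t1" "t1 - x"] True by simp
    have d1: "((\<lambda>t. (f t - f t1) / of_real (t - t1)) \<longlongrightarrow> f' t1) (at t1)"
      by (rule difference_quotient_tendsto[OF f])
    have "((\<lambda>t. fchar 1 (t - t1)) has_vector_derivative 2 * of_real pi * \<i>) (at t1)"
    proof -
      have "((\<lambda>t. fchar 1 t * fchar 1 (- t1)) has_vector_derivative (2 * of_real pi * \<i> * of_real 1 * fchar 1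
          t1) * fchar 1 (- t1)) (at t1)"
        by (intro has_vector_derivative_mult_left fchar_derivative)
      then show ?thesis by (simp add: fchar_add(2)[symmetric] mult.assoc)
    qed
    from difference_quotient_tendsto[OF this]
    have d2: "((\<lambda>t. (fchar 1 (t - t1) - 1) / of_real (t - t1)) \<longlongrightarrow> 2 * of_real pi * \<i>) (at t1)" by simp
    have lim: "((\<lambda>t. ((f t - f t1) / of_real (t - t1)) / ((fchar 1 (t - t1) - 1) / of_real (t - t1)))
        \<longlongrightarrow> f' t1 / (2 * of_real pi * \<i>)) (at t1)"
      by (intro tendsto_divide d1 d2) simp
    have "\<forall>\<^sub>F t in at t1. dist t t1 < 1"
      unfolding eventually_at by (rule exI[of _ 1]) auto
    then have "\<forall>\<^sub>F t in at t1. ((f t - f t1) / of_real (t - t1)) / ((fchar 1 (t - t1) - 1) / of_real (t - t1)) = g t"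
      unfolding eventually_at_filter
    proof eventually_elim
      case (elim t)
      show ?case
      proof (intro impI)
        assume t: "t \<noteq> t1"
        have "t - t1 \<notin> \<int>"
        proof
          assume "t - t1 \<in> \<int>"
          then obtain z :: int where z: "t - t1 = of_int z" by (elim Ints_cases)
          then have "\<bar>real_of_int z\<bar> < 1" using elim t by (simp add: dist_real_def)
          then have "z = 0" by linarith
          with z t show False by simp
        qed
        then have "fchar 1 (t - t1) \<noteq> 1" by (simp add: fchar_eq_1_iff)
        then show "((f t - f t1) / of_real (t - t1)) / ((fchar 1 (t - t1) - 1) / of_real (t - t1)) = g t"
          using t by (simp add: g_def ch fx)
      qed
    qed
    with lim have "(g \<longlongrightarrow> f' t1 / (2 * of_real pi * \<i>)) (at t1)" by (rule Lim_transform_eventually)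
    moreover have "g t1 = f' t1 / (2 * of_real pi * \<i>)" using True by (simp add: g_def)
    ultimately show ?thesis by (simp add: isCont_def)
  qed
qed

lemma sum_telescope_int:
  fixes h :: "int \<Rightarrow> complex"
  shows "(\<Sum>m=-int N..int N. h (m - 1) - h m) = h (- int N - 1) - h (int N)"
proof (induction N)
  case (Suc N)
  have "{-int (Suc N)..int (Suc N)} = insert (- int (Suc N)) (insert (int (Suc N)) {-int N..int N})" by auto
  then show ?case using Suc by (simp add: algebra_simps minus_diff_commute)
qed simp

lemma filterlim_symmetric_intervals:
  "filterlim (\<lambda>N. {-int N..int N}) (finite_subsets_at_top UNIV) sequentially"
  unfolding filterlim_finite_subsets_at_top
proof (intro allI impI)
  fix X :: "int set" assume X: "finite X \<and> X \<subseteq> UNIV"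
  then obtain B where B: "\<And>x. x \<in> X \<Longrightarrow> \<bar>x\<bar> \<le> int B"
  proof -
    have "finite (nat ` abs ` X)" using X by simp
    then obtain B where B: "\<And>y. y \<in> nat ` abs ` X \<Longrightarrow> y \<le> B" by (meson finite_nat_set_iff_bounded_le)
    have "\<bar>x\<bar> \<le> int B" if "x \<in> X" for x
      using B[of "nat \<bar>x\<bar>"] that by (simp add: nat_le_iff)
    then show ?thesis by (rule that)
  qed
  show "\<forall>\<^sub>F N in sequentially. finite {-int N..int N} \<and> X \<subseteq> {-int N..int N} \<and> {-int N..int N} \<subseteq> UNIV"
    using eventually_ge_at_top[of B]
  proof eventually_elim
    case (elim N)
    have "x \<in> {-int N..int N}" if "x \<in> X" for x using B[OF that] elim by (auto simp: abs_le_iff)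
    then show ?case by auto
  qed
qed

lemma summable_on_int_inverse_square:
  fixes f :: "int \<Rightarrow> complex"
  assumes "\<And>m. m \<noteq> 0 \<Longrightarrow> norm (f m) \<le> B / (real_of_int m)\<^sup>2"
  shows "f summable_on UNIV"
proof -
  have s: "summable (\<lambda>n. B / (real n)\<^sup>2)"
    using summable_mult[OF inverse_power_summable[of 2, where 'a = real], of B] by (simp add: divide_inverse)
  have 1: "(\<lambda>n. f (s * int (Suc n))) summable_on UNIV" if "\<bar>s\<bar> = 1" for s
  proof (rule norm_summable_imp_summable_on, rule summable_comparison_test)
    show "\<exists>N. \<forall>n\<ge>N. norm (norm (f (s * int (Suc n)))) \<le> B / (real (Suc n))\<^sup>2"
    proof (intro exI allI impI)
      fix n
      have "norm (f (s * int (Suc n))) \<le> B / (real_of_int (s * int (Suc n)))\<^sup>2"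
        using that by (intro assms) auto
      also have "(real_of_int (s * int (Suc n)))\<^sup>2 = (real (Suc n))\<^sup>2"
        using that by (cases "s = 1") (auto simp: abs_if power2_eq_square split: if_splits)
      finally show "norm (norm (f (s * int (Suc n)))) \<le> B / (real (Suc n))\<^sup>2" by simp
    qed
    show "summable (\<lambda>n. B / (real (Suc n))\<^sup>2)" using s by (subst summable_Suc_iff)
  qed
  have "f summable_on range (\<lambda>n. s * int (Suc n))" if "\<bar>s\<bar> = 1" for s
    using 1[OF that] that by (subst summable_on_reindex) (auto simp: inj_on_def o_def)
  from this[of 1] this[of "-1"]
  have "f summable_on ((range (\<lambda>n. 1 * int (Suc n)) \<union> range (\<lambda>n. -1 * int (Suc n))) \<union> {0})"
    by (intro summable_on_union) auto
  moreover have "(range (\<lambda>n. 1 * int (Suc n)) \<union> range (\<lambda>n. -1 * int (Suc n))) \<union> {0} = UNIV"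
  proof -
    have "m \<in> (range (\<lambda>n. 1 * int (Suc n)) \<union> range (\<lambda>n. -1 * int (Suc n))) \<union> {0}" for m
    proof (cases m rule: int_cases3)
      case (pos n)
      then have "m = 1 * int (Suc (n - 1))" by simp
      then show ?thesis by blast
    next
      case (neg n)
      then have "m = -1 * int (Suc (n - 1))" by simp
      then show ?thesis by blast
    qed simp
    then show ?thesis by blast
  qed
  ultimately show ?thesis by simp
qed

text \<open>
  Chernoff's argument.  With \<open>g(t) = (f(t) - f(x)) / (e\<^sup>2\<^sup>\<pi>\<^sup>i\<^sup>(\<^sup>t\<^sup>-\<^sup>x\<^sup>) - 1)\<close>, which is continuous, the
      coefficients of
  \<open>f - f(x)\<close> at \<open>x\<close> are differences of consecutive coefficients of \<open>g\<close>.  The symmetric partial sums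
  telescope, and what remains tends to zero by the lemma of Riemann and Lebesgue.  Two continuous
  derivatives make the series absolutely summable, so that the order of summation is immaterial.
\<close>

lemma fourier_series_pointwise:
  assumes f: "\<And>t. (f has_vector_derivative f' t) (at t)" and f': "\<And>t. (f' has_vector_derivative f'' t) (at t)"
    and f'': "continuous_on UNIV f''" and per: "\<And>t. f (t + 1) = f t"
  shows "((\<lambda>m::int. fourier_coeff f (of_int m) * fchar (of_int m) x) has_sum f x) UNIV"
proof -
  let ?c = "\<lambda>m::int. fourier_coeff f (of_int m) * fchar (of_int m) x"
  have cont: "continuous_on S f" "continuous_on S f'" "continuous_on S f''" for S
    using f f' by (auto intro!: continuous_at_imp_continuous_on continuous_on_subset[OF f''] intro:
        has_vector_derivative_continuous)
  have per': "f' (t + 1) = f' t" for t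
  proof -
    have "((\<lambda>t. f (t + 1)) has_vector_derivative f' (t + 1)) (at t)"
    proof -
      have "((\<lambda>t. t + 1) has_vector_derivative 1) (at t)" by (auto intro!: derivative_eq_intros)
      from vector_diff_chain_at[OF this f] show ?thesis by (simp add: o_def)
    qed
    then show ?thesis unfolding per using f vector_derivative_unique_at by blast
  qed
  have "bounded (f'' ` {0..1})" by (intro compact_imp_bounded compact_continuous_image cont) simp
  then obtain B where B: "B > 0" "\<And>t. t \<in> {0..1} \<Longrightarrow> norm (f'' t) \<le> B" by (auto simp: bounded_pos)
  have sm: "?c summable_on UNIV"
  proof (rule summable_on_int_inverse_square)
    fix m :: int assume m: "m \<noteq> 0"
    let ?w = "2 * of_real pi * \<i> * of_real (real_of_int m)"
    have "fourier_coeff f' (of_int m) = ?w * fourier_coeff f (of_int m)"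
      using fourier_coeff_derivative[of f f' "of_int m"] f cont per[of 0] by (simp add: fchar_minus)
    moreover have "fourier_coeff f'' (of_int m) = ?w * fourier_coeff f' (of_int m)"
      using fourier_coeff_derivative[of f' f'' "of_int m"] f' cont per'[of 0] by (simp add: fchar_minus)
    ultimately have "fourier_coeff f'' (of_int m) = ?w * (?w * fourier_coeff f (of_int m))" by simp
    then have "norm (?w * (?w * fourier_coeff f (of_int m))) \<le> B"
      using fourier_coeff_bound[OF cont(3) B(2), of "of_int m"] by simp
    then have "(2 * pi)\<^sup>2 * ((real_of_int m)\<^sup>2 * norm (fourier_coeff f (of_int m))) \<le> B"
      by (simp add: norm_mult power2_eq_square mult_ac flip: abs_mult)
    moreover have "1 \<le> (2 * pi)\<^sup>2" using pi_gt3 by (intro one_le_power) linarith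
    then have "1 * ((real_of_int m)\<^sup>2 * norm (fourier_coeff f (of_int m)))
        \<le> (2 * pi)\<^sup>2 * ((real_of_int m)\<^sup>2 * norm (fourier_coeff f (of_int m)))"
      by (intro mult_right_mono) auto
    ultimately have "(real_of_int m)\<^sup>2 * norm (fourier_coeff f (of_int m)) \<le> B" by linarith
    then show "norm (?c m) \<le> B / (real_of_int m)\<^sup>2"
      using m by (simp add: norm_mult field_simps)
  qed
  then obtain S where S: "(?c has_sum S) UNIV" by (auto simp: summable_on_def)
  then have lim1: "(\<lambda>N. \<Sum>m=-int N..int N. ?c m) \<longlonglongrightarrow> S"
    unfolding has_sum_def by (rule filterlim_compose[OF _ filterlim_symmetric_intervals])
  define g where "g = (\<lambda>t. if fchar 1 (t - x) = 1 then f' t / (2 * of_real pi * \<i>) else (f t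
      - f x) / (fchar 1 (t - x) - 1))"
  have cg: "continuous_on A g" for A
    using chernoff_quotient_continuous[OF f per, of x] unfolding g_def[symmetric] by (rule continuous_on_subset) simp
  \<comment> \<open>The definition of the quotient, solved for \<open>f\<close>; it also holds at the singularities.\<close>
  have fg: "f t = f x + (g t * fchar 1 t * fchar 1 (- x) - g t)" for t
  proof (cases "fchar 1 (t - x) = 1")
    case True
    then obtain m :: int where m: "t - x = of_int m" by (auto simp: fchar_eq_1_iff elim: Ints_cases)
    have "f t = f x" using periodic_int[of f x m] per m by (simp add: algebra_simps)
    then show ?thesis using True fchar_add(2)[of 1 t "- x"] by (simp add: mult.assoc)
  next
    case False
    then have "g t * (fchar 1 (t - x) - 1) = f t - f x" by (simp add: g_def)
    then show ?thesis using fchar_add(2)[of 1 t "- x"] by (simp add: algebra_simps)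
  qed
  define h where "h = (\<lambda>m::int. fourier_coeff g (of_int m) * fchar (of_int m) x)"
  have c1: "fourier_coeff (\<lambda>_. 1) (of_int m) = (if m = 0 then 1 else 0)" for m
  proof (cases "m = 0")
    case True then show ?thesis by (simp add: fourier_coeff_def)
  next
    case False
    have "fourier_coeff (\<lambda>_. 0) (of_int m) = 2 * of_real pi * \<i> * of_real (of_int m) * fourier_coeff (\<lambda>_. 1)
        (of_int m) + (1 * fchar (- of_int m) 1 - 1)"
      by (rule fourier_coeff_derivative) auto
    then show ?thesis using False by (simp add: fourier_coeff_def fchar_minus)
  qed
  have ch: "?c m = (if m = 0 then f x else 0) + (h (m - 1) - h m)" for m
  proof -
    have i: "(\<lambda>t. F t * fchar y t) integrable_on {0..1}" if "continuous_on {0..1} F" for F y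
      by (intro integrable_continuous_interval continuous_intros that)
    have sh: "fchar 1 t * fchar (- of_int m) t = fchar (1 - of_int m) t" for t
      using fchar_add(1)[of 1 "- of_int m" t] by simp
    have e: "f t * fchar (- of_int m) t = f x * (1 * fchar (- of_int m) t)
        + (fchar 1 (- x) * (g t * fchar (- of_int (m - 1)) t) - g t * fchar (- of_int m) t)" for t
      by (subst fg[of t]) (simp add: sh[symmetric] algebra_simps)
    have A: "fourier_coeff f (of_int m) = f x * fourier_coeff (\<lambda>_. 1) (of_int m)
        + (fchar 1 (- x) * fourier_coeff g (of_int (m - 1)) - fourier_coeff g (of_int m))"
    proof -
      have "fourier_coeff f (of_int m) = integral {0..1} (\<lambda>t. f x * (1 * fchar (- of_int m) t)) +
        (integral {0..1} (\<lambda>t. fchar 1 (- x) * (g t * fchar (- of_int (m - 1)) t))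
            - integral {0..1} (\<lambda>t. g t * fchar (- of_int m) t))"
        unfolding fourier_coeff_def e
        by (subst integral_add, (intro integrable_on_mult_right integrable_diff i cg continuous_intros)+, subst
            integral_diff,
            (intro integrable_on_mult_right integrable_diff i cg continuous_intros)+, rule refl)
      then show ?thesis by (simp only: fourier_coeff_def integral_mult_right)
    qed
    have B: "fchar 1 (- x) * fchar (of_int m) x = fchar (of_int (m - 1)) x"
      using fchar_add(1)[of "- 1" "of_int m" x] by (simp add: fchar_minus algebra_simps)
    have "?c m = f x * fourier_coeff (\<lambda>_. 1) (of_int m) * fchar (of_int m) x
      + (fourier_coeff g (of_int (m - 1)) * (fchar 1 (- x) * fchar (of_int m) x)
          - fourier_coeff g (of_int m) * fchar (of_int m) x)"
      unfolding A by (simp only: algebra_simps)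
    then show ?thesis unfolding B c1 h_def by simp
  qed
  have "(\<Sum>m=-int N..int N. ?c m) = f x + (h (- int N - 1) - h (int N))" for N
  proof -
    have "(\<Sum>m=-int N..int N. ?c m) = (\<Sum>m=-int N..int N. if m = 0 then f x else 0) + (\<Sum>m=-int N..int N. h (m - 1)
        - h m)"
      unfolding ch by (rule sum.distrib)
    also have "(\<Sum>m=-int N..int N. if m = 0 then f x else 0) = f x" by (simp add: sum.delta)
    finally show ?thesis by (simp only: sum_telescope_int)
  qed
  moreover have "(\<lambda>N. f x + (h (- int N - 1) - h (int N))) \<longlonglongrightarrow> f x + (0 - 0)"
  proof (intro tendsto_intros)
    have "(\<lambda>N. norm (fourier_coeff g (real N))) \<longlonglongrightarrow> 0"
      using riemann_lebesgue(1)[OF cg] by (rule tendsto_norm_zero)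
    then have "(\<lambda>N. norm (h (int N))) \<longlonglongrightarrow> 0" by (simp add: h_def norm_mult)
    then show "(\<lambda>N. h (int N)) \<longlonglongrightarrow> 0" by (rule tendsto_norm_zero_cancel)
    have "(\<lambda>N. norm (fourier_coeff g (- real (Suc N)))) \<longlonglongrightarrow> 0"
      using riemann_lebesgue(2)[OF cg] by (intro tendsto_norm_zero) (rule LIMSEQ_Suc)
    moreover have "norm (h (- int N - 1)) = norm (fourier_coeff g (- real (Suc N)))" for N
      by (simp add: h_def norm_mult algebra_simps minus_diff_commute)
    ultimately have "(\<lambda>N. norm (h (- int N - 1))) \<longlonglongrightarrow> 0" by simp
    then show "(\<lambda>N. h (- int N - 1)) \<longlonglongrightarrow> 0" by (rule tendsto_norm_zero_cancel)
  qed
  ultimately have "S = f x + (0 - 0)" using lim1 LIMSEQ_unique by auto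
  with S show ?thesis by simp
qed

section \<open>Laplace transforms on the half-line\<close>

definition half_line :: "real measure" where
  "half_line = restrict_space lborel {0<..}"

lemma space_half_line [simp]: "space half_line = {0<..}"
  by (simp add: half_line_def space_restrict_space)

lemma half_line_measurable:
  fixes f :: "real \<Rightarrow> 'a::{banach,second_countable_topology}"
  assumes "continuous_on {0<..} f"
  shows "f \<in> borel_measurable half_line"
proof -
  have "f \<in> borel_measurable (restrict_space borel {0<..})"
    by (rule borel_measurable_continuous_on_restrict[OF assms])
  moreover have "sets (restrict_space borel {0<..}) = sets half_line"
    unfolding half_line_def by (intro sets_restrict_space_cong) simp
  ultimately show ?thesis by (simp cong: measurable_cong_sets)
qed

lemma half_line_AE: "(\<And>s. s > 0 \<Longrightarrow> P s) \<Longrightarrow> AE s in half_line. P s"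
  by (rule AE_I2) simp

lemma integrable_half_line_powr:
  assumes "Re z > 0" "\<delta> > 0"
  shows "integrable half_line (\<lambda>s. of_real (exp (- \<delta> * s)) * (of_real s powr (z - 1)) :: complex)"
proof -
  have "complex_set_integrable lebesgue {0<..} (\<lambda>t. complex_of_real t powr (z - 1) / complex_of_real (exp (\<delta> * t)))"
    by (rule absolutely_integrable_Gamma_integral[OF assms])
  moreover have "complex_of_real t powr (z - 1) / complex_of_real (exp (\<delta> * t))
      = of_real (exp (- \<delta> * t)) * (of_real t powr (z - 1))" for t
    by (simp add: exp_minus field_simps)
  ultimately have *: "integrable lebesgue (\<lambda>t. indicat_real {0<..} t *\<^sub>R (of_real (exp (- \<delta> * t)) *
      (complex_of_real t powr (z - 1))))"
    unfolding set_integrable_def by (simp only:)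
  have m: "(\<lambda>t. indicat_real {0<..} t *\<^sub>R (of_real (exp (- \<delta> * t)) * (complex_of_real t powr (z - 1)))) \<in>
      borel_measurable lborel"
    unfolding measurable_lborel2
    by (rule borel_measurable_continuous_on_indicator) (auto intro!: continuous_intros)
  have "integrable lborel (\<lambda>t. indicat_real {0<..} t *\<^sub>R (of_real (exp (- \<delta> * t)) * (complex_of_real t powr (z
      - 1))))"
    using integrable_completion[OF m] * by simp
  then show ?thesis
    unfolding half_line_def by (subst integrable_restrict_space) auto
qed

lemma integral_half_line_stretch:
  fixes f :: "real \<Rightarrow> complex"
  assumes "t > 0"
  shows "integral\<^sup>L half_line f = of_real t * integral\<^sup>L half_line (\<lambda>s. f (t * s))"
proof -
  have "integral\<^sup>L half_line f = (\<integral>x. indicat_real {0<..} x *\<^sub>R f x \<partial>lborel)"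
    unfolding half_line_def by (subst integral_restrict_space) auto
  also have "\<dots> = \<bar>t\<bar> *\<^sub>R (\<integral>x. indicat_real {0<..} (0 + t * x) *\<^sub>R f (0 + t * x) \<partial>lborel)"
    by (rule lborel_integral_real_affine) (use assms in auto)
  also have "(\<lambda>x. indicat_real {0<..} (0 + t * x) *\<^sub>R f (0 + t * x)) = (\<lambda>x. indicat_real {0<..} x *\<^sub>R f (t * x))"
    using assms by (auto simp: indicator_def zero_less_mult_iff)
  also have "(\<integral>x. indicat_real {0<..} x *\<^sub>R f (t * x) \<partial>lborel) = integral\<^sup>L half_line (\<lambda>s. f (t * s))"
    unfolding half_line_def by (subst integral_restrict_space) auto
  finally show ?thesis using assms by (simp add: scaleR_conv_of_real)
qed

lemma Gamma_half_line:
  assumes "Re z > 0"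
  shows "integral\<^sup>L half_line (\<lambda>s. of_real (exp (- s)) * (of_real s powr (z - 1))) = Gamma z"
proof -
  let ?f = "\<lambda>t. complex_of_real t powr (z - 1) / complex_of_real (exp t)"
  have ai: "complex_set_integrable lebesgue {0<..} ?f"
    by (rule absolutely_integrable_Gamma_integral'[OF assms])
  have hi: "(?f has_integral Gamma z) {0<..}"
    by (rule Gamma_integral_complex'[OF assms])
  have m: "(\<lambda>t. indicat_real {0<..} t *\<^sub>R ?f t) \<in> borel_measurable lborel"
    unfolding measurable_lborel2
    by (rule borel_measurable_continuous_on_indicator) (auto intro!: continuous_intros)
  have e: "complex_of_real t powr (z - 1) / complex_of_real (exp t) = of_real (exp (- t)) * (of_real t powr (z
      - 1))" for t
    by (simp add: exp_minus field_simps)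
  have "Gamma z = (LINT x:{0<..}|lebesgue. ?f x)"
    using set_lebesgue_integral_eq_integral(2)[OF ai] hi by (metis integral_unique)
  also have "\<dots> = integral\<^sup>L lborel (\<lambda>t. indicat_real {0<..} t *\<^sub>R ?f t)"
    unfolding set_lebesgue_integral_def by (rule integral_completion[OF m])
  also have "\<dots> = integral\<^sup>L half_line ?f"
    unfolding half_line_def by (subst integral_restrict_space) auto
  finally show ?thesis unfolding e by simp
qed

text \<open>
  The functions whose Laplace transform converges absolutely for all positive arguments, however
  small.  The class is closed under multiplication by the variable, which is what differentiation of
  the transform requires.
\<close>

definition laplace_ok :: "(real \<Rightarrow> complex) \<Rightarrow> bool" where
  "laplace_ok \<phi> \<longleftrightarrow> continuous_on {0<..} \<phi> \<and>
     (\<forall>\<delta>>0. integrable half_line (\<lambda>s. of_real (exp (- \<delta> * s)) * \<phi> s))"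

definition laplace :: "(real \<Rightarrow> complex) \<Rightarrow> real \<Rightarrow> complex" where
  "laplace \<phi> t = integral\<^sup>L half_line (\<lambda>s. of_real (exp (- t * s)) * \<phi> s)"

lemma laplace_okD:
  "laplace_ok \<phi> \<Longrightarrow> \<delta> > 0 \<Longrightarrow> integrable half_line (\<lambda>s. of_real (exp (- \<delta> * s)) * \<phi> s)"
  by (simp add: laplace_ok_def)

lemma laplace_ok_powr:
  assumes "Re z > 0"
  shows "laplace_ok (\<lambda>s. of_real s powr (z - 1))"
  unfolding laplace_ok_def
proof (intro conjI allI impI)
  show "integrable half_line (\<lambda>s. complex_of_real (exp (- \<delta> * s)) * of_real s powr (z - 1))" if "\<delta> > 0" for \<delta>
    by (rule integrable_half_line_powr[OF assms that])
qed (auto intro!: continuous_intros)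

lemma laplace_ok_bound:
  assumes "laplace_ok \<psi>" "continuous_on {0<..} \<phi>" "\<And>s. s > 0 \<Longrightarrow> norm (\<phi> s) \<le> norm (\<psi> s)"
  shows "laplace_ok \<phi>"
  unfolding laplace_ok_def
proof (intro conjI allI impI)
  fix \<delta> :: real assume d: "\<delta> > 0"
  have "integrable half_line (\<lambda>s. of_real (exp (- \<delta> * s)) * \<psi> s)"
    using assms d by (simp add: laplace_ok_def)
  then show "integrable half_line (\<lambda>s. of_real (exp (- \<delta> * s)) * \<phi> s)"
  proof (rule Bochner_Integration.integrable_bound)
    show "(\<lambda>s. of_real (exp (- \<delta> * s)) * \<phi> s) \<in> borel_measurable half_line"
      by (rule half_line_measurable) (intro continuous_intros assms)
  qed (auto intro!: half_line_AE mult_left_mono assms simp: norm_mult simp del: of_real_exp)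
qed (rule assms)

lemma laplace_ok_times:
  assumes "laplace_ok \<phi>"
  shows "laplace_ok (\<lambda>s. of_real s * \<phi> s)"
  unfolding laplace_ok_def
proof (intro conjI allI impI)
  have c: "continuous_on {0<..} \<phi>" using assms by (simp add: laplace_ok_def)
  show c': "continuous_on {0<..} (\<lambda>s. of_real s * \<phi> s)"
    by (intro continuous_intros c)
  fix \<delta> :: real assume d: "\<delta> > 0"
  have "integrable half_line (\<lambda>s. of_real (2 / \<delta>) * (of_real (exp (- (\<delta> / 2) * s)) * \<phi> s))"
    by (intro integrable_mult_right laplace_okD assms) (use d in simp)
  then show "integrable half_line (\<lambda>s. of_real (exp (- \<delta> * s)) * (of_real s * \<phi> s))"
  proof (rule Bochner_Integration.integrable_bound)
    show "(\<lambda>s. of_real (exp (- \<delta> * s)) * (of_real s * \<phi> s)) \<in> borel_measurable half_line"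
      by (rule half_line_measurable) (intro continuous_intros c)
    show "AE s in half_line. norm (of_real (exp (- \<delta> * s)) * (of_real s * \<phi> s))
       \<le> norm (of_real (2 / \<delta>) * (of_real (exp (- (\<delta> / 2) * s)) * \<phi> s))"
    proof (rule half_line_AE)
      fix s :: real assume s: "s > 0"
      have "\<delta> / 2 * s \<le> exp (\<delta> / 2 * s)"
        using exp_ge_add_one_self[of "\<delta> / 2 * s"] by linarith
      then have "exp (- \<delta> * s) * (\<delta> / 2 * s) \<le> exp (- \<delta> * s) * exp (\<delta> / 2 * s)"
        by (intro mult_left_mono) auto
      also have "\<dots> = exp (- (\<delta> / 2) * s)" by (simp add: mult_exp_exp field_simps)
      finally have "exp (- \<delta> * s) * s \<le> 2 / \<delta> * exp (- (\<delta> / 2) * s)"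
        using d by (simp add: field_simps)
      then have "exp (- \<delta> * s) * s * norm (\<phi> s) \<le> 2 / \<delta> * exp (- (\<delta> / 2) * s) * norm (\<phi> s)"
        by (intro mult_right_mono) auto
      then show "norm (of_real (exp (- \<delta> * s)) * (of_real s * \<phi> s))
       \<le> norm (of_real (2 / \<delta>) * (of_real (exp (- (\<delta> / 2) * s)) * \<phi> s))"
        using s d by (simp add: norm_mult norm_divide mult.assoc del: of_real_exp of_real_divide)
    qed
  qed
qed

lemma laplace_ok_add:
  assumes "laplace_ok \<phi>" "laplace_ok \<psi>"
  shows "laplace_ok (\<lambda>s. \<phi> s + \<psi> s)"
  using assms unfolding laplace_ok_def
  by (auto intro!: continuous_intros simp: ring_distribs simp del: of_real_exp)

text \<open>
  The factor \<open>(1 + s)\<^sup>c\<close> is dominated by a natural power of \<open>1 + s\<close>, and such powers only multiply by the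
  variable and add.
\<close>

lemma laplace_ok_kernel:
  assumes "Re a > 0"
  shows "laplace_ok (\<lambda>s. of_real s powr (a - 1) * of_real (1 + s) powr c)"
proof -
  have 1: "laplace_ok (\<lambda>s. of_real (1 + s) ^ N * of_real s powr (a - 1))" for N
  proof (induction N)
    case 0 then show ?case using laplace_ok_powr[OF assms] by simp
  next
    case (Suc N)
    from laplace_ok_add[OF Suc laplace_ok_times[OF Suc]] show ?case
      by (simp add: algebra_simps)
  qed
  define N where "N = nat \<lceil>Re c\<rceil>"
  show ?thesis
  proof (rule laplace_ok_bound[OF 1[of N]])
    fix s :: real assume s: "s > 0"
    have "(1 + s) powr Re c \<le> (1 + s) powr of_nat N"
      by (rule powr_mono) (use s in \<open>auto simp: N_def le_nat_iff of_nat_ceiling\<close>)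
    also have "\<dots> = (1 + s) ^ N" using s by (simp add: powr_realpow)
    finally have "(1 + s) powr Re c \<le> (1 + s) ^ N" .
    moreover have "norm (complex_of_real (1 + s) powr c) = (1 + s) powr Re c"
      using s by (subst norm_powr_real_powr) auto
    moreover have "norm (complex_of_real (1 + s) ^ N) = (1 + s) ^ N"
      unfolding norm_power norm_of_real using s by simp
    ultimately show "norm (of_real s powr (a - 1) * of_real (1 + s) powr c)
         \<le> norm (of_real (1 + s) ^ N * complex_of_real s powr (a - 1))"
      by (simp only: norm_mult) (metis mult.commute mult_left_mono norm_ge_zero)
  qed (auto intro!: continuous_intros simp: complex_eq_iff)
qed

text \<open>
  The second order remainder of \<open>e\<^sup>-\<^sup>y\<^sup>s\<close> at \<open>t\<close> is at most \<open>(y - t)\<^sup>2 s\<^sup>2 e\<^sup>-\<^sup>t\<^sup>s\<^sup>/\<^sup>2\<close> when \<open>y\<close> is within \<open>t/2\<close>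
  of \<open>t\<close>, and this majorant is integrable against the transformed function.
\<close>

lemma has_vector_derivative_laplace:
  assumes ok: "laplace_ok \<phi>" and t: "t > 0"
  shows "(laplace \<phi> has_vector_derivative - laplace (\<lambda>s. of_real s * \<phi> s) t) (at t)"
proof -
  have ok1: "laplace_ok (\<lambda>s. of_real s * \<phi> s)" by (rule laplace_ok_times[OF ok])
  have ok2: "laplace_ok (\<lambda>s. of_real s * (of_real s * \<phi> s))" by (rule laplace_ok_times[OF ok1])
  \<comment> \<open>The constant in the quadratic remainder; half of the exponent is spent on \<open>|y - t| \<le> t/2\<close>.\<close>
  define K where "K = integral\<^sup>L half_line (\<lambda>s. norm (of_real (exp (- (t/2) * s)) * (of_real s * (of_real s * \<phi> s))))"
  have K: "K \<ge> 0" unfolding K_def by simp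
  have int: "integrable half_line (\<lambda>s. of_real (exp (- x * s)) * \<psi> s)" if "laplace_ok \<psi>" "x > 0" for x \<psi>
    using that by (simp add: laplace_ok_def)
  have key: "norm (laplace \<phi> y - laplace \<phi> t + (y - t) *\<^sub>R laplace (\<lambda>s. of_real s * \<phi> s) t) \<le> (y - t)\<^sup>2 * K"
    if y: "\<bar>y - t\<bar> \<le> t / 2" for y
  proof -
    have y0: "y > 0" using y t by (simp add: abs_if split: if_splits)
    have i1: "integrable half_line (\<lambda>s. of_real (exp (- y * s)) * \<phi> s)"
         and i2: "integrable half_line (\<lambda>s. of_real (exp (- t * s)) * \<phi> s)"
         and i3: "integrable half_line (\<lambda>s. (y - t) *\<^sub>R (of_real (exp (- t * s)) * (of_real s * \<phi> s)))"
      by (intro integrable_scaleR_right int ok ok1 y0 t)+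
    have i4: "integrable half_line (\<lambda>s. of_real (exp (- y * s)) * \<phi> s - of_real (exp (- t * s)) * \<phi> s
               + (y - t) *\<^sub>R (of_real (exp (- t * s)) * (of_real s * \<phi> s)))"
      by (intro Bochner_Integration.integrable_add Bochner_Integration.integrable_diff i1 i2 i3)
    have eq: "laplace \<phi> y - laplace \<phi> t + (y - t) *\<^sub>R laplace (\<lambda>s. of_real s * \<phi> s) t =
      integral\<^sup>L half_line (\<lambda>s. of_real (exp (- y * s)) * \<phi> s - of_real (exp (- t * s)) * \<phi> s
               + (y - t) *\<^sub>R (of_real (exp (- t * s)) * (of_real s * \<phi> s)))"
      unfolding laplace_def
      by (simp only: Bochner_Integration.integral_add[OF Bochner_Integration.integrable_diff[OF i1 i2] i3]
          Bochner_Integration.integral_diff[OF i1 i2] integral_scaleR_right)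
    have "norm (laplace \<phi> y - laplace \<phi> t + (y - t) *\<^sub>R laplace (\<lambda>s. of_real s * \<phi> s) t)
       \<le> integral\<^sup>L half_line (\<lambda>s. (y - t)\<^sup>2 * norm (of_real (exp (- (t/2) * s)) * (of_real s * (of_real s * \<phi> s))))"
      unfolding eq
    proof (rule Bochner_Integration.integral_norm_bound_integral[OF i4])
      show "integrable half_line (\<lambda>s. (y - t)\<^sup>2 * norm (of_real (exp (- (t/2) * s)) * (of_real s * (of_real s *
          \<phi> s))))"
        by (intro integrable_mult_right integrable_norm int ok2) (use t in auto)
      fix s assume "s \<in> space half_line"
      then have s: "s > 0" by simp
      define x where "x = - (y - t) * s"
      have "norm (exp x - (\<Sum>i\<le>1. x ^ i / fact i)) \<le> exp (norm x) * norm x ^ Suc 1 / fact 1"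
        by (rule Taylor_exp_field)
      then have T: "\<bar>exp x - 1 - x\<bar> \<le> exp \<bar>x\<bar> * x\<^sup>2"
        by (simp add: power2_eq_square algebra_simps)
      have "\<bar>x\<bar> = \<bar>y - t\<bar> * s" using s by (simp add: x_def abs_mult abs_minus_commute)
      then have "\<bar>x\<bar> \<le> t / 2 * s" using mult_right_mono[OF y, of s] s by simp
      then have "exp \<bar>x\<bar> * x\<^sup>2 \<le> exp (t / 2 * s) * x\<^sup>2" by (intro mult_right_mono) auto
      with T have "\<bar>exp x - 1 - x\<bar> \<le> exp (t / 2 * s) * x\<^sup>2" by linarith
      then have "exp (- t * s) * \<bar>exp x - 1 - x\<bar> \<le> exp (- t * s) * (exp (t / 2 * s) * x\<^sup>2)"
        by (intro mult_left_mono) auto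
      also have "\<dots> = exp (- (t / 2) * s) * ((y - t)\<^sup>2 * s\<^sup>2)"
      proof -
        have "exp (- t * s) * exp (t / 2 * s) = exp (- (t / 2) * s)"
          by (simp add: mult_exp_exp field_simps)
        moreover have "x\<^sup>2 = (y - t)\<^sup>2 * s\<^sup>2"
          unfolding x_def power_mult_distrib by (simp add: power2_commute)
        ultimately show ?thesis by (simp only: mult.assoc[symmetric])
      qed
      finally have *: "exp (- t * s) * \<bar>exp x - 1 - x\<bar> \<le> exp (- (t / 2) * s) * ((y - t)\<^sup>2 * s\<^sup>2)" .
      have ey: "exp (- y * s) = exp (- t * s) * exp x"
        by (simp add: x_def algebra_simps flip: exp_add)
      have "of_real (exp (- y * s)) * \<phi> s - of_real (exp (- t * s)) * \<phi> s
               + (y - t) *\<^sub>R (of_real (exp (- t * s)) * (of_real s * \<phi> s))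
          = of_real (exp (- t * s) * (exp x - 1 - x)) * \<phi> s"
        unfolding ey by (simp add: x_def algebra_simps scaleR_conv_of_real del: of_real_exp)
      then have "norm (of_real (exp (- y * s)) * \<phi> s - of_real (exp (- t * s)) * \<phi> s
               + (y - t) *\<^sub>R (of_real (exp (- t * s)) * (of_real s * \<phi> s)))
           = exp (- t * s) * \<bar>exp x - 1 - x\<bar> * norm (\<phi> s)"
        by (simp only: norm_mult norm_of_real abs_mult) simp
      also have "\<dots> \<le> exp (- (t / 2) * s) * ((y - t)\<^sup>2 * s\<^sup>2) * norm (\<phi> s)"
        by (intro mult_right_mono *) auto
      also have "\<dots> = (y - t)\<^sup>2 * norm (of_real (exp (- (t/2) * s)) * (of_real s * (of_real s * \<phi> s)))"
        using s by (simp add: norm_mult power2_eq_square del: of_real_exp)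
      finally show "norm (of_real (exp (- y * s)) * \<phi> s - of_real (exp (- t * s)) * \<phi> s
               + (y - t) *\<^sub>R (of_real (exp (- t * s)) * (of_real s * \<phi> s)))
          \<le> (y - t)\<^sup>2 * norm (of_real (exp (- (t/2) * s)) * (of_real s * (of_real s * \<phi> s)))" .
    qed
    also have "\<dots> = (y - t)\<^sup>2 * K" unfolding K_def by simp
    finally show ?thesis .
  qed
  show ?thesis
    unfolding has_vector_derivative_def has_derivative_at_alt
  proof (intro conjI allI impI)
    show "bounded_linear (\<lambda>x. x *\<^sub>R - laplace (\<lambda>s. of_real s * \<phi> s) t)"
      by (rule bounded_linear_scaleR_left)
    fix e :: real assume e: "e > 0"
    define d where "d = min (t / 2) (e / (K + 1))"
    show "\<exists>d>0. \<forall>y. norm (y - t) < d \<longrightarrow>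
        norm (laplace \<phi> y - laplace \<phi> t - (y - t) *\<^sub>R - laplace (\<lambda>s. of_real s * \<phi> s) t) \<le> e * norm (y - t)"
    proof (intro exI[of _ d] conjI allI impI)
      show "d > 0" using t e K by (simp add: d_def)
      fix y assume y: "norm (y - t) < d"
      then have 1: "\<bar>y - t\<bar> \<le> t / 2" and 2: "\<bar>y - t\<bar> \<le> e / (K + 1)" by (auto simp: d_def)
      have "\<bar>y - t\<bar> * K \<le> e / (K + 1) * K" using 2 K by (intro mult_right_mono)
      also have "\<dots> \<le> e" using e K by (simp add: field_simps)
      finally have "\<bar>y - t\<bar> * K \<le> e" .
      then have "\<bar>y - t\<bar> * (\<bar>y - t\<bar> * K) \<le> \<bar>y - t\<bar> * e" by (intro mult_left_mono) auto
      then have "(y - t)\<^sup>2 * K \<le> e * norm (y - t)"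
      proof -
        have "(y - t)\<^sup>2 = \<bar>y - t\<bar> * \<bar>y - t\<bar>" by (simp add: power2_eq_square)
        then show ?thesis
          using \<open>\<bar>y - t\<bar> * (\<bar>y - t\<bar> * K) \<le> \<bar>y - t\<bar> * e\<close> by (simp only: mult_ac real_norm_def)
      qed
      with key[OF 1] show "norm (laplace \<phi> y - laplace \<phi> t - (y - t) *\<^sub>R - laplace (\<lambda>s. of_real s * \<phi> s) t)
          \<le> e * norm (y - t)"
        by simp
    qed
  qed
qed

section \<open>Tricomi's integral and the recessive Whittaker function\<close>

text \<open>
  A solution of Whittaker's equation together with its derivative.  Carrying the derivative along gives
  Wronskians and asymptotics of derivatives without choosing derivatives anew.
\<close>

definition whittaker_pair :: "complex \<Rightarrow> complex \<Rightarrow> (real \<Rightarrow> complex) \<Rightarrow> (real \<Rightarrow> complex) \<Rightarrow> bool" where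
  "whittaker_pair \<kappa> \<nu> G G' \<longleftrightarrow> (\<forall>y>0.
     (G has_vector_derivative G' y) (at y) \<and>
     (G' has_vector_derivative (1/4 - \<kappa> / of_real y - (1/4 - \<nu>\<^sup>2) / of_real (y\<^sup>2)) * G y) (at y))"

lemma whittaker_solution_iff_pair:
  "whittaker_solution \<kappa> \<nu> G \<longleftrightarrow> (\<exists>G'. whittaker_pair \<kappa> \<nu> G G')"
proof
  assume "whittaker_solution \<kappa> \<nu> G"
  then obtain G' G'' where *: "\<And>y. y > 0 \<Longrightarrow> (G has_vector_derivative G' y) (at y) \<and>
        (G' has_vector_derivative G'' y) (at y) \<and>
        G'' y + (- 1/4 + \<kappa> / of_real y + (1/4 - \<nu>\<^sup>2) / of_real (y\<^sup>2)) * G y = 0"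
    unfolding whittaker_solution_def by blast
  have "G'' y = (1/4 - \<kappa> / of_real y - (1/4 - \<nu>\<^sup>2) / of_real (y\<^sup>2)) * G y" if "y > 0" for y
    using *[OF that] by (simp add: eq_neg_iff_add_eq_0[symmetric] algebra_simps)
  then show "\<exists>G'. whittaker_pair \<kappa> \<nu> G G'"
    unfolding whittaker_pair_def using * by metis
next
  assume "\<exists>G'. whittaker_pair \<kappa> \<nu> G G'"
  then obtain G' where *: "whittaker_pair \<kappa> \<nu> G G'" ..
  show "whittaker_solution \<kappa> \<nu> G"
    unfolding whittaker_solution_def
    by (rule exI[of _ G'], rule exI[of _ "\<lambda>y. (1/4 - \<kappa> / of_real y - (1/4 - \<nu>\<^sup>2) / of_real (y\<^sup>2)) * G y"])
       (use * in \<open>auto simp: whittaker_pair_def algebra_simps\<close>)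
qed

lemma whittaker_weight_derivative:
  fixes p :: complex
  assumes t: "t > 0"
  shows "((\<lambda>t. of_real (exp (- t / 2)) * of_real t powr p) has_vector_derivative
     of_real (exp (- t / 2)) * of_real t powr p * (p / of_real t - 1/2)) (at t)"
proof -
  have "((\<lambda>z. exp (- z / 2) * z powr p) has_field_derivative
      exp (- of_real t / 2) * (p * of_real t powr (p - 1)) + (exp (- of_real t / 2) * (- 1 / 2)) * of_real t
          powr p) (at (of_real t))"
    using t by (auto intro!: derivative_eq_intros)
  moreover have "of_real t powr (p - 1) = of_real t powr p / complex_of_real t"
    using t by (simp add: powr_diff)
  ultimately have "((\<lambda>z. exp (- z / 2) * z powr p) has_field_derivative
      exp (- of_real t / 2) * of_real t powr p * (p / of_real t - 1/2)) (at (of_real t))"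
    by (simp add: field_simps)
  from has_vector_derivative_real_field[OF this, of UNIV] show ?thesis
    by (simp flip: exp_of_real)
qed

text \<open>
  What remains of the transformation after the weight has been cancelled.  Here \<open>i\<close> stands for \<open>1/t\<close>,
  which turns the identity into one between polynomials.
\<close>

lemma kummer_whittaker_identity:
  fixes T i p \<kappa> u v :: complex
  assumes "T * i = 1"
  shows "((p - \<kappa>) * u - (2 * p - T) * v) * i + ((p * i - 1/2) * v + (- p * i\<^sup>2) * u)
     + (p * i - 1/2) * (v + (p * i - 1/2) * u) = (1/4 - \<kappa> * i - (1/4 - (p - 1/2)\<^sup>2) * i\<^sup>2) * u"
proof -
  have "((p - \<kappa>) * u - (2 * p - T) * v) * i + ((p * i - 1/2) * v + (- p * i\<^sup>2) * u)
     + (p * i - 1/2) * (v + (p * i - 1/2) * u) - (1/4 - \<kappa> * i - (1/4 - (p - 1/2)\<^sup>2) * i\<^sup>2) * u = (T * i - 1) * v"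
    by algebra
  then show ?thesis using assms by simp
qed
text \<open>
  Whittaker's equation is Kummer's equation with the first order term removed by the weight
  \<open>e\<^sup>-\<^sup>t\<^sup>/\<^sup>2 t\<^sup>1\<^sup>/\<^sup>2\<^sup>+\<^sup>\<nu>\<close>.
\<close>

lemma whittaker_pair_kummer:
  assumes U: "\<And>t. t > 0 \<Longrightarrow> (U has_vector_derivative U1 t) (at t)"
    "\<And>t. t > 0 \<Longrightarrow> (U1 has_vector_derivative U2 t) (at t)"
    and ode: "\<And>t. t > 0 \<Longrightarrow> of_real t * U2 t + (b - of_real t) * U1 t - a * U t = 0"
    and a: "a = 1/2 + \<nu> - \<kappa>" and b: "b = 1 + 2 * \<nu>"
  shows "whittaker_pair \<kappa> \<nu>
    (\<lambda>t. of_real (exp (- t / 2)) * of_real t powr (1/2 + \<nu>) * U t)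
    (\<lambda>t. of_real (exp (- t / 2)) * of_real t powr (1/2 + \<nu>) * (U1 t + ((1/2 + \<nu>) / of_real t - 1/2) * U t))"
  unfolding whittaker_pair_def
proof (intro allI impI conjI)
  fix t :: real assume t: "t > 0"
  define p where "p = 1/2 + \<nu>"
  let ?E = "\<lambda>t. complex_of_real (exp (- t / 2)) * of_real t powr p"
  note E = whittaker_weight_derivative[OF t, of p]
  show "((\<lambda>t. of_real (exp (- t / 2)) * of_real t powr (1/2 + \<nu>) * U t) has_vector_derivative
    of_real (exp (- t / 2)) * of_real t powr (1/2 + \<nu>) * (U1 t + ((1/2 + \<nu>) / of_real t - 1/2) * U t)) (at t)"
    using has_vector_derivative_mult[OF E U(1)[OF t]] unfolding p_def[symmetric]
    by (simp add: algebra_simps)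
  have R: "((\<lambda>t. p / of_real t - 1/2) has_vector_derivative - p / of_real t ^ 2) (at t)"
    by (rule has_vector_derivative_real_field)
       (use t in \<open>auto intro!: derivative_eq_intros simp: power2_eq_square\<close>)
  have V: "((\<lambda>t. U1 t + (p / of_real t - 1/2) * U t) has_vector_derivative
     U2 t + ((p / of_real t - 1/2) * U1 t + (- p / of_real t ^ 2) * U t)) (at t)"
    by (intro has_vector_derivative_add has_vector_derivative_mult U t R)
  have U2: "U2 t = (a * U t - (b - of_real t) * U1 t) / of_real t"
    using ode[OF t] t by (simp add: field_simps)
  have a': "a = p - \<kappa>" and b': "b = 2 * p" and n: "\<nu> = p - 1/2" by (simp_all add: p_def a b)
  define i where "i = 1 / complex_of_real t"
  have ti: "of_real t * i = 1" using t by (simp add: i_def)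
  have c: "p / of_real t = p * i" "- p / of_real t ^ 2 = - p * i\<^sup>2"
    "(a * U t - (b - of_real t) * U1 t) / of_real t = (a * U t - (b - of_real t) * U1 t) * i"
    by (simp_all add: i_def power_divide)
  have "(U2 t + ((p / of_real t - 1/2) * U1 t + (- p / of_real t ^ 2) * U t)) +
     (p / of_real t - 1/2) * (U1 t + (p / of_real t - 1/2) * U t)
     = (1/4 - \<kappa> * i - (1/4 - \<nu>\<^sup>2) * i\<^sup>2) * U t"
    unfolding U2 c unfolding a' b' n by (rule kummer_whittaker_identity[OF ti])
  then have e1: "?E t * (U2 t + ((p / of_real t - 1/2) * U1 t + (- p / of_real t ^ 2) * U t)) +
     ?E t * (p / of_real t - 1/2) * (U1 t + (p / of_real t - 1/2) * U t)
     = ?E t * ((1/4 - \<kappa> * i - (1/4 - \<nu>\<^sup>2) * i\<^sup>2) * U t)"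
    by (simp only: mult.assoc distrib_left[symmetric])
  have e2: "1/4 - \<kappa> * i - (1/4 - \<nu>\<^sup>2) * i\<^sup>2 = 1/4 - \<kappa> / of_real t - (1/4 - \<nu>\<^sup>2) / of_real (t\<^sup>2)"
    by (simp add: i_def power_divide)
  show "((\<lambda>t. of_real (exp (- t / 2)) * of_real t powr (1/2 + \<nu>) * (U1 t + ((1/2 + \<nu>) / of_real t - 1/2) * U t))
      has_vector_derivative
     (1/4 - \<kappa> / of_real t - (1/4 - \<nu>\<^sup>2) / of_real (t\<^sup>2)) *
      (of_real (exp (- t / 2)) * of_real t powr (1/2 + \<nu>) * U t)) (at t)"
    using has_vector_derivative_mult[OF E V] unfolding e1 e2 unfolding p_def[symmetric]
    by (simp only: mult_ac)
qed

text \<open>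
  Up to the factor \<open>\<Gamma>(a)\<close> this is Tricomi's confluent hypergeometric function \<open>U(a, a + c + 1, t)\<close>.
  With \<open>c\<close> instead of the second parameter, differentiation only changes \<open>a\<close>.
\<close>

definition tricomi :: "complex \<Rightarrow> complex \<Rightarrow> real \<Rightarrow> complex" where
  "tricomi a c = laplace (\<lambda>s. of_real s powr (a - 1) * of_real (1 + s) powr c)"

lemma tricomi_derivative:
  assumes "Re a > 0" "t > 0"
  shows "(tricomi a c has_vector_derivative - tricomi (a + 1) c t) (at t)"
proof -
  have "laplace (\<lambda>s. of_real s * (of_real s powr (a - 1) * of_real (1 + s) powr c)) t = tricomi (a + 1) c t"
    unfolding laplace_def tricomi_def
  proof (rule Bochner_Integration.integral_cong)
    fix s assume "s \<in> space half_line"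
    then have "complex_of_real s powr (a - 1 + 1) = of_real s * of_real s powr (a - 1)"
      by (subst powr_add) auto
    then show "of_real (exp (- t * s)) * (of_real s * (of_real s powr (a - 1) * of_real (1 + s) powr c))
      = of_real (exp (- t * s)) * (of_real s powr (a + 1 - 1) * complex_of_real (1 + s) powr c)"
      by (simp add: mult.assoc)
  qed simp
  then show ?thesis
    using has_vector_derivative_laplace[OF laplace_ok_kernel[OF assms(1), of c] assms(2)]
    by (simp add: tricomi_def)
qed

lemma laplace_lincomb:
  assumes "laplace_ok f" "laplace_ok g" "laplace_ok h" "t > 0"
  shows "x * laplace f t + y * laplace g t + z * laplace h t
     = laplace (\<lambda>s. x * f s + y * g s + z * h s) t"
  and "laplace_ok (\<lambda>s. x * f s + y * g s + z * h s)"
proof -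
  note i = assms(1-3)[THEN laplace_okD, OF assms(4)]
  have e: "of_real (exp (- \<delta> * s)) * (x * f s + y * g s + z * h s) = x * (of_real (exp (- \<delta> * s)) * f s)
     + y * (of_real (exp (- \<delta> * s)) * g s) + z * (of_real (exp (- \<delta> * s)) * h s)" for s \<delta>
    by (simp only: ring_distribs mult_ac)
  show "x * laplace f t + y * laplace g t + z * laplace h t
     = laplace (\<lambda>s. x * f s + y * g s + z * h s) t"
    unfolding laplace_def e
    by (simp only: Bochner_Integration.integral_add integrable_mult_right Bochner_Integration.integrable_add
         integral_mult_right_zero i)
  show "laplace_ok (\<lambda>s. x * f s + y * g s + z * h s)"
    unfolding laplace_ok_def e
    using assms(1-3) by (auto simp only: laplace_ok_def intro!: continuous_intros
        Bochner_Integration.integrable_add integrable_mult_right)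
qed

text \<open>
  The left-hand side is the integral of the derivative of \<open>-e\<^sup>-\<^sup>t\<^sup>s s\<^sup>a (1 + s)\<^sup>c\<^sup>+\<^sup>1\<close>, a function that vanishes at
  both ends of the half-line.
\<close>

lemma tricomi_kummer:
  assumes a: "Re a > 0" and t: "t > 0"
  shows "of_real t * tricomi (a + 2) c t - (a + c + 1 - of_real t) * tricomi (a + 1) c t - a * tricomi a c t = 0"
proof -
  let ?k = "\<lambda>a s. of_real s powr (a - 1) * complex_of_real (1 + s) powr c"
  have ok: "laplace_ok (?k a)" "laplace_ok (?k (a+1))" "laplace_ok (?k (a+2))"
    by (rule laplace_ok_kernel, use a in simp)+
  let ?f = "\<lambda>s. of_real (exp (- t * s)) * (of_real t * ?k (a + 2) s + (- (a + c + 1 - of_real t)) * ?k (a+1) s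
      + (- a) * ?k a s)"
  let ?F = "\<lambda>s. - (complex_of_real (exp (- t * s)) * (of_real s powr a * of_real (1 + s) powr (c + 1)))"
  note lc = laplace_lincomb[OF ok(3) ok(2) ok(1) t, of "of_real t" "- (a + c + 1 - of_real t)" "- a"]
  have cont: "continuous_on {0<..} ?f"
  proof (rule continuous_on_mult)
    show "continuous_on {0<..} (\<lambda>s. complex_of_real (exp (- t * s)))" by (intro continuous_intros)
  qed (use lc(2) in \<open>unfold laplace_ok_def, blast\<close>)
  have eq1: "of_real t * tricomi (a + 2) c t - (a + c + 1 - of_real t) * tricomi (a + 1) c t - a * tricomi a c t
     = integral\<^sup>L half_line ?f"
    using lc(1) unfolding tricomi_def laplace_def by (simp only: mult_minus_left add_uminus_conv_diff)
  have int: "set_integrable lborel (einterval 0 \<infinity>) ?f"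
    using laplace_okD[OF lc(2) t] unfolding half_line_def set_integrable_def zero_ereal_def einterval_eq_Ici
    by (subst (asm) integrable_restrict_space) auto
  have "(LBINT s=0..\<infinity>. ?f s) = 0 - 0"
  proof (rule interval_integral_FTC_integrable[where F = ?F])
    fix s assume "(0::ereal) < ereal s" "ereal s < \<infinity>"
    then have s: "s > 0" by simp
    have e1: "of_real s powr a = complex_of_real s * of_real s powr (a - 1)"
      and e2: "complex_of_real (1 + s) powr (c + 1) = of_real (1 + s) * complex_of_real (1 + s) powr c"
      and e3: "of_real s powr (a + 1 - 1) = complex_of_real s * of_real s powr (a - 1)"
      and e4: "of_real s powr (a + 2 - 1) = complex_of_real s ^ 2 * of_real s powr (a - 1)"
      using s by (auto simp: powr_diff powr_add power2_eq_square powr_numeral complex_eq_iff simp del: of_real_add)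
    have D: "((\<lambda>z. - (exp (- of_real t * z) * (z powr a * (1 + z) powr (c + 1)))) has_field_derivative
       - (exp (- of_real t * of_real s) * (of_real s powr a * ((c + 1) * (1 + of_real s) powr c)
            + (a * of_real s powr (a - 1)) * (1 + of_real s) powr (c + 1))
          + (exp (- of_real t * of_real s) * (- of_real t)) * (of_real s powr a * (1 + of_real s) powr (c
              + 1)))) (at (of_real s))"
      using s by (auto intro!: derivative_eq_intros simp: complex_nonpos_Reals_iff)
    have "(?F has_vector_derivative - (exp (- of_real t * of_real s) * (of_real s powr a * ((c + 1) * (1
        + of_real s) powr c)
            + (a * of_real s powr (a - 1)) * (1 + of_real s) powr (c + 1))
          + (exp (- of_real t * of_real s) * (- of_real t)) * (of_real s powr a * (1 + of_real s) powr (c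
              + 1)))) (at s)"
      using has_vector_derivative_real_field[OF D, of UNIV] by (simp flip: exp_of_real)
    moreover have "- (exp (- of_real t * of_real s) * (of_real s powr a * ((c + 1) * (1 + of_real s) powr c)
            + (a * of_real s powr (a - 1)) * (1 + of_real s) powr (c + 1))
          + (exp (- of_real t * of_real s) * (- of_real t)) * (of_real s powr a * (1 + of_real s) powr (c + 1)))
        = ?f s"
      unfolding e1 e3 e4 using e2 by (simp add: algebra_simps power2_eq_square flip: exp_of_real)
    ultimately show "(?F has_vector_derivative ?f s) (at s)" by (simp only:)
    show "isCont ?f s"
      using cont s by (meson continuous_on_eq_continuous_at greaterThan_iff open_greaterThan)
  next
    have n: "norm (?F s) = exp (- t * s) * (s powr Re a * (1 + s) powr (Re c + 1))" if "s > 0" for s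
    proof -
      have "norm (complex_of_real (1 + s) powr (c + 1)) = (1 + s) powr (Re c + 1)"
        using that by (subst norm_powr_real_powr) auto
      moreover have "norm (complex_of_real s powr a) = s powr Re a"
        using that by (subst norm_powr_real_powr) auto
      ultimately show ?thesis by (simp only: norm_minus_cancel norm_mult norm_of_real abs_exp_cancel)
    qed
    have "((\<lambda>s. exp (- t * s) * (s powr Re a * (1 + s) powr (Re c + 1))) \<longlongrightarrow> 0) (at_right 0)"
      using a t by real_asymp
    moreover have "\<forall>\<^sub>F s in at_right 0. exp (- t * s) * (s powr Re a * (1 + s) powr (Re c + 1)) = norm (?F s)"
      using n by (auto simp: eventually_at_filter)
    ultimately have "((\<lambda>s. norm (?F s)) \<longlongrightarrow> 0) (at_right 0)"
      by (rule Lim_transform_eventually)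
    then show "((?F \<circ> real_of_ereal) \<longlongrightarrow> 0) (at_right 0)"
      unfolding zero_ereal_def ereal_tendsto_simps by (rule tendsto_norm_zero_cancel)
    have "((\<lambda>s. exp (- t * s) * (s powr Re a * (1 + s) powr (Re c + 1))) \<longlongrightarrow> 0) at_top"
      using a t by real_asymp
    moreover have "\<forall>\<^sub>F s in at_top. exp (- t * s) * (s powr Re a * (1 + s) powr (Re c + 1)) = norm (?F s)"
      using eventually_gt_at_top[of 0] by eventually_elim (simp only: n)
    ultimately have "((\<lambda>s. norm (?F s)) \<longlongrightarrow> 0) at_top"
      by (rule Lim_transform_eventually)
    then show "((?F \<circ> real_of_ereal) \<longlongrightarrow> 0) (at_left \<infinity>)"
      unfolding ereal_tendsto_simps by (rule tendsto_norm_zero_cancel)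
  qed (use int in auto)
  moreover have "(LBINT s=0..\<infinity>. ?f s) = integral\<^sup>L half_line ?f"
    unfolding half_line_def zero_ereal_def interval_integral_to_infinity_eq set_lebesgue_integral_def
    by (subst integral_restrict_space) auto
  ultimately show ?thesis using eq1 by simp
qed

lemma tricomi_rescaled:
  assumes t: "t > 0"
  shows "of_real t powr a * tricomi a c t =
    integral\<^sup>L half_line (\<lambda>s. of_real (exp (- s)) * (of_real s powr (a - 1) * of_real (1 + s / t) powr c))"
proof -
  let ?f = "\<lambda>s. complex_of_real (exp (- t * s)) * (of_real s powr (a - 1) * of_real (1 + s) powr c)"
  have "of_real t powr a * tricomi a c t = of_real t powr a * (of_real (1 / t) * integral\<^sup>L half_line
      (\<lambda>s. ?f (1 / t * s)))"
    unfolding tricomi_def laplace_def using integral_half_line_stretch[of "1 / t" ?f] t by simp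
  also have "\<dots> = integral\<^sup>L half_line (\<lambda>s. of_real t powr a * of_real (1 / t) * ?f (1 / t * s))"
    by (simp only: integral_mult_right_zero mult.assoc)
  also have "\<dots> = integral\<^sup>L half_line (\<lambda>s. of_real (exp (- s)) * (of_real s powr (a - 1) * of_real (1
      + s / t) powr c))"
  proof (rule Bochner_Integration.integral_cong)
    fix s assume "s \<in> space half_line"
    then have s: "s > 0" by simp
    have "of_real s = complex_of_real t * of_real (1 / t * s)" using t by simp
    then have "complex_of_real s powr (a - 1) = of_real t powr (a - 1) * of_real (1 / t * s) powr (a - 1)"
      using s t by (metis Reals_of_real powr_times_real Re_complex_of_real less_imp_le mult_pos_pos
          divide_pos_pos zero_less_one)
    moreover have "complex_of_real t powr a * of_real (1 / t) = of_real t powr (a - 1)"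
      using t by (simp add: powr_diff)
    moreover have "exp (- t * (1 / t * s)) = exp (- s)" using t by simp
    moreover have "1 + 1 / t * s = 1 + s / t" by simp
    ultimately show "of_real t powr a * of_real (1 / t) * ?f (1 / t * s)
       = of_real (exp (- s)) * (of_real s powr (a - 1) * of_real (1 + s / t) powr c)"
      by (simp only: mult_ac)
  qed simp
  finally show ?thesis .
qed

text \<open>
  After rescaling, the only dependence on \<open>t\<close> is in the factor \<open>(1 + s/t)\<^sup>c\<close>, which tends to 1 and is
  dominated by a power of \<open>1 + s\<close> for \<open>t \<ge> 1\<close>.
\<close>

lemma tricomi_asymptotics:
  assumes a: "Re a > 0"
  shows "((\<lambda>t. of_real t powr a * tricomi a c t) \<longlongrightarrow> Gamma a) at_top"
proof -
  \<comment> \<open>The maximum keeps \<open>1 + s/t\<close> positive for all real \<open>t\<close>; it does not matter in the limit.\<close>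
  let ?s = "\<lambda>t s. complex_of_real (exp (- s)) * (of_real s powr (a - 1) * of_real (1 + s / max t 1) powr c)"
  define d where "d = max 0 (Re c)"
  have "((\<lambda>t. integral\<^sup>L half_line (?s t)) \<longlongrightarrow> integral\<^sup>L half_line (\<lambda>s. of_real (exp (- s)) * (of_real s powr (a
      - 1)))) at_top"
  proof (rule integral_dominated_convergence_at_top)
    show "(\<lambda>s. complex_of_real (exp (- s)) * (of_real s powr (a - 1))) \<in> borel_measurable half_line"
      by (rule half_line_measurable) (auto intro!: continuous_intros)
    fix t :: real
    have "1 + x / max t 1 > 0" if "x > 0" for x
      using that by (simp add: add_pos_nonneg)
    then have "1 + complex_of_real x / of_real (max t 1) \<noteq> 0" "\<not> Re (1 + complex_of_real x / of_real (max t 1))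
        \<le> 0" if "x > 0" for x
      using that by (force simp: complex_eq_iff)+
    then show "?s t \<in> borel_measurable half_line"
      by (intro half_line_measurable) (auto intro!: continuous_intros simp: complex_nonpos_Reals_iff)
  next
    have "laplace_ok (\<lambda>s. of_real s powr (a - 1) * of_real (1 + s) powr (of_real d))"
      by (rule laplace_ok_kernel[OF a])
    from integrable_norm[OF laplace_okD[OF this, of 1]]
    show "integrable half_line (\<lambda>s. norm (complex_of_real (exp (- 1 * s)) * (of_real s powr (a - 1) * of_real (1
        + s) powr (of_real d))))"
      by simp
  next
    show "AE x in half_line. ((\<lambda>t. ?s t x) \<longlongrightarrow> of_real (exp (- x)) * (of_real x powr (a - 1))) at_top"
    proof (rule half_line_AE)
      fix x :: real assume "x > 0"
      have 1: "((\<lambda>t. 1 + x / max t 1) \<longlongrightarrow> 1) at_top" by real_asymp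
      have 2: "isCont (\<lambda>r. complex_of_real r powr c) 1"
        by (auto intro!: continuous_intros)
      have "((\<lambda>t. complex_of_real (1 + x / max t 1) powr c) \<longlongrightarrow> complex_of_real 1 powr c) at_top"
        by (rule isCont_tendsto_compose[OF 2 1])
      from tendsto_mult[OF tendsto_const[of "complex_of_real (exp (- x)) * of_real x powr (a - 1)"] this]
      show "((\<lambda>t. ?s t x) \<longlongrightarrow> of_real (exp (- x)) * (of_real x powr (a - 1))) at_top"
        by (simp only: mult.assoc of_real_1 powr_one_eq_one mult_1_right)
    qed
  next
    show "\<forall>\<^sub>F t in at_top. AE x in half_line. norm (?s t x) \<le>
       norm (complex_of_real (exp (- 1 * x)) * (of_real x powr (a - 1) * of_real (1 + x) powr (of_real d)))"
    proof (rule always_eventually, rule allI, rule half_line_AE)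
      fix t x :: real assume x: "x > 0"
      have 1: "1 \<le> 1 + x / max t 1" and 2: "1 + x / max t 1 \<le> 1 + x"
        using x by (auto simp: divide_le_eq mult_left_le)
      have "(1 + x / max t 1) powr Re c \<le> (1 + x / max t 1) powr d"
        by (rule powr_mono) (use 1 in \<open>auto simp: d_def\<close>)
      also have "\<dots> \<le> (1 + x) powr d"
        by (rule powr_mono2) (use 1 2 in \<open>auto simp: d_def\<close>)
      finally have 3: "(1 + x / max t 1) powr Re c \<le> (1 + x) powr d" .
      have 4: "norm (complex_of_real (1 + x / max t 1) powr c) = (1 + x / max t 1) powr Re c"
        using 1 by (subst norm_powr_real_powr) auto
      have 5: "norm (complex_of_real (1 + x) powr (of_real d)) = (1 + x) powr d"
        using x by (subst norm_powr_real_powr) auto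
      show "norm (?s t x) \<le> norm (complex_of_real (exp (- 1 * x)) * (of_real x powr (a - 1) * of_real (1
          + x) powr (of_real d)))"
        unfolding norm_mult 4 5 using 3 by (simp add: mult_left_mono)
    qed
  qed
  then have lim: "((\<lambda>t. integral\<^sup>L half_line (?s t)) \<longlongrightarrow> Gamma a) at_top"
    by (simp only: Gamma_half_line[OF a])
  have "\<forall>\<^sub>F t in at_top. integral\<^sup>L half_line (?s t) = of_real t powr a * tricomi a c t"
    using eventually_ge_at_top[of 1]
  proof eventually_elim
    case (elim t)
    then have "max t 1 = t" by simp
    then show ?case using elim tricomi_rescaled[of t a c] by simp
  qed
  with lim show ?thesis by (rule Lim_transform_eventually)
qed

text \<open>
  A solution with the asymptotics of \<open>W\<close>.  The asymptotics of the derivative are part of the notion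
  because the raising operator below combines \<open>G\<close> and \<open>G'\<close>.
\<close>

definition whittaker_recessive :: "complex \<Rightarrow> complex \<Rightarrow> (real \<Rightarrow> complex) \<Rightarrow> (real \<Rightarrow> complex) \<Rightarrow> bool" where
  "whittaker_recessive \<kappa> \<nu> G G' \<longleftrightarrow> whittaker_pair \<kappa> \<nu> G G' \<and>
     ((\<lambda>t. G t / (of_real (exp (- t / 2)) * of_real t powr \<kappa>)) \<longlongrightarrow> 1) at_top \<and>
     ((\<lambda>t. G' t / (of_real (exp (- t / 2)) * of_real t powr \<kappa>)) \<longlongrightarrow> - 1/2) at_top"

lemma tendsto_const_over_of_real: "((\<lambda>t. (x::complex) / of_real t) \<longlongrightarrow> 0) at_top"
proof -
  have "((\<lambda>t. x * complex_of_real (1 / t)) \<longlongrightarrow> x * of_real 0) at_top"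
    by (intro tendsto_mult tendsto_const tendsto_of_real) real_asymp
  then show ?thesis by simp
qed

text \<open>
  Tricomi's integral with \<open>a = 1/2 + \<nu> - \<kappa>\<close>, convergent for \<open>Re a > 0\<close>.
\<close>

lemma whittaker_recessive_base:
  assumes "Re (1/2 + \<nu> - \<kappa>) > 0"
  shows "\<exists>G G'. whittaker_recessive \<kappa> \<nu> G G'"
proof -
  define a where "a = 1/2 + \<nu> - \<kappa>"
  \<comment> \<open>Chosen such that \<open>a + c + 1 = 1 + 2\<nu>\<close>, the second parameter of Kummer's equation.\<close>
  define c where "c = \<nu> + \<kappa> - 1/2"
  have a: "Re a > 0" using assms by (simp add: a_def)
  have Ga: "Gamma a \<noteq> 0" using a by (auto simp: Gamma_eq_zero_iff elim!: nonpos_Ints_cases)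
  define U where "U = (\<lambda>t. 1 / Gamma a * tricomi a c t)"
  define U1 where "U1 = (\<lambda>t. 1 / Gamma a * (- tricomi (a + 1) c t))"
  define U2 where "U2 = (\<lambda>t. 1 / Gamma a * tricomi (a + 2) c t)"
  let ?G = "\<lambda>t. of_real (exp (- t / 2)) * of_real t powr (1/2 + \<nu>) * U t"
  let ?G' = "\<lambda>t. of_real (exp (- t / 2)) * of_real t powr (1/2 + \<nu>) * (U1 t + ((1/2 + \<nu>) / of_real t - 1/2) * U t)"
  have 1: "whittaker_pair \<kappa> \<nu> ?G ?G'"
  proof (rule whittaker_pair_kummer)
    fix t :: real assume t: "t > 0"
    show "(U has_vector_derivative U1 t) (at t)"
      unfolding U_def U1_def by (intro has_vector_derivative_mult_right tricomi_derivative a t)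
    have "(tricomi (a + 1) c has_vector_derivative - tricomi (a + 1 + 1) c t) (at t)"
      by (rule tricomi_derivative) (use a t in auto)
    from has_vector_derivative_mult_right[OF has_vector_derivative_minus[OF this], of "1 / Gamma a"]
    show "(U1 has_vector_derivative U2 t) (at t)"
      unfolding U1_def U2_def by (simp add: add.assoc)
    have "of_real t * U2 t + ((a + c + 1) - of_real t) * U1 t - a * U t
      = 1 / Gamma a * (of_real t * tricomi (a + 2) c t - (a + c + 1 - of_real t) * tricomi (a + 1) c t
          - a * tricomi a c t)"
      unfolding U_def U1_def U2_def using Ga by (simp add: field_simps)
    then show "of_real t * U2 t + ((a + c + 1) - of_real t) * U1 t - a * U t = 0"
      using tricomi_kummer[OF a t, of c] by simp
  qed (simp_all add: a_def c_def)
  have u: "((\<lambda>t. of_real t powr a * U t) \<longlongrightarrow> 1 / Gamma a * Gamma a) at_top"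
    unfolding U_def mult.left_commute[of _ "1 / Gamma a"]
    by (intro tendsto_mult tendsto_const tricomi_asymptotics a)
  have "((\<lambda>t. (- 1 / Gamma a) / of_real t * (of_real t powr (a + 1) * tricomi (a + 1) c t)) \<longlongrightarrow> 0 * Gamma (a
      + 1)) at_top"
    by (intro tendsto_mult tendsto_const_over_of_real tricomi_asymptotics) (use a in simp)
  moreover have "\<forall>\<^sub>F t in at_top. (- 1 / Gamma a) / of_real t * (of_real t powr (a + 1) * tricomi (a + 1) c t)
      = of_real t powr a * U1 t"
    using eventually_gt_at_top[of 0]
    by eventually_elim (simp add: U1_def powr_add)
  ultimately have u1: "((\<lambda>t. of_real t powr a * U1 t) \<longlongrightarrow> 0 * Gamma (a + 1)) at_top"
    by (rule Lim_transform_eventually)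
  have e: "of_real (exp (- t / 2)) * of_real t powr (1/2 + \<nu>) * x / (of_real (exp (- t / 2)) * of_real t powr \<kappa>)
      = of_real t powr a * x"
    if "t > 0" for t x
  proof -
    have "complex_of_real t powr (1/2 + \<nu>) = of_real t powr \<kappa> * of_real t powr a"
      using that by (simp add: a_def flip: powr_add)
    then show ?thesis using that by (simp add: field_simps)
  qed
  have "((\<lambda>t. ?G t / (of_real (exp (- t / 2)) * of_real t powr \<kappa>)) \<longlongrightarrow> 1 / Gamma a * Gamma a) at_top"
    using u by (rule Lim_transform_eventually) (use eventually_gt_at_top[of 0] in eventually_elim, simp only: e)
  then have 2: "((\<lambda>t. ?G t / (of_real (exp (- t / 2)) * of_real t powr \<kappa>)) \<longlongrightarrow> 1) at_top"
    using Ga by simp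
  have "((\<lambda>t. of_real t powr a * U1 t + ((1/2 + \<nu>) / of_real t - 1/2) * (of_real t powr a * U t)) \<longlongrightarrow>
     0 * Gamma (a + 1) + (0 - 1/2) * (1 / Gamma a * Gamma a)) at_top"
    by (intro tendsto_add tendsto_mult tendsto_diff u u1 tendsto_const_over_of_real tendsto_const)
  then have "((\<lambda>t. ?G' t / (of_real (exp (- t / 2)) * of_real t powr \<kappa>)) \<longlongrightarrow> 0 * Gamma (a + 1)
      + (0 - 1/2) * (1 / Gamma a * Gamma a)) at_top"
  proof (rule Lim_transform_eventually)
    show "\<forall>\<^sub>F t in at_top. of_real t powr a * U1 t + ((1/2 + \<nu>) / of_real t - 1/2) * (of_real t powr a * U t)
       = ?G' t / (of_real (exp (- t / 2)) * of_real t powr \<kappa>)"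
      using eventually_gt_at_top[of 0]
    proof eventually_elim
      case (elim t)
      show ?case unfolding e[OF elim] by (simp add: algebra_simps)
    qed
  qed
  then have 3: "((\<lambda>t. ?G' t / (of_real (exp (- t / 2)) * of_real t powr \<kappa>)) \<longlongrightarrow> - 1/2) at_top"
    using Ga by simp
  show ?thesis
    by (rule exI[of _ ?G], rule exI[of _ ?G']) (unfold whittaker_recessive_def, intro conjI 1 2 3)
qed

text \<open>
  The raising operator \<open>G \<mapsto> (T/2 - \<kappa>)G - TG'\<close>: the second identity computes the derivative of the
  result, the first says that the result solves the equation with \<open>\<kappa> + 1\<close>.  Here \<open>H\<close> stands for \<open>G'\<close>, the
  letter \<open>i\<close> for \<open>1/T\<close> and \<open>\<mu>\<close> for \<open>1/4 - \<nu>\<^sup>2\<close>.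
\<close>

lemma raising_operator_identity:
  fixes T i \<kappa> \<mu> G H :: complex
  assumes "T * i = 1"
  shows "((1/2 - T/4 + \<kappa> + \<mu> * i) * H + (- 1/4 - \<mu> * i\<^sup>2) * G) + ((T/2 - \<kappa> - 1) * ((1/4 - \<kappa> * i - \<mu> * i\<^sup>2) * G)
      + 1/2 * H)
    = (1/4 - (\<kappa> + 1) * i - \<mu> * i\<^sup>2) * ((T/2 - \<kappa>) * G - T * H)"
    and "(T/2 - \<kappa>) * H + 1/2 * G - (T * ((1/4 - \<kappa> * i - \<mu> * i\<^sup>2) * G) + H) = (1/2 - T/4 + \<kappa> + \<mu> * i) * G
        + (T/2 - \<kappa> - 1) * H"
proof -
  have "((1/2 - T/4 + \<kappa> + \<mu> * i) * H + (- 1/4 - \<mu> * i\<^sup>2) * G) + ((T/2 - \<kappa> - 1) * ((1/4 - \<kappa> * i - \<mu> * i\<^sup>2) * G)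
      + 1/2 * H)
    - (1/4 - (\<kappa> + 1) * i - \<mu> * i\<^sup>2) * ((T/2 - \<kappa>) * G - T * H) = (T * i - 1) * (G / 2 - (\<kappa> + 1 + \<mu> * i) * H)"
    by (simp add: algebra_simps power2_eq_square) (simp add: field_simps)
  then show "((1/2 - T/4 + \<kappa> + \<mu> * i) * H + (- 1/4 - \<mu> * i\<^sup>2) * G)
      + ((T/2 - \<kappa> - 1) * ((1/4 - \<kappa> * i - \<mu> * i\<^sup>2) * G) + 1/2 * H)
    = (1/4 - (\<kappa> + 1) * i - \<mu> * i\<^sup>2) * ((T/2 - \<kappa>) * G - T * H)"
    using assms by simp
  have "(T/2 - \<kappa>) * H + 1/2 * G - (T * ((1/4 - \<kappa> * i - \<mu> * i\<^sup>2) * G) + H)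
    - ((1/2 - T/4 + \<kappa> + \<mu> * i) * G + (T/2 - \<kappa> - 1) * H) = (T * i - 1) * ((\<kappa> + \<mu> * i) * G)"
    by ((simp add: algebra_simps power2_eq_square), (simp add: field_simps)?)
  then show "(T/2 - \<kappa>) * H + 1/2 * G - (T * ((1/4 - \<kappa> * i - \<mu> * i\<^sup>2) * G) + H) = (1/2 - T/4 + \<kappa> + \<mu> * i) * G
      + (T/2 - \<kappa> - 1) * H"
    using assms by simp
qed

text \<open>
  Applying the raising operator to \<open>e\<^sup>-\<^sup>t\<^sup>/\<^sup>2 t\<^sup>\<kappa>\<close> gives \<open>(t/2 + t/2) e\<^sup>-\<^sup>t\<^sup>/\<^sup>2 t\<^sup>\<kappa>\<close> to leading order, so the
      normalisation
  is preserved.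
\<close>

lemma whittaker_recessive_step:
  assumes "whittaker_recessive \<kappa> \<nu> G G'"
  shows "\<exists>H H'. whittaker_recessive (\<kappa> + 1) \<nu> H H'"
proof -
  define \<mu> where "\<mu> = 1/4 - \<nu>\<^sup>2"
  define H where "H = (\<lambda>t. (of_real t / 2 - \<kappa>) * G t - of_real t * G' t)"
  define H' where "H' = (\<lambda>t. (1/2 - of_real t / 4 + \<kappa> + \<mu> * (1 / of_real t)) * G t + (of_real t / 2 - \<kappa> - 1) * G' t)"
  have P: "whittaker_pair \<kappa> \<nu> G G'"
    and g: "((\<lambda>t. G t / (of_real (exp (- t / 2)) * of_real t powr \<kappa>)) \<longlongrightarrow> 1) at_top"
    and g': "((\<lambda>t. G' t / (of_real (exp (- t / 2)) * of_real t powr \<kappa>)) \<longlongrightarrow> - 1/2) at_top"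
    using assms by (auto simp: whittaker_recessive_def)
  have pair: "whittaker_pair (\<kappa> + 1) \<nu> H H'"
    unfolding whittaker_pair_def
  proof (intro allI impI)
    fix t :: real assume t: "t > 0"
    have q: "x - y / of_real t - (1/4 - \<nu>\<^sup>2) / of_real (t\<^sup>2) = x - y * (1 / of_real t) - \<mu> * (1 / of_real t)\<^sup>2"
        for x y
      by (simp add: \<mu>_def power_divide)
    have DG: "(G has_vector_derivative G' t) (at t)"
      and DG': "(G' has_vector_derivative (1/4 - \<kappa> * (1 / of_real t) - \<mu> * (1 / of_real t)\<^sup>2) * G t) (at t)"
      using P[unfolded whittaker_pair_def, rule_format, OF t, unfolded q] by blast+
    have T: "complex_of_real t * (1 / of_real t) = 1" using t by simp
    have d1: "((\<lambda>t. of_real t / 2 - \<kappa>) has_vector_derivative 1/2) (at t)"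
      and d2: "((\<lambda>t. complex_of_real t) has_vector_derivative 1) (at t)"
      and d3: "((\<lambda>t. 1/2 - of_real t / 4 + \<kappa> + \<mu> * (1 / of_real t)) has_vector_derivative (- 1/4
          - \<mu> * (1 / of_real t)\<^sup>2)) (at t)"
      and d4: "((\<lambda>t. of_real t / 2 - \<kappa> - 1) has_vector_derivative 1/2) (at t)"
      by (rule has_vector_derivative_real_field; use t in \<open>auto intro!: derivative_eq_intros simp: power2_eq_square\<close>)+
    show "(H has_vector_derivative H' t) (at t) \<and>
      (H' has_vector_derivative (1/4 - (\<kappa> + 1) / of_real t - (1/4 - \<nu>\<^sup>2) / of_real (t\<^sup>2)) * H t) (at t)"
      unfolding q
      using has_vector_derivative_diff[OF has_vector_derivative_mult[OF d1 DG] has_vector_derivative_mult[OF d2 DG']]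
        has_vector_derivative_add[OF has_vector_derivative_mult[OF d3 DG] has_vector_derivative_mult[OF d4 DG']]
      unfolding mult_1_left raising_operator_identity[OF T] H_def H'_def by blast
  qed
  let ?E = "\<lambda>t. complex_of_real (exp (- t / 2)) * of_real t powr \<kappa>"
  have E: "complex_of_real (exp (- t / 2)) * of_real t powr (\<kappa> + 1) = ?E t * of_real t" if "t > 0" for t
    using that by (simp add: powr_add)
  have "((\<lambda>t. (1/2 - \<kappa> / of_real t) * (G t / ?E t) - G' t / ?E t) \<longlongrightarrow> (1/2 - 0) * 1 - (- 1/2)) at_top"
    by (intro tendsto_diff tendsto_mult tendsto_const tendsto_const_over_of_real g g')
  then have h: "((\<lambda>t. H t / (of_real (exp (- t / 2)) * of_real t powr (\<kappa> + 1))) \<longlongrightarrow> (1/2 - 0) * 1 - (- 1/2)) at_top"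
  proof (rule Lim_transform_eventually)
    show "\<forall>\<^sub>F t in at_top. (1/2 - \<kappa> / of_real t) * (G t / ?E t) - G' t / ?E t
        = H t / (of_real (exp (- t / 2)) * of_real t powr (\<kappa> + 1))"
      using eventually_gt_at_top[of 0]
    proof eventually_elim
      case (elim t)
      then have "?E t \<noteq> 0" by simp
      then show ?case unfolding E[OF elim] H_def using elim by (simp add: field_simps)
    qed
  qed
  have "((\<lambda>t. (1/2 / of_real t - 1/4 + \<kappa> / of_real t + \<mu> / of_real t * (1 / of_real t)) * (G t / ?E t)
      + (1/2 - (\<kappa> + 1) / of_real t) * (G' t / ?E t)) \<longlongrightarrow>
      (0 - 1/4 + 0 + 0 * 0) * 1 + (1/2 - 0) * (- 1/2)) at_top"
    by (intro tendsto_diff tendsto_mult tendsto_add tendsto_const tendsto_const_over_of_real g g')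
  then have h': "((\<lambda>t. H' t / (of_real (exp (- t / 2)) * of_real t powr (\<kappa> + 1))) \<longlongrightarrow> (0 - 1/4 + 0 + 0 * 0) * 1
      + (1/2 - 0) * (- 1/2)) at_top"
  proof (rule Lim_transform_eventually)
    show "\<forall>\<^sub>F t in at_top. (1/2 / of_real t - 1/4 + \<kappa> / of_real t + \<mu> / of_real t * (1 / of_real t)) *
        (G t / ?E t) + (1/2 - (\<kappa> + 1) / of_real t) * (G' t / ?E t)
      = H' t / (of_real (exp (- t / 2)) * of_real t powr (\<kappa> + 1))"
      using eventually_gt_at_top[of 0]
    proof eventually_elim
      case (elim t)
      then have "?E t \<noteq> 0" by simp
      then show ?case unfolding E[OF elim] H'_def using elim by (simp add: field_simps)
    qed
  qed
  show ?thesis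
    using pair h h' by (intro exI[of _ H] exI[of _ H']) (simp add: whittaker_recessive_def)
qed

text \<open>
  The raising operator lowers \<open>Re (1/2 + \<nu> - \<kappa>)\<close> by one, so every \<open>\<kappa>\<close> is reached from the range of
  convergence of Tricomi's integral.
\<close>

lemma whittaker_recessive_exists: "\<exists>G G'. whittaker_recessive \<kappa> \<nu> G G'"
proof -
  have step: "\<exists>G G'. whittaker_recessive (\<kappa> - of_nat N + of_nat m) \<nu> G G'"
    if "\<exists>G G'. whittaker_recessive (\<kappa> - of_nat N) \<nu> G G'" for N m
  proof (induction m)
    case (Suc m)
    then obtain G G' where "whittaker_recessive (\<kappa> - of_nat N + of_nat m) \<nu> G G'" by blast
    from whittaker_recessive_step[OF this] show ?case by (simp add: add_ac)
  qed (use that in simp)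
  obtain N :: nat where "real N > Re \<kappa> - Re \<nu> - 1/2" using reals_Archimedean2 by blast
  then have "\<exists>G G'. whittaker_recessive (\<kappa> - of_nat N) \<nu> G G'"
    by (intro whittaker_recessive_base) simp
  from step[OF this, of N] show ?thesis by simp
qed

section \<open>Kummer's series\<close>

definition kummer_coeff :: "complex \<Rightarrow> complex \<Rightarrow> nat \<Rightarrow> complex" where
  "kummer_coeff a b n = pochhammer a n / pochhammer b n / fact n"

lemma kummer_M_altdef: "kummer_M a b z = (\<Sum>n. kummer_coeff a b n * z ^ n)"
  by (simp add: kummer_M_def kummer_coeff_def field_simps)

lemma not_nonpos_Int_add_nat:
  fixes b :: complex
  assumes "b \<notin> \<int>\<^sub>\<le>\<^sub>0"
  shows "b + of_nat n \<noteq> 0" "b + of_nat n \<notin> \<int>\<^sub>\<le>\<^sub>0"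
proof -
  show *: "b + of_nat n \<notin> \<int>\<^sub>\<le>\<^sub>0"
  proof
    assume "b + of_nat n \<in> \<int>\<^sub>\<le>\<^sub>0"
    then obtain m where "b + of_nat n = - of_nat m" by (auto elim!: nonpos_Ints_cases')
    then have "b = - of_nat (n + m)" by (simp add: algebra_simps eq_neg_iff_add_eq_0)
    then show False using assms by (metis minus_of_nat_in_nonpos_Ints)
  qed
  show "b + of_nat n \<noteq> 0" using * by auto
qed

lemma kummer_coeff_Suc:
  assumes "b \<notin> \<int>\<^sub>\<le>\<^sub>0"
  shows "(b + of_nat n) * of_nat (Suc n) * kummer_coeff a b (Suc n) = (a + of_nat n) * kummer_coeff a b n"
proof -
  have "pochhammer b n \<noteq> 0" for n
    using assms by (auto simp: pochhammer_eq_0_iff)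
  moreover have "b + of_nat n \<noteq> 0" by (rule not_nonpos_Int_add_nat[OF assms])
  moreover have "1 + complex_of_nat n \<noteq> 0" by (metis of_nat_Suc of_nat_neq_0)
  ultimately show ?thesis
    by (simp add: kummer_coeff_def pochhammer_Suc divide_simps)
qed

text \<open>
  The ratio of consecutive terms tends to zero.
\<close>

lemma summable_norm_kummer:
  assumes b: "b \<notin> \<int>\<^sub>\<le>\<^sub>0"
  shows "summable (\<lambda>n. norm (kummer_coeff a b n * z ^ n))"
proof -
  have "\<forall>\<^sub>F n in sequentially. (norm a + real n) * norm z \<le> 1/2 * ((real n - norm b) * (real n + 1))
      \<and> real n > norm b"
    by (intro eventually_conj; real_asymp)
  then obtain N where N: "\<And>n. n \<ge> N \<Longrightarrow> (norm a + real n) * norm z \<le> 1/2 * ((real n - norm b) * (real n + 1))"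
      "\<And>n. n \<ge> N \<Longrightarrow> real n > norm b"
    by (auto simp: eventually_sequentially)
  show ?thesis
  proof (rule summable_ratio_test[of "1/2" N])
    fix n assume n: "N \<le> n"
    have bn: "norm (b + of_nat n) \<ge> real n - norm b"
      by (metis add.commute norm_diff_ineq norm_of_nat)
    have p: "norm (b + of_nat n) * real (Suc n) > 0"
      using bn N(2)[OF n] by (intro mult_pos_pos) auto
    have an: "norm (a + of_nat n) \<le> norm a + real n"
      by (metis norm_triangle_ineq norm_of_nat)
    have "norm (b + of_nat n) * real (Suc n) * norm (kummer_coeff a b (Suc n) * z ^ Suc n)
        = norm ((b + of_nat n) * of_nat (Suc n) * kummer_coeff a b (Suc n)) * norm z * norm (z ^ n)"
      by (simp only: norm_mult norm_of_nat power_Suc mult_ac)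
    also have "\<dots> = norm (a + of_nat n) * norm z * norm (kummer_coeff a b n * z ^ n)"
      unfolding kummer_coeff_Suc[OF b] by (simp only: norm_mult mult_ac)
    also have "\<dots> \<le> (norm a + real n) * norm z * norm (kummer_coeff a b n * z ^ n)"
      by (intro mult_right_mono an) auto
    also have "\<dots> \<le> 1/2 * ((real n - norm b) * (real n + 1)) * norm (kummer_coeff a b n * z ^ n)"
      by (intro mult_right_mono N(1)[OF n]) auto
    also have "\<dots> \<le> 1/2 * (norm (b + of_nat n) * real (Suc n)) * norm (kummer_coeff a b n * z ^ n)"
    proof -
      have "(real n - norm b) * (real n + 1) \<le> norm (b + of_nat n) * real (Suc n)"
      proof -
        have "real n + 1 = real (Suc n)" by simp
        then show ?thesis using bn by (metis mult_right_mono of_nat_0_le_iff)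
      qed
      then show ?thesis by (intro mult_right_mono) auto
    qed
    also have "\<dots> = norm (b + of_nat n) * real (Suc n) * (1/2 * norm (kummer_coeff a b n * z ^ n))" by simp
    finally have "norm (kummer_coeff a b (Suc n) * z ^ Suc n) \<le> 1/2 * norm (kummer_coeff a b n * z ^ n)"
      using p by (simp only: mult_le_cancel_left_pos)
    then show "norm (norm (kummer_coeff a b (Suc n) * z ^ Suc n)) \<le> 1/2 * norm (norm (kummer_coeff a b n * z ^ n))"
      by simp
  qed simp
qed

lemma summable_kummer: "b \<notin> \<int>\<^sub>\<le>\<^sub>0 \<Longrightarrow> summable (\<lambda>n. kummer_coeff a b n * z ^ n)"
  by (rule summable_norm_cancel[OF summable_norm_kummer])

lemma diffs_kummer_coeff:
  assumes b: "b \<notin> \<int>\<^sub>\<le>\<^sub>0"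
  shows "diffs (kummer_coeff a b) n = a / b * kummer_coeff (a + 1) (b + 1) n"
proof -
  have "of_nat (Suc n) \<noteq> (0::complex)" by (rule of_nat_neq_0)
  then show ?thesis
    by (simp add: diffs_def kummer_coeff_def pochhammer_rec fact_Suc del: of_nat_Suc)
qed

lemma kummer_M_derivative:
  assumes b: "b \<notin> \<int>\<^sub>\<le>\<^sub>0"
  shows "(kummer_M a b has_field_derivative a / b * kummer_M (a + 1) (b + 1) z) (at z)"
proof -
  have b1: "b + 1 \<notin> \<int>\<^sub>\<le>\<^sub>0" using not_nonpos_Int_add_nat(2)[OF b, of 1] by simp
  have "((\<lambda>z. \<Sum>n. kummer_coeff a b n * z ^ n) has_field_derivative (\<Sum>n. diffs (kummer_coeff a b) n * z ^ n)) (at z)"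
    by (rule termdiffs_strong_converges_everywhere) (rule summable_kummer[OF b])
  also have "(\<lambda>z. \<Sum>n. kummer_coeff a b n * z ^ n) = kummer_M a b"
    by (simp add: kummer_M_altdef fun_eq_iff)
  also have "(\<Sum>n. diffs (kummer_coeff a b) n * z ^ n) = a / b * kummer_M (a + 1) (b + 1) z"
    unfolding diffs_kummer_coeff[OF b] kummer_M_altdef mult.assoc
    by (rule suminf_mult) (rule summable_kummer[OF b1])
  finally show ?thesis .
qed

text \<open>
  Comparing coefficients, the equation is the two-term recursion of \<open>kummer_coeff_Suc\<close>.
\<close>

lemma kummer_M_ode:
  assumes b: "b \<notin> \<int>\<^sub>\<le>\<^sub>0"
  shows "z * (a / b * ((a + 1) / (b + 1) * kummer_M (a + 2) (b + 2) z)) +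
     (b - z) * (a / b * kummer_M (a + 1) (b + 1) z) - a * kummer_M a b z = 0"
proof -
  let ?c = "kummer_coeff a b"
  have b1: "b + 1 \<notin> \<int>\<^sub>\<le>\<^sub>0" using not_nonpos_Int_add_nat(2)[OF b, of 1] by simp
  have b2: "b + 2 \<notin> \<int>\<^sub>\<le>\<^sub>0" using not_nonpos_Int_add_nat(2)[OF b, of 2] by simp
  have s0: "(\<lambda>n. ?c n * z ^ n) sums kummer_M a b z"
    unfolding kummer_M_altdef by (rule summable_sums[OF summable_kummer[OF b]])
  have d1: "(\<lambda>n. diffs ?c n * z ^ n) sums (a / b * kummer_M (a + 1) (b + 1) z)"
    unfolding diffs_kummer_coeff[OF b] kummer_M_altdef mult.assoc
    by (intro sums_mult summable_sums summable_kummer b1)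
  have dd: "diffs (diffs ?c) n = a / b * ((a + 1) / (b + 1) * kummer_coeff (a + 2) (b + 2) n)" for n
  proof -
    have "diffs (diffs ?c) n = a / b * diffs (kummer_coeff (a + 1) (b + 1)) n"
      by (subst (1 2) diffs_def) (simp add: diffs_kummer_coeff[OF b])
    then show ?thesis by (simp add: diffs_kummer_coeff[OF b1] add.assoc)
  qed
  have d2: "(\<lambda>n. diffs (diffs ?c) n * z ^ n) sums (a / b * ((a + 1) / (b + 1) * kummer_M (a + 2) (b + 2) z))"
    unfolding dd kummer_M_altdef mult.assoc
    by (intro sums_mult summable_sums summable_kummer b2)
  have e: "z * (of_nat n * x * z ^ (n - Suc 0)) = of_nat n * x * z ^ n" for n x
    by (cases n) auto
  have s1: "(\<lambda>n. of_nat n * ?c n * z ^ n) sums (z * (a / b * kummer_M (a + 1) (b + 1) z))"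
    using sums_mult[OF diffs_equiv[OF sums_summable[OF d1]], of z]
    unfolding e sums_unique[OF d1, symmetric] by simp
  have s2: "(\<lambda>n. of_nat n * diffs ?c n * z ^ n) sums (z * (a / b * ((a + 1) / (b + 1) * kummer_M (a + 2) (b + 2) z)))"
    using sums_mult[OF diffs_equiv[OF sums_summable[OF d2]], of z]
    unfolding e sums_unique[OF d2, symmetric] by simp
  have "(\<lambda>n. of_nat n * diffs ?c n * z ^ n + (b * (diffs ?c n * z ^ n) - of_nat n * ?c n * z ^ n)
      - a * (?c n * z ^ n))
    sums (z * (a / b * ((a + 1) / (b + 1) * kummer_M (a + 2) (b + 2) z)) +
     (b * (a / b * kummer_M (a + 1) (b + 1) z) - z * (a / b * kummer_M (a + 1) (b + 1) z)) - a * kummer_M a b z)"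
    by (intro sums_add sums_diff sums_mult s0 s1 s2 d1)
  moreover have "of_nat n * diffs ?c n * z ^ n + (b * (diffs ?c n * z ^ n) - of_nat n * ?c n * z ^ n)
      - a * (?c n * z ^ n) = 0" for n
  proof -
    have "of_nat n * diffs ?c n * z ^ n + (b * (diffs ?c n * z ^ n) - of_nat n * ?c n * z ^ n) - a * (?c n * z ^ n)
      = ((b + of_nat n) * of_nat (Suc n) * ?c (Suc n) - (a + of_nat n) * ?c n) * z ^ n"
      by (simp add: diffs_def algebra_simps)
    then show ?thesis by (simp only: kummer_coeff_Suc[OF b] diff_self mult_zero_left)
  qed
  ultimately have "(\<lambda>n. 0) sums (z * (a / b * ((a + 1) / (b + 1) * kummer_M (a + 2) (b + 2) z)) +
     (b * (a / b * kummer_M (a + 1) (b + 1) z) - z * (a / b * kummer_M (a + 1) (b + 1) z)) - a * kummer_M a b z)"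
    by (simp only:)
  from sums_unique2[OF this sums_zero] show ?thesis by (simp only: left_diff_distrib)
qed

text \<open>
  The derivative of \<open>M\<close>, in the form in which \<open>whittaker_pair_kummer\<close> produces it.
\<close>

definition whittaker_M' :: "complex \<Rightarrow> complex \<Rightarrow> real \<Rightarrow> complex" where
  "whittaker_M' \<kappa> \<nu> t = of_real (exp (- t / 2)) * of_real t powr (1/2 + \<nu>) *
     ((1/2 + \<nu> - \<kappa>) / (1 + 2 * \<nu>) * kummer_M (1/2 + \<nu> - \<kappa> + 1) (1 + 2 * \<nu> + 1) (of_real t)
       + ((1/2 + \<nu>) / of_real t - 1/2) * kummer_M (1/2 + \<nu> - \<kappa>) (1 + 2 * \<nu>) (of_real t))"

lemma whittaker_pair_M:
  assumes b: "1 + 2 * \<nu> \<notin> \<int>\<^sub>\<le>\<^sub>0"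
  shows "whittaker_pair \<kappa> \<nu> (whittaker_M \<kappa> \<nu>) (whittaker_M' \<kappa> \<nu>)"
  unfolding whittaker_M_def[abs_def] whittaker_M'_def[abs_def]
proof (rule whittaker_pair_kummer)
  have b1: "1 + 2 * \<nu> + 1 \<notin> \<int>\<^sub>\<le>\<^sub>0" using not_nonpos_Int_add_nat(2)[OF b, of 1] by simp
  fix t :: real assume t: "t > 0"
  show "((\<lambda>t. kummer_M (1/2 + \<nu> - \<kappa>) (1 + 2 * \<nu>) (of_real t)) has_vector_derivative
    (1/2 + \<nu> - \<kappa>) / (1 + 2 * \<nu>) * kummer_M (1/2 + \<nu> - \<kappa> + 1) (1 + 2 * \<nu> + 1) (of_real t)) (at t)"
    by (rule has_vector_derivative_real_field[OF kummer_M_derivative[OF b]])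
  show "((\<lambda>t. (1/2 + \<nu> - \<kappa>) / (1 + 2 * \<nu>) * kummer_M (1/2 + \<nu> - \<kappa> + 1) (1 + 2 * \<nu> + 1) (of_real t))
      has_vector_derivative
    (1/2 + \<nu> - \<kappa>) / (1 + 2 * \<nu>) * ((1/2 + \<nu> - \<kappa> + 1) / (1 + 2 * \<nu> + 1) * kummer_M (1/2 + \<nu> - \<kappa> + 1 + 1) (1
        + 2 * \<nu> + 1 + 1) (of_real t))) (at t)"
    by (rule has_vector_derivative_mult_right[OF has_vector_derivative_real_field[OF kummer_M_derivative[OF b1]]])
  show "complex_of_real t * ((1/2 + \<nu> - \<kappa>) / (1 + 2 * \<nu>) * ((1/2 + \<nu> - \<kappa> + 1) / (1 + 2 * \<nu> + 1) * kummer_M (1/2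
      + \<nu> - \<kappa> + 1 + 1) (1 + 2 * \<nu> + 1 + 1) (of_real t)))
    + (1 + 2 * \<nu> - of_real t) * ((1/2 + \<nu> - \<kappa>) / (1 + 2 * \<nu>) * kummer_M (1/2 + \<nu> - \<kappa> + 1) (1 + 2 * \<nu> + 1) (of_real t))
    - (1/2 + \<nu> - \<kappa>) * kummer_M (1/2 + \<nu> - \<kappa>) (1 + 2 * \<nu>) (of_real t) = 0"
    using kummer_M_ode[OF b, of "of_real t" "1/2 + \<nu> - \<kappa>"] by (simp only: add.assoc one_add_one)
qed simp_all

text \<open>
  The substitution is that of \<open>tricomi_rescaled\<close> with \<open>c = 0\<close>.
\<close>

lemma laplace_powr:
  assumes "Re z > 0" "t > 0"
  shows "integral\<^sup>L half_line (\<lambda>s. of_real (exp (- t * s)) * of_real s powr (z - 1)) = Gamma z / of_real t powr z"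
proof -
  have 1: "complex_of_real (1 + s) powr 0 = 1" "complex_of_real (1 + s / t) powr 0 = 1" if "s > 0" for s
  proof -
    have "1 + s / t > 0" using that assms by (simp add: add_pos_pos)
    then have n: "1 + s / t \<noteq> 0" "1 + s \<noteq> 0" using that by auto
    show "complex_of_real (1 + s) powr 0 = 1"
      unfolding powr_zero_eq_one of_real_eq_0_iff using n by simp
    show "complex_of_real (1 + s / t) powr 0 = 1"
      unfolding powr_zero_eq_one of_real_eq_0_iff using n by simp
  qed
  have "of_real t powr z * tricomi z 0 t = integral\<^sup>L half_line (\<lambda>s. of_real (exp (- s)) * (of_real s powr (z - 1)))"
    unfolding tricomi_rescaled[OF assms(2)]
    by (rule Bochner_Integration.integral_cong) (simp_all only: space_half_line greaterThan_iff 1 mult_1_right)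
  moreover have "tricomi z 0 t = integral\<^sup>L half_line (\<lambda>s. of_real (exp (- t * s)) * of_real s powr (z - 1))"
    unfolding tricomi_def laplace_def
    by (rule Bochner_Integration.integral_cong) (simp_all only: space_half_line greaterThan_iff 1 mult_1_right)
  ultimately show ?thesis using Gamma_half_line[OF assms(1)] assms(2) by (simp add: field_simps)
qed

lemma laplace_powr_norm:
  assumes "Re z > 0" "t > 0"
  shows "integral\<^sup>L half_line (\<lambda>s. norm (of_real (exp (- t * s)) * complex_of_real s powr (z - 1)))
      = Gamma (Re z) / t powr Re z"
proof -
  have "complex_of_real (integral\<^sup>L half_line (\<lambda>s. norm (of_real (exp (- t * s)) * complex_of_real s powr (z - 1))))
    = integral\<^sup>L half_line (\<lambda>s. of_real (norm (of_real (exp (- t * s)) * complex_of_real s powr (z - 1))))"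
    by simp
  also have "\<dots> = integral\<^sup>L half_line (\<lambda>s. of_real (exp (- t * s)) * of_real s powr (of_real (Re z) - 1))"
  proof (rule Bochner_Integration.integral_cong)
    fix s assume "s \<in> space half_line"
    then have s: "s > 0" by simp
    have "norm (complex_of_real s powr (z - 1)) = s powr (Re z - 1)"
      using s by (subst norm_powr_real_powr) auto
    moreover have "complex_of_real (s powr (Re z - 1)) = of_real s powr (of_real (Re z) - 1)"
      using s by (subst powr_of_real[symmetric]) auto
    ultimately show "complex_of_real (norm (of_real (exp (- t * s)) * complex_of_real s powr (z - 1)))
      = of_real (exp (- t * s)) * of_real s powr (of_real (Re z) - 1)"
      by (simp only: norm_mult norm_of_real abs_exp_cancel of_real_mult)
  qed simp
  also have "\<dots> = Gamma (of_real (Re z)) / of_real t powr (of_real (Re z))"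
    by (rule laplace_powr) (use assms in auto)
  also have "\<dots> = complex_of_real (Gamma (Re z) / t powr Re z)"
    using assms by (simp add: Gamma_complex_of_real powr_of_real)
  finally show ?thesis by (simp only: of_real_eq_iff)
qed

section \<open>Exponential growth of Kummer's series\<close>

definition poly_bounded :: "(real \<Rightarrow> complex) \<Rightarrow> bool" where
  "poly_bounded f \<longleftrightarrow> (\<exists>N. f \<in> O(\<lambda>t. of_real t ^ N))"

lemma poly_boundedI: "f \<in> O(\<lambda>t. of_real t ^ N) \<Longrightarrow> poly_bounded f"
  by (auto simp: poly_bounded_def)

lemma of_real_power_bigo: "N \<le> M \<Longrightarrow> (\<lambda>t. complex_of_real t ^ N) \<in> O(\<lambda>t. of_real t ^ M)"
proof (rule landau_o.bigI[of 1])
  assume "N \<le> M"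
  show "\<forall>\<^sub>F t in at_top. norm (complex_of_real t ^ N) \<le> 1 * norm (complex_of_real t ^ M)"
    using eventually_ge_at_top[of 1]
  proof eventually_elim
    case (elim t)
    then show ?case using \<open>N \<le> M\<close> by (simp add: norm_power power_increasing)
  qed
qed simp

lemma poly_bounded_add:
  assumes "poly_bounded f" "poly_bounded g"
  shows "poly_bounded (\<lambda>t. f t + g t)"
proof -
  obtain N M where "f \<in> O(\<lambda>t. of_real t ^ N)" "g \<in> O(\<lambda>t. of_real t ^ M)"
    using assms unfolding poly_bounded_def by blast
  note NM = this
  have "f \<in> O(\<lambda>t. of_real t ^ max N M)"
    by (rule landau_o.big_trans[OF NM(1) of_real_power_bigo]) simp
  moreover have "g \<in> O(\<lambda>t. of_real t ^ max N M)"
    by (rule landau_o.big_trans[OF NM(2) of_real_power_bigo]) simp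
  ultimately show ?thesis by (intro poly_boundedI sum_in_bigo)
qed

lemma poly_bounded_mult:
  assumes "poly_bounded f" "poly_bounded g"
  shows "poly_bounded (\<lambda>t. f t * g t)"
proof -
  obtain N M where "f \<in> O(\<lambda>t. of_real t ^ N)" "g \<in> O(\<lambda>t. of_real t ^ M)"
    using assms unfolding poly_bounded_def by blast
  from landau_o.big.mult[OF this] show ?thesis
    by (intro poly_boundedI[of _ "N + M"]) (simp add: power_add)
qed

lemma poly_bounded_tendsto:
  assumes "(f \<longlongrightarrow> c) at_top"
  shows "poly_bounded f"
proof (rule poly_boundedI[of _ 0])
  have "f \<in> O(\<lambda>_. 1)" by (rule bigoI_tendsto[of _ _ c]) (use assms in auto)
  then show "f \<in> O(\<lambda>t. of_real t ^ 0)" by simp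
qed

lemma poly_bounded_const: "poly_bounded (\<lambda>_. c)"
  by (rule poly_bounded_tendsto[of _ c]) simp

lemma poly_bounded_of_real: "poly_bounded of_real"
  by (rule poly_boundedI[of _ 1]) simp

lemma poly_bounded_powr: "poly_bounded (\<lambda>t. of_real t powr z)"
proof (rule poly_boundedI[of _ "nat \<lceil>Re z\<rceil>"], rule landau_o.bigI[of 1])
  show "\<forall>\<^sub>F t in at_top. norm (complex_of_real t powr z) \<le> 1 * norm (complex_of_real t ^ nat \<lceil>Re z\<rceil>)"
    using eventually_ge_at_top[of 1]
  proof eventually_elim
    case (elim t)
    have "norm (complex_of_real t powr z) = t powr Re z"
      using elim by (subst norm_powr_real_powr) auto
    also have "\<dots> \<le> t powr of_nat (nat \<lceil>Re z\<rceil>)"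
      by (rule powr_mono) (use elim in \<open>auto simp: of_nat_ceiling\<close>)
    also have "\<dots> = t ^ nat \<lceil>Re z\<rceil>" using elim by (simp add: powr_realpow)
    finally show ?case using elim by (simp add: norm_power)
  qed
qed simp

lemma poly_bounded_cong:
  assumes "poly_bounded f" "\<forall>\<^sub>F t in at_top. f t = g t"
  shows "poly_bounded g"
proof -
  obtain N where "f \<in> O(\<lambda>t. of_real t ^ N)" using assms(1) unfolding poly_bounded_def by blast
  then have "g \<in> O(\<lambda>t. of_real t ^ N)" using assms(2) by (simp cong: landau_o.big.in_cong)
  then show ?thesis by (rule poly_boundedI)
qed

lemma kummer_coeff_Gamma:
  assumes "b \<notin> \<int>\<^sub>\<le>\<^sub>0"
  shows "kummer_coeff a b n * Gamma (b + of_nat n) = Gamma b * (pochhammer a n / fact n)"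
proof -
  have "pochhammer b n \<noteq> 0" using assms by (auto simp: pochhammer_eq_0_iff)
  moreover have "Gamma (b + of_nat n) = pochhammer b n * Gamma b"
    using pochhammer_Gamma[OF assms, of n] assms by (simp add: Gamma_eq_zero_iff)
  ultimately show ?thesis by (simp add: kummer_coeff_def)
qed

text \<open>
  Termwise, the transform of \<open>t\<^sup>b\<^sup>+\<^sup>n\<^sup>-\<^sup>1\<close> is \<open>\<Gamma>(b + n)s\<^sup>-\<^sup>b\<^sup>-\<^sup>n\<close>, whose Gamma factor cancels the denominators
      \<open>(b)\<^sub>n\<close> of
  Kummer's series and leaves a binomial series.  The interchange of sum and integral is dominated since
  the integrals of the absolute values have ratio at most \<open>(|a| + n) / ((n + 1)s)\<close>.
\<close>

lemma laplace_kummer: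
  assumes b: "Re b > 0" and s: "s > 1"
  shows "laplace (\<lambda>t. of_real t powr (b - 1) * kummer_M a b (of_real t)) s
    = Gamma b / of_real s powr b * (1 - 1 / of_real s) powr (- a)"
proof -
  have bn: "b \<notin> \<int>\<^sub>\<le>\<^sub>0" using b by (auto elim!: nonpos_Ints_cases)
  let ?c = "kummer_coeff a b"
  let ?f = "\<lambda>i t. ?c i * (of_real (exp (- s * t)) * complex_of_real t powr (b + of_nat i - 1))"
  have f: "?f i t = of_real (exp (- s * t)) * (of_real t powr (b - 1) * (?c i * of_real t ^ i))" if "t > 0" for i t
  proof -
    have "complex_of_real t powr (b + of_nat i - 1) = of_real t powr (b - 1) * of_real t powr (of_nat i)"
      by (simp flip: powr_add add: algebra_simps)
    then show ?thesis using that by (simp add: powr_nat)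
  qed
  have s0: "s > 0" using s by simp
  have bi: "Re (b + of_nat i) > 0" for i using b by simp
  have int: "integrable half_line (?f i)" for i
    by (intro integrable_mult_right integrable_half_line_powr bi s0)
  have ni: "integral\<^sup>L half_line (\<lambda>t. norm (?f i t)) = norm (?c i) * (Gamma (Re b + real i) / s powr (Re b
      + real i))" for i
  proof -
    have "integral\<^sup>L half_line (\<lambda>t. norm (?f i t))
        = norm (?c i) * integral\<^sup>L half_line (\<lambda>t. norm (of_real (exp (- s * t)) * complex_of_real t powr (b
            + of_nat i - 1)))"
      by (simp only: norm_mult[of "?c i"] integral_mult_right_zero)
    then show ?thesis unfolding laplace_powr_norm[OF bi s0] by simp
  qed
  have sumn: "summable (\<lambda>i. norm (?c i) * (Gamma (Re b + real i) / s powr (Re b + real i)))"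
  proof -
    \<comment> \<open>Any number strictly between \<open>1/s\<close>, the limit of the ratios, and 1.\<close>
    define r where "r = (1 + 1 / s) / 2"
    have r: "r < 1" "r * s > 1" using s by (auto simp: r_def field_simps)
    have "\<forall>\<^sub>F i in sequentially. norm a + real i \<le> (real i + 1) * (r * s)"
      using r(2) by real_asymp
    then obtain N where N: "\<And>i. i \<ge> N \<Longrightarrow> norm a + real i \<le> (real i + 1) * (r * s)"
      by (auto simp: eventually_sequentially)
    show ?thesis
    proof (rule summable_ratio_test[OF r(1), of N])
      fix i assume "N \<le> i"
      let ?G = "Gamma (Re b + real i) / s powr (Re b + real i)"
      have Gp: "?G > 0" using b s0 by (intro divide_pos_pos Gamma_real_pos) auto
      have GS: "Gamma (Re b + real (Suc i)) / s powr (Re b + real (Suc i)) = (Re b + real i) / s * ?G"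
      proof -
        have "Gamma (Re b + real i + 1) = (Re b + real i) * Gamma (Re b + real i)"
          by (rule Gamma_plus1) (use b in \<open>auto elim!: nonpos_Ints_cases\<close>)
        moreover have "s powr (Re b + real i + 1) = s powr (Re b + real i) * s"
          using s0 by (simp add: powr_add)
        ultimately show ?thesis by (simp add: add_ac)
      qed
      have b1: "Re b + real i \<le> norm (b + of_nat i)"
        using complex_Re_le_cmod[of "b + of_nat i"] by simp
      have p: "norm (b + of_nat i) * real (Suc i) > 0"
        using b1 b by (intro mult_pos_pos) auto
      have "norm (b + of_nat i) * real (Suc i) * (norm (?c (Suc i)) * ((Re b + real i) / s * ?G))
        = norm ((b + of_nat i) * of_nat (Suc i) * ?c (Suc i)) * ((Re b + real i) / s * ?G)"
        by (simp only: norm_mult norm_of_nat mult_ac)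
      also have "\<dots> = norm (a + of_nat i) * norm (?c i) * ((Re b + real i) / s * ?G)"
        unfolding kummer_coeff_Suc[OF bn] by (simp only: norm_mult)
      also have "\<dots> \<le> ((real i + 1) * (r * s)) * norm (?c i) * (norm (b + of_nat i) / s * ?G)"
      proof (intro mult_mono order_refl)
        have "norm (a + of_nat i) \<le> norm a + real i" by (metis norm_triangle_ineq norm_of_nat)
        then show "norm (a + of_nat i) \<le> (real i + 1) * (r * s)" using N[OF \<open>N \<le> i\<close>] by linarith
        show "(Re b + real i) / s \<le> norm (b + of_nat i) / s" using b1 s0 by (simp add: divide_right_mono)
      qed (use Gp b s0 r in auto)
      also have "\<dots> = norm (b + of_nat i) * real (Suc i) * (r * (norm (?c i) * ?G))"
        using s0 by (simp add: field_simps)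
      finally have "norm (?c (Suc i)) * ((Re b + real i) / s * ?G) \<le> r * (norm (?c i) * ?G)"
        using p by (simp only: mult_le_cancel_left_pos)
      then show "norm (norm (?c (Suc i)) * (Gamma (Re b + real (Suc i)) / s powr (Re b + real (Suc i))))
          \<le> r * norm (norm (?c i) * ?G)"
        unfolding GS using Gp b s0 by (simp add: abs_mult)
    qed
  qed
  have "(\<lambda>i. integral\<^sup>L half_line (?f i)) sums (\<integral>t. (\<Sum>i. ?f i t) \<partial>half_line)"
  proof (rule sums_integral)
    show "AE t in half_line. summable (\<lambda>i. norm (?f i t))"
    proof (rule half_line_AE)
      fix t :: real assume t: "t > 0"
      have "summable (\<lambda>i. norm (of_real (exp (- s * t)) * complex_of_real t powr (b - 1)) * norm (?c i * of_real
          t ^ i))"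
        by (intro summable_mult summable_norm_kummer bn)
      then show "summable (\<lambda>i. norm (?f i t))"
        unfolding f[OF t] by (simp only: norm_mult mult.assoc)
    qed
  qed (use int sumn ni in simp_all)
  moreover have "(\<integral>t. (\<Sum>i. ?f i t) \<partial>half_line) = laplace (\<lambda>t. of_real t powr (b - 1) * kummer_M a b (of_real t)) s"
    unfolding laplace_def
  proof (rule Bochner_Integration.integral_cong)
    fix t assume "t \<in> space half_line"
    then have t: "t > 0" by simp
    show "(\<Sum>i. ?f i t) = of_real (exp (- s * t)) * (of_real t powr (b - 1) * kummer_M a b (of_real t))"
      unfolding f[OF t] kummer_M_altdef
      by (simp only: suminf_mult summable_mult summable_kummer[OF bn])
  qed simp
  moreover have "integral\<^sup>L half_line (?f i)
      = Gamma b / of_real s powr b * ((- a gchoose i) * (- (1 / of_real s)) ^ i)" for i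
  proof -
    have "integral\<^sup>L half_line (?f i) = ?c i * (Gamma (b + of_nat i) / of_real s powr (b + of_nat i))"
      by (simp only: integral_mult_right_zero laplace_powr[OF bi s0])
    also have "\<dots> = Gamma b * (pochhammer a i / fact i) / (of_real s powr b * of_real s ^ i)"
      using kummer_coeff_Gamma[OF bn, of a i] s0 by (simp add: powr_add powr_nat)
    also have "\<dots> = Gamma b / of_real s powr b * ((- a gchoose i) * (- (1 / of_real s)) ^ i)"
      by (simp add: gbinomial_pochhammer power_minus[of "1 / complex_of_real s"] power_divide)
         (simp add: mult_ac flip: power_mult_distrib)
    finally show ?thesis .
  qed
  ultimately have 1: "(\<lambda>i. Gamma b / of_real s powr b * ((- a gchoose i) * (- (1 / of_real s)) ^ i)) sums
      laplace (\<lambda>t. of_real t powr (b - 1) * kummer_M a b (of_real t)) s" by (simp only:)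
  have "(\<lambda>i. (- a gchoose i) * (- (1 / complex_of_real s)) ^ i) sums (1 + - (1 / of_real s)) powr (- a)"
    by (rule gen_binomial_complex) (use s in \<open>simp add: norm_divide\<close>)
  from sums_unique2[OF 1 sums_mult[OF this]] show ?thesis by simp
qed

text \<open>
  Otherwise the Laplace transform of \<open>t\<^sup>b\<^sup>-\<^sup>1\<Phi>(a,b,t)\<close> would converge absolutely at \<open>s = 1\<close> and so stay bounded
  as \<open>s\<close> decreases to 1, in contrast to \<open>(1 - 1/s)\<^sup>-\<^sup>a\<close>.
\<close>

lemma kummer_M_not_poly_bounded:
  assumes a: "Re a > 0" and b: "Re b > 0"
  shows "\<not> poly_bounded (\<lambda>t. kummer_M a b (of_real t))"
proof
  assume "poly_bounded (\<lambda>t. kummer_M a b (of_real t))"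
  then obtain N where "(\<lambda>t. kummer_M a b (of_real t)) \<in> O(\<lambda>t. of_real t ^ N)" by (auto simp: poly_bounded_def)
  then obtain C where C: "C > 0" "\<forall>\<^sub>F t in at_top. norm (kummer_M a b (of_real t)) \<le> C * norm (complex_of_real t ^ N)"
    by (auto elim: landau_o.bigE)
  then obtain T where T: "\<And>t. t \<ge> T \<Longrightarrow> norm (kummer_M a b (of_real t)) \<le> C * norm (complex_of_real t ^ N)"
    by (auto simp: eventually_at_top_linorder)
  have bn: "b \<notin> \<int>\<^sub>\<le>\<^sub>0" using b by (auto elim!: nonpos_Ints_cases)
  have cont0: "continuous_on UNIV (kummer_M a b)"
    using kummer_M_derivative[OF bn] by (intro DERIV_continuous_on) (auto intro: has_field_derivative_at_within)
  have cont: "continuous_on S (\<lambda>t. kummer_M a b (of_real t))" for S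
    by (rule continuous_on_compose2[OF cont0]) (auto intro!: continuous_intros)
  have "compact ((\<lambda>t. kummer_M a b (of_real t)) ` {0..max T 0})"
    by (intro compact_continuous_image cont) simp
  then have "bounded ((\<lambda>t. kummer_M a b (of_real t)) ` {0..max T 0})" by (rule compact_imp_bounded)
  then obtain D where D: "D > 0" "\<And>t. t \<in> {0..max T 0} \<Longrightarrow> norm (kummer_M a b (of_real t)) \<le> D"
    unfolding bounded_pos by auto
  have bd: "norm (kummer_M a b (of_real t)) \<le> (C + D) * (1 + t) ^ N" if "t > 0" for t
  proof (cases "t \<ge> T")
    case True
    have "norm (kummer_M a b (of_real t)) \<le> C * t ^ N" using T[OF True] that by (simp add: norm_power)
    also have "\<dots> \<le> (C + D) * (1 + t) ^ N"
      using that C D by (intro mult_mono power_mono) auto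
    finally show ?thesis .
  next
    case False
    then have "norm (kummer_M a b (of_real t)) \<le> D" using that by (intro D) auto
    also have "\<dots> \<le> (C + D) * (1 + t) ^ N"
      using that C D mult_mono[of D "C + D" 1 "(1 + t) ^ N"] by simp
    finally show ?thesis .
  qed
  have k: "laplace_ok (\<lambda>s. of_real s powr (b - 1) * of_real (1 + s) powr (of_nat N))"
    by (rule laplace_ok_kernel[OF b])
  have k': "laplace_ok (\<lambda>s. of_real (C + D) * (of_real s powr (b - 1) * of_real (1 + s) powr (of_nat N)))"
    using laplace_lincomb(2)[OF k k k zero_less_one, of "of_real (C + D)" 0 0] by simp
  define \<phi> where "\<phi> = (\<lambda>t. complex_of_real t powr (b - 1) * kummer_M a b (of_real t))"
  have ok: "laplace_ok \<phi>"
    unfolding \<phi>_def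
  proof (rule laplace_ok_bound[OF k'])
    fix t :: real assume t: "t > 0"
    have "complex_of_real (1 + t) powr (of_nat N) = of_real (1 + t) ^ N"
      using t by (subst powr_nat) (auto simp: complex_eq_iff)
    then have "norm (complex_of_real (1 + t) powr (of_nat N)) = (1 + t) ^ N"
      using t by (simp only: norm_power norm_of_real)
    moreover have "norm (complex_of_real (C + D)) = C + D" using C D unfolding norm_of_real by simp
    ultimately show "norm (of_real t powr (b - 1) * kummer_M a b (of_real t))
        \<le> norm (of_real (C + D) * (of_real t powr (b - 1) * of_real (1 + t) powr (of_nat N)))"
      unfolding norm_mult using mult_left_mono[OF bd[OF t], of "norm (complex_of_real t powr (b - 1))"]
      by (simp only: norm_ge_zero mult_ac)
  qed (intro continuous_intros cont; auto)
  define K where "K = integral\<^sup>L half_line (\<lambda>t. norm (of_real (exp (- 1 * t)) * \<phi> t))"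
  have bound: "norm (laplace \<phi> s) \<le> K" if "s > 1" for s
    unfolding laplace_def K_def
  proof (rule Bochner_Integration.integral_norm_bound_integral)
    show "integrable half_line (\<lambda>t. complex_of_real (exp (- s * t)) * \<phi> t)"
      by (rule laplace_okD[OF ok]) (use that in simp)
    show "integrable half_line (\<lambda>t. norm (complex_of_real (exp (- 1 * t)) * \<phi> t))"
      by (intro integrable_norm laplace_okD[OF ok]) simp
    fix t assume "t \<in> space half_line"
    then show "norm (complex_of_real (exp (- s * t)) * \<phi> t) \<le> norm (complex_of_real (exp (- 1 * t)) * \<phi> t)"
      using that unfolding norm_mult norm_of_real by (intro mult_right_mono) auto
  qed
  have eq: "norm (laplace \<phi> s) = norm (Gamma b) / s powr Re b * (1 - 1 / s) powr (- Re a)" if "s > 1" for s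
  proof -
    have "norm (complex_of_real (1 - 1 / s) powr (- a)) = (1 - 1 / s) powr (- Re a)"
      using that by (subst norm_powr_real_powr) auto
    moreover have "norm (complex_of_real s powr b) = s powr Re b"
      using that by (subst norm_powr_real_powr) auto
    ultimately show ?thesis
      unfolding \<phi>_def laplace_kummer[OF b that] by (simp add: norm_mult norm_divide)
  qed
  have G: "norm (Gamma b) > 0" using bn by (simp add: Gamma_eq_zero_iff)
  have "filterlim (\<lambda>s. norm (Gamma b) / s powr Re b * (1 - 1 / s) powr (- Re a)) at_top (at_right 1)"
    using a G by real_asymp
  then have "\<forall>\<^sub>F s in at_right 1. norm (Gamma b) / s powr Re b * (1 - 1 / s) powr (- Re a) > K"
    by (simp add: filterlim_at_top_dense)
  moreover have "\<forall>\<^sub>F s in at_right 1. s > (1::real)" by (simp add: eventually_at_filter)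
  ultimately have "\<forall>\<^sub>F s in at_right (1::real). False"
    by eventually_elim (use bound eq in force)
  then show False by (simp add: trivial_limit_at_right_real)
qed

text \<open>
  Up to a non-zero factor, \<open>\<Phi>(a+1,b+1)\<close> is the derivative of \<open>\<Phi>(a,b)\<close>, and Kummer's equation expresses the
  second derivative by the first two functions.  Polynomial bounds thus propagate to all
  \<open>\<Phi>(a+n,b+n)\<close>, and for large \<open>n\<close> the real parts of the parameters are positive.
\<close>

lemma kummer_M_not_poly_bounded_with_derivative:
  assumes a: "a \<notin> \<int>\<^sub>\<le>\<^sub>0" and b: "b \<notin> \<int>\<^sub>\<le>\<^sub>0"
    and p0: "poly_bounded (\<lambda>t. kummer_M a b (of_real t))"
    and p1: "poly_bounded (\<lambda>t. kummer_M (a + 1) (b + 1) (of_real t))"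
  shows False
proof -
  have *: "poly_bounded (\<lambda>t. kummer_M (a + of_nat n) (b + of_nat n) (of_real t)) \<and>
     poly_bounded (\<lambda>t. kummer_M (a + of_nat n + 1) (b + of_nat n + 1) (of_real t))" for n
  proof (induction n)
    case 0 then show ?case using p0 p1 by simp
  next
    case (Suc n)
    define A where "A = a + of_nat n"
    define B where "B = b + of_nat n"
    have A: "A \<noteq> 0" "A + 1 \<noteq> 0" and B: "B \<notin> \<int>\<^sub>\<le>\<^sub>0" "B \<noteq> 0" "B + 1 \<noteq> 0"
      using not_nonpos_Int_add_nat[OF a, of n] not_nonpos_Int_add_nat[OF a, of "Suc n"]
        not_nonpos_Int_add_nat[OF b, of n] not_nonpos_Int_add_nat[OF b, of "Suc n"]
      by (auto simp: A_def B_def add_ac)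
    have q0: "poly_bounded (\<lambda>t. kummer_M A B (of_real t))"
        and q1: "poly_bounded (\<lambda>t. kummer_M (A + 1) (B + 1) (of_real t))"
      using Suc by (auto simp: A_def B_def)
    define k where "k = A / B * ((A + 1) / (B + 1))"
    have k: "k \<noteq> 0" using A B by (simp add: k_def)
    have inv: "((\<lambda>t. complex_of_real (1 / t)) \<longlongrightarrow> of_real 0) at_top" by (intro tendsto_of_real) real_asymp
    have "poly_bounded (\<lambda>t. 1 / k * (complex_of_real (1 / t) * (A * kummer_M A B (of_real t) + (of_real t +
        - B) * (A / B * kummer_M (A + 1) (B + 1) (of_real t)))))"
      by (intro poly_bounded_mult poly_bounded_add poly_bounded_const q0 q1 poly_bounded_of_real
          poly_bounded_tendsto[OF inv])
    moreover have "\<forall>\<^sub>F t in at_top. 1 / k * (complex_of_real (1 / t) * (A * kummer_M A B (of_real t)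
        + (of_real t + - B) * (A / B * kummer_M (A + 1) (B + 1) (of_real t))))
       = kummer_M (A + 2) (B + 2) (of_real t)"
      using eventually_gt_at_top[of 0]
    proof eventually_elim
      case (elim t)
      have h: "of_real t * (k * kummer_M (A + 2) (B + 2) (of_real t)) = A * kummer_M A B (of_real t)
          + (of_real t + - B) * (A / B * kummer_M (A + 1) (B + 1) (of_real t))"
        using kummer_M_ode[OF B(1), of "of_real t" A] unfolding k_def mult.assoc by (simp only: algebra_simps) algebra
      show ?case unfolding h[symmetric] using elim k by simp
    qed
    ultimately have "poly_bounded (\<lambda>t. kummer_M (A + 2) (B + 2) (of_real t))" by (rule poly_bounded_cong)
    with q1 show ?case by (simp add: A_def B_def add_ac)
  qed
  obtain n where n: "real n > max (- Re a) (- Re b)" using reals_Archimedean2 by blast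
  have "\<not> poly_bounded (\<lambda>t. kummer_M (a + of_nat n) (b + of_nat n) (of_real t))"
    by (rule kummer_M_not_poly_bounded) (use n in auto)
  with * show False by blast
qed

section \<open>A fundamental system for Whittaker's equation\<close>

definition wronskian :: "(real \<Rightarrow> complex) \<Rightarrow> (real \<Rightarrow> complex) \<Rightarrow> (real \<Rightarrow> complex) \<Rightarrow> (real \<Rightarrow> complex) \<Rightarrow> real \<Rightarrow>
    complex" where
  "wronskian G G' H H' t = G t * H' t - G' t * H t"

lemma wronskian_constant:
  assumes G: "\<And>t. t > 0 \<Longrightarrow> (G has_vector_derivative G' t) (at t)"
      "\<And>t. t > 0 \<Longrightarrow> (G' has_vector_derivative Q t * G t) (at t)"
    and H: "\<And>t. t > 0 \<Longrightarrow> (H has_vector_derivative H' t) (at t)"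
      "\<And>t. t > 0 \<Longrightarrow> (H' has_vector_derivative Q t * H t) (at t)"
  obtains w where "\<And>t. t > 0 \<Longrightarrow> wronskian G G' H H' t = w"
proof (rule has_vector_derivative_zero_constant[of "{0<..}" "wronskian G G' H H'"])
  fix t :: real assume "t \<in> {0<..}"
  then have t: "t > 0" by simp
  have "((\<lambda>t. G t * H' t - G' t * H t) has_vector_derivative
     (G t * (Q t * H t) + G' t * H' t) - (G' t * H' t + (Q t * G t) * H t)) (at t)"
    by (intro has_vector_derivative_diff has_vector_derivative_mult G H t)
  then have "(wronskian G G' H H' has_vector_derivative 0) (at t)"
    unfolding wronskian_def[abs_def] by (simp add: mult_ac)
  then show "(wronskian G G' H H' has_vector_derivative 0) (at t within {0<..})"
    by (rule has_vector_derivative_at_within)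
qed (use that in auto)

text \<open>
  Cramer's rule for \<open>G = \<alpha>H + \<beta>K\<close>, \<open>G' = \<alpha>H' + \<beta>K'\<close>: an identity at the point \<open>t\<close>, whatever the
  functions are.
\<close>

lemma wronskian_cramer:
  "G t * wronskian H H' K K' t = wronskian G G' K K' t * H t + wronskian H H' G G' t * K t"
  unfolding wronskian_def by (simp add: algebra_simps)

text \<open>
  The three Wronskians in Cramer's rule are constants.
\<close>

lemma fundamental_system:
  assumes G: "\<And>t. t > 0 \<Longrightarrow> (G has_vector_derivative G' t) (at t)"
      "\<And>t. t > 0 \<Longrightarrow> (G' has_vector_derivative Q t * G t) (at t)"
    and H: "\<And>t. t > 0 \<Longrightarrow> (H has_vector_derivative H' t) (at t)"
      "\<And>t. t > 0 \<Longrightarrow> (H' has_vector_derivative Q t * H t) (at t)"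
    and K: "\<And>t. t > 0 \<Longrightarrow> (K has_vector_derivative K' t) (at t)"
      "\<And>t. t > 0 \<Longrightarrow> (K' has_vector_derivative Q t * K t) (at t)"
    and t0: "t0 > 0" "wronskian H H' K K' t0 \<noteq> 0"
  shows "\<forall>t>0. G t = wronskian G G' K K' t0 / wronskian H H' K K' t0 * H t
     + wronskian H H' G G' t0 / wronskian H H' K K' t0 * K t"
proof -
  obtain w1 where w1: "\<And>t. t > 0 \<Longrightarrow> wronskian H H' K K' t = w1" using wronskian_constant[OF H K] by blast
  obtain w2 where w2: "\<And>t. t > 0 \<Longrightarrow> wronskian G G' K K' t = w2" using wronskian_constant[OF G K] by blast
  obtain w3 where w3: "\<And>t. t > 0 \<Longrightarrow> wronskian H H' G G' t = w3" using wronskian_constant[OF H G] by blast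
  have "G t = w2 / w1 * H t + w3 / w1 * K t" if "t > 0" for t
  proof -
    have "G t * w1 = w2 * H t + w3 * K t"
      using wronskian_cramer[of G t H H' K K' G'] unfolding w1[OF that] w2[OF that] w3[OF that] .
    then show ?thesis using t0 w1[OF t0(1)] by (simp add: field_simps)
  qed
  then show ?thesis unfolding w1[OF t0(1)] w2[OF t0(1)] w3[OF t0(1)] by blast
qed

text \<open>
  For large \<open>t\<close> the coefficient of the equation is at most 1 in absolute value, so \<open>G''\<close> obeys the bound
  of \<open>G\<close>; Taylor's formula on the interval from \<open>t\<close> to \<open>t + 1\<close> then bounds \<open>G'\<close>.
\<close>

lemma whittaker_pair_derivative_bound:
  assumes P: "whittaker_pair \<kappa> \<nu> G G'"
    and g: "\<forall>\<^sub>F t in at_top. norm (G t) \<le> C * exp (c * t)"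
  shows "\<exists>C'. \<forall>\<^sub>F t in at_top. norm (G' t) \<le> C' * exp (c * t)"
proof -
  let ?Q = "\<lambda>t. 1/4 - \<kappa> / of_real t - (1/4 - \<nu>\<^sup>2) / of_real (t\<^sup>2)"
  have "((\<lambda>t. 1/4 - \<kappa> / of_real t - (1/4 - \<nu>\<^sup>2) / of_real t * (1 / of_real t)) \<longlongrightarrow> 1/4 - 0 - 0 * 0) at_top"
    by (intro tendsto_diff tendsto_mult tendsto_const tendsto_const_over_of_real)
  then have "((\<lambda>t. norm (?Q t)) \<longlongrightarrow> norm (1/4 - 0 - 0 * 0 :: complex)) at_top"
    by (intro tendsto_norm) (simp add: power2_eq_square)
  then have "\<forall>\<^sub>F t in at_top. norm (?Q t) < 1"
    by (rule order_tendstoD) (simp add: norm_divide)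
  then have "\<forall>\<^sub>F t in at_top. norm (?Q t) < 1 \<and> norm (G t) \<le> C * exp (c * t) \<and> t > 0"
    using g eventually_gt_at_top[of 0] by eventually_elim auto
  then obtain T where T: "\<And>t. t \<ge> T \<Longrightarrow> norm (?Q t) < 1 \<and> norm (G t) \<le> C * exp (c * t) \<and> t > 0"
    by (auto simp: eventually_at_top_linorder)
  have C: "C \<ge> 0"
    using T[of T] norm_ge_zero[of "G T"] by (smt (verit) exp_gt_zero mult_neg_pos)
  \<comment> \<open>Over a unit interval the bound varies by the factor \<open>e\<^sup>|\<^sup>c\<^sup>|\<close> at most.\<close>
  define D where "D = C * exp \<bar>c\<bar>"
  have "norm (G' t) \<le> (D + D + C) * exp (c * t)" if t: "t \<ge> T" for t
  proof -
    have DG: "(G has_vector_derivative G' s) (at s)" "(G' has_vector_derivative ?Q s * G s) (at s)" if "s \<ge> t" for s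
      using P T[of s] that t unfolding whittaker_pair_def by auto
    have le: "norm (G s) \<le> D * exp (c * t)" "norm (?Q s * G s) \<le> D * exp (c * t)" if s: "t \<le> s" "s \<le> t + 1" for s
    proof -
      have "c * s \<le> \<bar>c\<bar> + c * t"
      proof -
        have "c * (s - t) \<le> \<bar>c\<bar> * (s - t)" using s by (intro mult_right_mono) auto
        also have "\<dots> \<le> \<bar>c\<bar> * 1" using s by (intro mult_left_mono) auto
        finally have "c * (s - t) \<le> \<bar>c\<bar> * 1" .
        then show ?thesis by (simp add: algebra_simps)
      qed
      then have "C * exp (c * s) \<le> C * exp (\<bar>c\<bar> + c * t)" using C by (intro mult_left_mono) auto
      then show 1: "norm (G s) \<le> D * exp (c * t)"
        using T[of s] s t by (simp add: D_def exp_add)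
      have "norm (?Q s * G s) \<le> 1 * norm (G s)"
        unfolding norm_mult using T[of s] s t by (intro mult_right_mono) auto
      with 1 show "norm (?Q s * G s) \<le> D * exp (c * t)" by simp
    qed
    have contG': "continuous_on {a..b} G'" and contG: "continuous_on {a..b} G" if "a \<ge> t" for a b
      using that
      by (auto intro!: continuous_at_imp_continuous_on has_vector_derivative_continuous[OF DG(2)]
          has_vector_derivative_continuous[OF DG(1)])
    have d1: "norm (G' s - G' t) \<le> D * exp (c * t)" if s: "t < s" "s \<le> t + 1" for s
    proof -
      have "norm (G' s - G' t) \<le> D * exp (c * t) * s - D * exp (c * t) * t"
      proof (rule differentiable_bound_general[OF s(1) contG'])
        fix x assume x: "t < x" "x < s"
        show "(G' has_vector_derivative ?Q x * G x) (at x)" using DG(2) x by simp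
        show "((\<lambda>s. D * exp (c * t) * s) has_vector_derivative D * exp (c * t)) (at x)"
          by (auto intro!: derivative_eq_intros)
        show "norm (?Q x * G x) \<le> D * exp (c * t)" by (rule le(2)) (use x s in auto)
      qed (auto intro!: continuous_intros)
      also have "\<dots> = D * exp (c * t) * (s - t)" by (simp add: algebra_simps)
      also have "\<dots> \<le> D * exp (c * t) * 1" using s C by (intro mult_left_mono) (auto simp: D_def)
      finally show ?thesis by simp
    qed
    have d2: "norm ((G (t + 1) - of_real (t + 1) * G' t) - (G t - of_real t * G' t)) \<le> D * exp (c * t) * (t + 1)
        - D * exp (c * t) * t"
    proof (rule differentiable_bound_general[where f' = "\<lambda>s. G' s - G' t" and \<phi>' = "\<lambda>_. D * exp (c * t)"])
      fix s assume s: "t < s" "s < t + 1"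
      have "((\<lambda>s. complex_of_real s * G' t) has_vector_derivative 1 * G' t) (at s)"
        by (intro has_vector_derivative_mult_left) (auto intro!: derivative_eq_intros
            has_vector_derivative_real_field)
      from has_vector_derivative_diff[OF DG(1) this]
      show "((\<lambda>s. G s - of_real s * G' t) has_vector_derivative G' s - G' t) (at s)" using s by simp
      show "norm (G' s - G' t) \<le> D * exp (c * t)" using d1 s by simp
    qed (auto intro!: continuous_intros contG derivative_eq_intros)
    have "G' t = - ((G (t + 1) - of_real (t + 1) * G' t) - (G t - of_real t * G' t)) + G (t + 1) - G t"
      by (simp add: algebra_simps)
    then have "norm (G' t) \<le> norm ((G (t + 1) - of_real (t + 1) * G' t) - (G t - of_real t * G' t))
        + norm (G (t + 1)) + norm (G t)"
      by (smt (verit) norm_minus_cancel norm_triangle_ineq norm_triangle_ineq4)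
    also have "\<dots> \<le> D * exp (c * t) + D * exp (c * t) + C * exp (c * t)"
      using d2 le(1)[of "t + 1"] T[OF t] by (intro add_mono) (auto simp: algebra_simps)
    finally show ?thesis by (simp add: algebra_simps)
  qed
  then show ?thesis by (auto simp: eventually_at_top_linorder)
qed

lemma recessive_asymptotics_bound:
  assumes W: "((\<lambda>t. W t / (of_real (exp (- t / 2)) * of_real t powr \<kappa>)) \<longlongrightarrow> (1::complex)) at_top" and c: "c > - 1/2"
  shows "\<forall>\<^sub>F t in at_top. norm (W t) \<le> exp (c * t)"
proof -
  have "((\<lambda>t. norm (W t / (of_real (exp (- t / 2)) * of_real t powr \<kappa>))) \<longlongrightarrow> norm (1::complex)) at_top"
    by (rule tendsto_norm[OF W])
  then have "\<forall>\<^sub>F t in at_top. norm (W t / (of_real (exp (- t / 2)) * of_real t powr \<kappa>)) < 2"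
    by (rule order_tendstoD) simp
  moreover have "\<forall>\<^sub>F t in at_top. 2 * (exp (- t / 2) * t powr Re \<kappa>) \<le> exp (c * t)"
    using c by real_asymp
  ultimately show ?thesis using eventually_gt_at_top[of 0]
  proof eventually_elim
    case (elim t)
    have "norm (complex_of_real t powr \<kappa>) = t powr Re \<kappa>"
      using elim by (subst norm_powr_real_powr) auto
    then have n: "norm (complex_of_real (exp (- t / 2)) * of_real t powr \<kappa>) = exp (- t / 2) * t powr Re \<kappa>"
      by (simp only: norm_mult norm_of_real abs_exp_cancel)
    have "exp (- t / 2) * t powr Re \<kappa> > 0" using elim by simp
    then have "norm (W t) < 2 * (exp (- t / 2) * t powr Re \<kappa>)"
      using elim(1) unfolding norm_divide n by (simp only: pos_divide_less_eq)
    with elim(2) show ?case by linarith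
  qed
qed

text \<open>
  The Wronskian is constant and at most of the order of \<open>e\<^sup>c\<^sup>t e\<^sup>d\<^sup>t\<close> for every \<open>d > -1/2\<close>.
\<close>

lemma wronskian_recessive_zero:
  assumes P: "whittaker_pair \<kappa> \<nu> G G'" and R: "whittaker_recessive \<kappa> \<nu> W W'"
    and g: "\<forall>\<^sub>F t in at_top. norm (G t) \<le> C * exp (c * t)" and c: "c < 1/2" and t0: "t0 > 0"
  shows "wronskian W W' G G' t0 = 0"
proof -
  have PW: "whittaker_pair \<kappa> \<nu> W W'" using R by (simp add: whittaker_recessive_def)
  \<comment> \<open>The midpoint of \<open>-1/2\<close> and \<open>-c\<close>.\<close>
  define d where "d = (- 1/2 - c) / 2"
  have d: "d > - 1/2" "c + d < 0" using c by (auto simp: d_def field_simps)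
  have w: "\<forall>\<^sub>F t in at_top. norm (W t) \<le> 1 * exp (d * t)"
    using recessive_asymptotics_bound[OF _ d(1), of W \<kappa>] R by (simp add: whittaker_recessive_def)
  obtain C' where g': "\<forall>\<^sub>F t in at_top. norm (G' t) \<le> C' * exp (c * t)"
    using whittaker_pair_derivative_bound[OF P g] by blast
  obtain D where w': "\<forall>\<^sub>F t in at_top. norm (W' t) \<le> D * exp (d * t)"
    using whittaker_pair_derivative_bound[OF PW w] by blast
  obtain x where x: "\<And>t. t > 0 \<Longrightarrow> wronskian W W' G G' t = x"
    using wronskian_constant[of W W' "\<lambda>t. 1/4 - \<kappa> / of_real t - (1/4 - \<nu>\<^sup>2) / of_real (t\<^sup>2)" G G']
      P PW unfolding whittaker_pair_def by blast
  have "\<forall>\<^sub>F t in at_top. norm x \<le> (C' + D * C) * exp ((c + d) * t)"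
    using w w' g g' eventually_gt_at_top[of 0]
  proof eventually_elim
    case (elim t)
    have "norm x \<le> norm (W t) * norm (G' t) + norm (W' t) * norm (G t)"
      unfolding x[OF elim(5), symmetric] wronskian_def by (metis norm_mult norm_triangle_ineq4)
    also have "\<dots> \<le> (1 * exp (d * t)) * (C' * exp (c * t)) + (D * exp (d * t)) * (C * exp (c * t))"
      using elim by (intro add_mono mult_mono) (auto intro: order_trans[OF norm_ge_zero])
    also have "\<dots> = (C' + D * C) * exp ((c + d) * t)" by (simp add: algebra_simps exp_add)
    finally show ?case .
  qed
  moreover have "((\<lambda>t. (C' + D * C) * exp ((c + d) * t)) \<longlongrightarrow> 0) at_top"
    using d(2) by real_asymp
  ultimately have "norm x \<le> 0"
    by (intro tendsto_lowerbound[where F = at_top]) auto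
  then show ?thesis using x[OF t0] by simp
qed

lemma solve_scaled_eq:
  fixes e m x c w :: complex
  assumes "e * m * x = c * w" "e \<noteq> 0" "m \<noteq> 0"
  shows "c * (w / e * (1 / m)) = x"
  using assms by (simp add: field_simps)

text \<open>
  If the Wronskian vanished, then \<open>M\<close> would be a multiple of \<open>W\<close> near infinity, where \<open>W\<close> has no
  zeros.  Dividing \<open>M\<close> and \<open>M'\<close> by the weight, Kummer's series and its derivative would be polynomially
  bounded.
\<close>

lemma wronskian_W_M_nonzero:
  assumes R: "whittaker_recessive \<kappa> \<nu> W W'"
    and b: "1 + 2 * \<nu> \<notin> \<int>\<^sub>\<le>\<^sub>0" and a: "1/2 + \<nu> - \<kappa> \<notin> \<int>\<^sub>\<le>\<^sub>0" and t0: "t0 > 0"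
  shows "wronskian W W' (whittaker_M \<kappa> \<nu>) (whittaker_M' \<kappa> \<nu>) t0 \<noteq> 0"
proof
  let ?M = "whittaker_M \<kappa> \<nu>" and ?M' = "whittaker_M' \<kappa> \<nu>"
  let ?E = "\<lambda>t. complex_of_real (exp (- t / 2)) * of_real t powr \<kappa>"
  assume zero: "wronskian W W' ?M ?M' t0 = 0"
  have PW: "whittaker_pair \<kappa> \<nu> W W'"
    and rW: "((\<lambda>t. W t / ?E t) \<longlongrightarrow> 1) at_top" and rW': "((\<lambda>t. W' t / ?E t) \<longlongrightarrow> - 1/2) at_top"
    using R by (auto simp: whittaker_recessive_def)
  have PM: "whittaker_pair \<kappa> \<nu> ?M ?M'" by (rule whittaker_pair_M[OF b])
  obtain x where x: "\<And>t. t > 0 \<Longrightarrow> wronskian W W' ?M ?M' t = x"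
    using wronskian_constant[of W W' "\<lambda>t. 1/4 - \<kappa> / of_real t - (1/4 - \<nu>\<^sup>2) / of_real (t\<^sup>2)" ?M ?M']
      PM PW unfolding whittaker_pair_def by blast
  with zero t0 have x0: "wronskian W W' ?M ?M' t = 0" if "t > 0" for t using that by metis
  have "\<forall>\<^sub>F t in at_top. W t / ?E t \<noteq> 0"
    using rW by (rule tendsto_imp_eventually_ne) simp
  then have "\<forall>\<^sub>F t in at_top. W t \<noteq> 0" by eventually_elim auto
  then obtain T0 where T0: "\<And>t. t \<ge> T0 \<Longrightarrow> W t \<noteq> 0" by (auto simp: eventually_at_top_linorder)
  define T where "T = max T0 1"
  have T: "W t \<noteq> 0" "t > 0" if "t > T" for t using T0[of t] that by (auto simp: T_def)
  \<comment> \<open>The derivative of \<open>M/W\<close> is the Wronskian over \<open>W\<^sup>2\<close>.\<close>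
  obtain c where c: "\<And>t. t \<in> {T<..} \<Longrightarrow> ?M t / W t = c"
  proof (rule has_vector_derivative_zero_constant[of "{T<..}" "\<lambda>t. ?M t / W t"])
    fix t assume "t \<in> {T<..}"
    then have t: "t > T" by simp
    have "(?M has_vector_derivative ?M' t) (at t)" "(W has_vector_derivative W' t) (at t)"
      using PM PW T[OF t] unfolding whittaker_pair_def by auto
    from has_derivative_divide'[OF this[unfolded has_vector_derivative_def] T(1)[OF t]]
    have "((\<lambda>t. ?M t / W t) has_vector_derivative (?M' t * W t - ?M t * W' t) / (W t * W t)) (at t)"
      unfolding has_vector_derivative_def
      by (rule has_derivative_eq_rhs) (simp add: fun_eq_iff scaleR_conv_of_real algebra_simps diff_divide_distrib)
    moreover have "?M' t * W t - ?M t * W' t = 0"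
      using x0[OF T(2)[OF t]] by (simp add: wronskian_def mult.commute)
    ultimately show "((\<lambda>t. ?M t / W t) has_vector_derivative 0) (at t within {T<..})"
      by (auto intro: has_vector_derivative_at_within)
  qed auto
  have M: "?M t = c * W t" "?M' t = c * W' t" if "t > T" for t
  proof -
    show 1: "?M t = c * W t" using c[of t] T[OF that] that by (simp add: field_simps)
    have "W t * (?M' t - c * W' t) = 0"
      using x0[OF T(2)[OF that]] unfolding wronskian_def 1 by (simp add: algebra_simps)
    then show "?M' t = c * W' t" using T[OF that] by simp
  qed
  have gt: "\<forall>\<^sub>F t in at_top. t > T" by (rule eventually_gt_at_top)
  let ?a = "1/2 + \<nu> - \<kappa>" and ?b = "1 + 2 * \<nu>"
  have E: "of_real (exp (- t / 2)) * of_real t powr (1/2 + \<nu>)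
      = ?E t * of_real t powr ?a" "?E t \<noteq> 0" "complex_of_real t powr ?a \<noteq> 0"
    "complex_of_real t powr (- ?a) = 1 / complex_of_real t powr ?a" if "t > T" for t
  proof -
    have t: "t > 0" by (rule T(2)[OF that])
    have "complex_of_real t powr (1/2 + \<nu>) = of_real t powr \<kappa> * of_real t powr ?a"
      by (subst powr_add[symmetric]) simp
    then show "of_real (exp (- t / 2)) * of_real t powr (1/2 + \<nu>) = ?E t * of_real t powr ?a"
        by (simp only: mult.assoc)
    show "?E t \<noteq> 0" "complex_of_real t powr ?a \<noteq> 0" using t by auto
    show "complex_of_real t powr (- ?a) = 1 / complex_of_real t powr ?a"
        by (simp only: powr_minus divide_inverse mult_1_left)
  qed
  have p0: "poly_bounded (\<lambda>t. kummer_M ?a ?b (of_real t))"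
  proof (rule poly_bounded_cong)
    show "poly_bounded (\<lambda>t. c * (W t / ?E t * of_real t powr (- ?a)))"
      by (intro poly_bounded_mult poly_bounded_const poly_bounded_tendsto[OF rW] poly_bounded_powr)
    show "\<forall>\<^sub>F t in at_top. c * (W t / ?E t * of_real t powr (- ?a)) = kummer_M ?a ?b (of_real t)"
      using gt
    proof eventually_elim
      case (elim t)
      have "?E t * of_real t powr ?a * kummer_M ?a ?b (of_real t) = c * W t"
        using M(1)[OF elim] unfolding whittaker_M_def E(1)[OF elim] .
      from solve_scaled_eq[OF this E(2,3)[OF elim]] show ?case unfolding E(4)[OF elim] .
    qed
  qed
  have inv: "poly_bounded (\<lambda>t. (1/2 + \<nu>) / of_real t)"
    by (rule poly_bounded_tendsto[OF tendsto_const_over_of_real])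
  have a0: "?a \<noteq> 0" "?b \<noteq> 0" using a b by auto
  have p1: "poly_bounded (\<lambda>t. kummer_M (?a + 1) (?b + 1) (of_real t))"
  proof (rule poly_bounded_cong)
    show "poly_bounded (\<lambda>t. ?b / ?a * (c * (W' t / ?E t * of_real t powr (- ?a)) + (((1/2 + \<nu>) / of_real t +
        - 1/2) * (- 1)) * kummer_M ?a ?b (of_real t)))"
      by (intro poly_bounded_mult poly_bounded_add poly_bounded_const poly_bounded_tendsto[OF rW']
          poly_bounded_powr p0 inv)
    show "\<forall>\<^sub>F t in at_top. ?b / ?a * (c * (W' t / ?E t * of_real t powr (- ?a)) + (((1/2 + \<nu>) / of_real t +
        - 1/2) * (- 1)) * kummer_M ?a ?b (of_real t))
       = kummer_M (?a + 1) (?b + 1) (of_real t)"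
      using gt
    proof eventually_elim
      case (elim t)
      define k0 where "k0 = kummer_M ?a ?b (of_real t)"
      define k1 where "k1 = kummer_M (?a + 1) (?b + 1) (of_real t)"
      define r where "r = (1/2 + \<nu>) / of_real t"
      define a b where "a = ?a" and "b = ?b"
      have ab: "a \<noteq> 0" "b \<noteq> 0" using a0 by (auto simp: a_def b_def)
      have e: "?E t * of_real t powr a * (a / b * k1 + (r - 1/2) * k0) = c * W' t"
        using M(2)[OF elim] unfolding whittaker_M'_def E(1)[OF elim] k0_def k1_def r_def a_def b_def .
      have "c * (W' t / ?E t * (1 / of_real t powr a)) = a / b * k1 + (r - 1/2) * k0"
        unfolding a_def by (rule solve_scaled_eq[OF e[unfolded a_def] E(2,3)[OF elim]])
      then have "c * (W' t / ?E t * (1 / of_real t powr a)) + ((r + - 1/2) * (- 1)) * k0 = a / b * k1"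
        by (simp add: algebra_simps)
      then show ?case
        unfolding E(4)[OF elim] unfolding k0_def[symmetric] k1_def[symmetric] r_def[symmetric]
        unfolding a_def[symmetric] b_def[symmetric]
        using ab by simp
    qed
  qed
  from kummer_M_not_poly_bounded_with_derivative[OF a b p0 p1] show False .
qed

text \<open>
  The function \<open>W\<close> defined by its asymptotics is the recessive solution constructed above: any other
  candidate is bounded, hence a multiple of it, and the factor is 1.
\<close>

lemma whittaker_expansion:
  assumes b: "1 + 2 * \<nu> \<notin> \<int>\<^sub>\<le>\<^sub>0" and a: "1/2 + \<nu> - \<kappa> \<notin> \<int>\<^sub>\<le>\<^sub>0" and P: "whittaker_pair \<kappa> \<nu> G G'"
  shows "\<exists>\<alpha> \<beta>. (\<forall>t>0. G t = \<alpha> * whittaker_W_tilde \<kappa> \<nu> t + \<beta> * whittaker_M_tilde \<kappa> \<nu> t) \<and>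
     ((\<exists>C c. c < 1/2 \<and> (\<forall>\<^sub>F t in at_top. norm (G t) \<le> C * exp (c * t))) \<longrightarrow> \<beta> = 0)"
proof -
  let ?M = "whittaker_M \<kappa> \<nu>" and ?M' = "whittaker_M' \<kappa> \<nu>"
  obtain W W' where R: "whittaker_recessive \<kappa> \<nu> W W'" using whittaker_recessive_exists by blast
  have PW: "whittaker_pair \<kappa> \<nu> W W'" using R by (simp add: whittaker_recessive_def)
  have PM: "whittaker_pair \<kappa> \<nu> ?M ?M'" by (rule whittaker_pair_M[OF b])
  define w where "w = wronskian W W' ?M ?M' 1"
  have w: "w \<noteq> 0" unfolding w_def by (rule wronskian_W_M_nonzero[OF R b a]) simp
  have expand: "\<forall>t>0. H t = wronskian H H' ?M ?M' 1 / w * W t + wronskian W W' H H' 1 / w * ?M t"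
    if "whittaker_pair \<kappa> \<nu> H H'" for H H'
    using fundamental_system[of H H' "\<lambda>t. 1/4 - \<kappa> / of_real t - (1/4 - \<nu>\<^sup>2) / of_real (t\<^sup>2)" W W' ?M ?M' 1]
      that PW PM w unfolding whittaker_pair_def w_def by simp
  have W: "whittaker_W \<kappa> \<nu> t = W t" if t: "t > 0" for t
    unfolding whittaker_W_def
  proof (rule the_equality)
    show "\<exists>G. whittaker_solution \<kappa> \<nu> G \<and> ((\<lambda>t. G t / (of_real (exp (- t / 2)) * of_real t powr \<kappa>)) \<longlongrightarrow> 1) at_top
        \<and> W t = G t"
      using R unfolding whittaker_solution_iff_pair whittaker_recessive_def by blast
  next
    fix x assume "\<exists>G. whittaker_solution \<kappa> \<nu> G \<and> ((\<lambda>t. G t / (of_real (exp (- t / 2)) * of_real t powr \<kappa>))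
        \<longlongrightarrow> 1) at_top \<and> x = G t"
    then obtain H H' where H: "whittaker_pair \<kappa> \<nu> H H'" "((\<lambda>t. H t / (of_real (exp (- t / 2)) * of_real t powr
        \<kappa>)) \<longlongrightarrow> 1) at_top" "x = H t"
      unfolding whittaker_solution_iff_pair by blast
    have "\<forall>\<^sub>F t in at_top. norm (H t) \<le> 1 * exp (0 * t)"
      using recessive_asymptotics_bound[OF H(2), of 0] by simp
    then have "wronskian W W' H H' 1 = 0"
      by (rule wronskian_recessive_zero[OF H(1) R]) auto
    then have "\<forall>t>0. H t = wronskian H H' ?M ?M' 1 / w * W t"
      using expand[OF H(1)] by simp
    then obtain k where k: "\<And>t. t > 0 \<Longrightarrow> H t = k * W t" by blast
    have "((\<lambda>t. k * (W t / (of_real (exp (- t / 2)) * of_real t powr \<kappa>))) \<longlongrightarrow> k * 1) at_top"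
      using R by (intro tendsto_mult tendsto_const) (simp add: whittaker_recessive_def)
    moreover have "\<forall>\<^sub>F t in at_top. k * (W t / (of_real (exp (- t / 2)) * of_real t powr \<kappa>))
        = H t / (of_real (exp (- t / 2)) * of_real t powr \<kappa>)"
      using eventually_gt_at_top[of 0] by eventually_elim (simp add: k)
    ultimately have "((\<lambda>t. H t / (of_real (exp (- t / 2)) * of_real t powr \<kappa>)) \<longlongrightarrow> k * 1) at_top"
      by (rule Lim_transform_eventually)
    with H(2) have "k = 1" using tendsto_unique[OF trivial_limit_at_top_linorder] by fastforce
    then show "x = W t" using k[OF t] H(3) by simp
  qed
  define m where "m = Gamma (1/2 + \<nu> - \<kappa>) / Gamma (1 + 2 * \<nu>)"
  have m: "m \<noteq> 0" using a b by (simp add: m_def Gamma_eq_zero_iff)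
  have "\<forall>t>0. G t = wronskian G G' ?M ?M' 1 / w * whittaker_W_tilde \<kappa> \<nu> t
     + (wronskian W W' G G' 1 / w / m) * whittaker_M_tilde \<kappa> \<nu> t"
    using expand[OF P] W m by (simp add: whittaker_W_tilde_def whittaker_M_tilde_def m_def[symmetric])
  moreover have "wronskian W W' G G' 1 / w / m = 0" if "c < 1/2" "\<forall>\<^sub>F t in at_top. norm (G t) \<le> C * exp (c * t)"
      for C c
    using wronskian_recessive_zero[OF P R that(2,1), of 1] by simp
  ultimately show ?thesis by blast
qed

section \<open>Derivatives of real-analytic functions\<close>

text \<open>
  Unconditional convergence at the single point \<open>(\<rho>, \<rho>)\<close> is absolute convergence there.
\<close>

lemma double_series_abs_summable:
  fixes a :: "nat \<times> nat \<Rightarrow> complex"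
  assumes "\<And>s t. \<bar>s\<bar> < r \<Longrightarrow> \<bar>t\<bar> < r \<Longrightarrow> ((\<lambda>(m, n). a (m, n) * of_real (s ^ m * t ^ n)) has_sum F s t) UNIV"
    and "0 \<le> \<rho>" "\<rho> < r"
  shows "(\<lambda>(m, n). norm (a (m, n)) * (\<rho> ^ m * \<rho> ^ n)) summable_on UNIV"
proof -
  have "((\<lambda>(m, n). a (m, n) * of_real (\<rho> ^ m * \<rho> ^ n)) has_sum F \<rho> \<rho>) UNIV"
    using assms by (intro assms(1)) auto
  then have "(\<lambda>(m, n). a (m, n) * of_real (\<rho> ^ m * \<rho> ^ n)) summable_on UNIV"
    by (auto simp: summable_on_def)
  then have "(\<lambda>p. norm (case p of (m, n) \<Rightarrow> a (m, n) * of_real (\<rho> ^ m * \<rho> ^ n))) summable_on UNIV"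
    unfolding summable_on_iff_abs_summable_on_complex .
  then show ?thesis
    using assms(2) by (simp add: case_prod_unfold norm_mult norm_power)
qed

lemma bounded_Suc_times_power:
  fixes x :: real
  assumes "0 \<le> x" "x < 1"
  obtains K where "K > 0" "\<And>m. real (Suc m) * x ^ m \<le> K"
proof -
  have "(\<lambda>m. real (Suc m) * x ^ m) \<longlonglongrightarrow> 0"
  proof (cases "x = 0")
    case True
    have "(\<lambda>m. real (Suc (Suc m)) * x ^ Suc m) \<longlonglongrightarrow> 0" using True by simp
    then show ?thesis by (subst (asm) filterlim_sequentially_Suc)
  next
    case False
    with assms have "x > 0" by simp
    then show ?thesis using assms(2) by real_asymp
  qed
  then have "Bseq (\<lambda>m. real (Suc m) * x ^ m)" by (intro convergent_imp_Bseq) (auto simp: convergent_def)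
  then obtain K where "K > 0" "\<And>m. norm (real (Suc m) * x ^ m) \<le> K" by (auto simp: Bseq_def)
  then show ?thesis using that[of K] by (metis abs_le_D1 real_norm_def)
qed

text \<open>
  Summing over \<open>n\<close> first gives, for fixed \<open>t\<close>, a power series in \<open>s\<close>, which may be differentiated termwise.
  The differentiated double series converges absolutely because \<open>(m + 1)|s|\<^sup>m\<close> is at most a constant times
  \<open>\<rho>\<^sup>m\<close> for \<open>|s| < \<rho>\<close>.
\<close>

lemma double_series_derivative:
  fixes a :: "nat \<times> nat \<Rightarrow> complex"
  assumes F: "\<And>s t. \<bar>s\<bar> < r \<Longrightarrow> \<bar>t\<bar> < r \<Longrightarrow> ((\<lambda>(m, n). a (m, n) * of_real (s ^ m * t ^ n)) has_sum F s t) UNIV"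
  obtains D where
    "\<And>s t. \<bar>s\<bar> < r \<Longrightarrow> \<bar>t\<bar> < r \<Longrightarrow> ((\<lambda>s. F s t) has_vector_derivative D s t) (at s)"
    "\<And>s t. \<bar>s\<bar> < r \<Longrightarrow> \<bar>t\<bar> < r \<Longrightarrow>
       ((\<lambda>(m, n). of_nat (Suc m) * a (Suc m, n) * of_real (s ^ m * t ^ n)) has_sum D s t) UNIV"
proof -
  define a' where "a' = (\<lambda>(m, n). of_nat (Suc m) * a (Suc m, n))"
  have summ: "(\<lambda>(m, n). a' (m, n) * of_real (s ^ m * t ^ n)) summable_on UNIV" if st: "\<bar>s\<bar> < r" "\<bar>t\<bar> < r" for s t
  proof -
    define \<rho> where "\<rho> = (max \<bar>s\<bar> \<bar>t\<bar> + r) / 2"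
    have \<rho>: "\<rho> > 0" "\<rho> < r" "\<bar>s\<bar> < \<rho>" "\<bar>t\<bar> < \<rho>" using st by (auto simp: \<rho>_def)
    obtain K where K: "K > 0" "\<And>m. real (Suc m) * (\<bar>s\<bar> / \<rho>) ^ m \<le> K"
      by (rule bounded_Suc_times_power[of "\<bar>s\<bar> / \<rho>"]) (use \<rho> in auto)
    have "(\<lambda>(m, n). norm (a (m, n)) * (\<rho> ^ m * \<rho> ^ n)) summable_on UNIV"
      by (rule double_series_abs_summable[OF F]) (use \<rho> in auto)
    then have "(\<lambda>(m, n). norm (a (m, n)) * (\<rho> ^ m * \<rho> ^ n)) summable_on ((\<lambda>(m, n). (Suc m, n)) ` UNIV)"
      by (rule summable_on_subset_banach) auto
    then have "((\<lambda>(m, n). norm (a (m, n)) * (\<rho> ^ m * \<rho> ^ n)) \<circ> (\<lambda>(m, n). (Suc m, n))) summable_on UNIV"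
      by (subst (asm) summable_on_reindex) (auto simp: inj_on_def)
    then have S: "(\<lambda>p. K / \<rho> * ((\<lambda>(m, n). norm (a (m, n)) * (\<rho> ^ m * \<rho> ^ n)) \<circ> (\<lambda>(m, n). (Suc m, n))) p)
        summable_on UNIV"
      by (rule summable_on_cmult_right)
    have "(\<lambda>p. norm ((\<lambda>(m, n). a' (m, n) * of_real (s ^ m * t ^ n)) p)) summable_on UNIV"
    proof (rule summable_on_comparison_test[OF S])
      fix p :: "nat \<times> nat"
      obtain m n where p: "p = (m, n)" by (cases p)
      have "\<bar>s\<bar> ^ m = (\<bar>s\<bar> / \<rho>) ^ m * \<rho> ^ m" using \<rho> by (simp add: power_divide)
      then have "real (Suc m) * \<bar>s\<bar> ^ m \<le> K * \<rho> ^ m"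
        using mult_right_mono[OF K(2)[of m], of "\<rho> ^ m"] \<rho> by (simp add: mult.assoc)
      moreover have "\<bar>t\<bar> ^ n * norm (a (Suc m, n)) \<le> \<rho> ^ n * norm (a (Suc m, n))"
        using \<rho> by (intro mult_right_mono power_mono) auto
      ultimately have "real (Suc m) * \<bar>s\<bar> ^ m * (\<bar>t\<bar> ^ n * norm (a (Suc m, n)))
          \<le> K * \<rho> ^ m * (\<rho> ^ n * norm (a (Suc m, n)))"
        by (rule mult_mono) (use \<rho> K in auto)
      also have "\<dots> = K / \<rho> * (norm (a (Suc m, n)) * (\<rho> ^ Suc m * \<rho> ^ n))"
        using \<rho> by simp
      finally show "norm ((\<lambda>(m, n). a' (m, n) * of_real (s ^ m * t ^ n)) p)
          \<le> K / \<rho> * ((\<lambda>(m, n). norm (a (m, n)) * (\<rho> ^ m * \<rho> ^ n)) \<circ> (\<lambda>(m, n). (Suc m, n))) p"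
        by (simp add: p a'_def norm_mult norm_power mult_ac del: of_nat_Suc power_Suc)
    qed simp
    then show ?thesis unfolding summable_on_iff_abs_summable_on_complex .
  qed
  define D where "D = (\<lambda>s t. \<Sum>\<^sub>\<infinity>(m, n). a' (m, n) * of_real (s ^ m * t ^ n))"
  have D: "((\<lambda>(m, n). a' (m, n) * of_real (s ^ m * t ^ n)) has_sum D s t) UNIV" if "\<bar>s\<bar> < r" "\<bar>t\<bar> < r" for s t
    unfolding D_def using summ[OF that] by (rule has_sum_infsum)
  have "((\<lambda>s. F s t) has_vector_derivative D s t) (at s)" if st: "\<bar>s\<bar> < r" "\<bar>t\<bar> < r" for s t
  proof -
    have r: "r > 0" using st by auto
    define \<rho> where "\<rho> = (\<bar>s\<bar> + r) / 2"
    have \<rho>: "\<rho> > 0" "\<rho> < r" "\<bar>s\<bar> < \<rho>" using st r by (auto simp: \<rho>_def)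
    define c where "c = (\<lambda>m. \<Sum>\<^sub>\<infinity>n. a (m, n) * of_real (t ^ n))"
    have c: "((\<lambda>n. a (m, n) * of_real (t ^ n)) has_sum c m) UNIV" for m
    proof -
      have "(\<lambda>(m, n). a (m, n) * of_real (\<rho> ^ m * t ^ n)) summable_on (UNIV \<times> UNIV)"
        using F[of \<rho> t] \<rho> st by (auto simp: summable_on_def)
      from summable_on_SigmaD1[OF this, of m]
      have "(\<lambda>n. of_real (\<rho> ^ m) * (a (m, n) * of_real (t ^ n))) summable_on UNIV"
        by (simp add: mult_ac)
      then have "(\<lambda>n. a (m, n) * of_real (t ^ n)) summable_on UNIV"
        using \<rho> by (subst (asm) summable_on_cmult_right') auto
      then show ?thesis unfolding c_def by (rule has_sum_infsum)
    qed
    have Fs: "(\<lambda>m. c m * of_real s ^ m) sums F s t" if s: "\<bar>s\<bar> < r" for s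
    proof (rule has_sum_imp_sums)
      have "((\<lambda>p. case p of (m, n) \<Rightarrow> a (m, n) * of_real (s ^ m * t ^ n)) has_sum F s t) (UNIV \<times> UNIV)"
        using F[OF s st(2)] by simp
      then show "((\<lambda>m. c m * of_real s ^ m) has_sum F s t) UNIV"
      proof (rule has_sum_SigmaD)
        fix m
        have "((\<lambda>n. of_real (s ^ m) * (a (m, n) * of_real (t ^ n))) has_sum of_real (s ^ m) * c m) UNIV"
          by (rule has_sum_cmult_right[OF c])
        then show "((\<lambda>n. case (m, n) of (m, n) \<Rightarrow> a (m, n) * of_real (s ^ m * t ^ n))
            has_sum c m * of_real s ^ m) UNIV"
          by (simp add: mult_ac)
      qed
    qed
    have Ds: "(\<lambda>m. diffs c m * of_real s ^ m) sums D s t"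
    proof (rule has_sum_imp_sums)
      have "((\<lambda>p. case p of (m, n) \<Rightarrow> a' (m, n) * of_real (s ^ m * t ^ n)) has_sum D s t) (UNIV \<times> UNIV)"
        using D[OF st] by simp
      then show "((\<lambda>m. diffs c m * of_real s ^ m) has_sum D s t) UNIV"
      proof (rule has_sum_SigmaD)
        fix m
        have "((\<lambda>n. of_nat (Suc m) * of_real (s ^ m) * (a (Suc m, n) * of_real (t ^ n)))
            has_sum of_nat (Suc m) * of_real (s ^ m) * c (Suc m)) UNIV"
          by (rule has_sum_cmult_right[OF c])
        then show "((\<lambda>n. case (m, n) of (m, n) \<Rightarrow> a' (m, n) * of_real (s ^ m * t ^ n))
            has_sum diffs c m * of_real s ^ m) UNIV"
          by (simp add: mult_ac a'_def diffs_def del: of_nat_Suc)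
      qed
    qed
    have "((\<lambda>z. \<Sum>m. c m * z ^ m) has_field_derivative (\<Sum>m. diffs c m * of_real s ^ m)) (at (of_real s))"
    proof (rule termdiffs_strong)
      show "summable (\<lambda>m. c m * of_real \<rho> ^ m)" using sums_summable[OF Fs[of \<rho>]] \<rho> by simp
    qed (use \<rho> in simp)
    then have "((\<lambda>s. \<Sum>m. c m * of_real s ^ m) has_vector_derivative (\<Sum>m. diffs c m * of_real s ^ m)) (at s)"
      by (rule has_vector_derivative_real_field)
    moreover have "(\<Sum>m. diffs c m * of_real s ^ m) = D s t" using Ds by (rule sums_unique[symmetric])
    ultimately have "((\<lambda>s. \<Sum>m. c m * of_real s ^ m) has_vector_derivative D s t) (at s)" by simp
    then show ?thesis
    proof (rule has_vector_derivative_transform_within_open)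
      show "open {-r<..<r}" by simp
      show "s \<in> {-r<..<r}" using st by auto
      fix x assume "x \<in> {-r<..<r}"
      then show "(\<Sum>m. c m * of_real x ^ m) = F x t" using Fs[of x]
          by (auto simp: abs_if sums_unique[symmetric] split: if_splits)
    qed
  qed
  then show thesis using D that[of D] by (simp add: a'_def)
qed

text \<open>
  The differentiated series represents the partial derivative in the whole neighbourhood, not just at
  its centre.
\<close>

lemma real_analytic_partial_x:
  assumes "real_analytic_on u S"
  shows "real_analytic_on (partial_x u) S"
  unfolding real_analytic_on_def
proof
  fix z assume "z \<in> S"
  then obtain r a where r: "r > 0" and F: "\<And>s t. \<bar>s\<bar> < r \<Longrightarrow> \<bar>t\<bar> < r \<Longrightarrow>
        ((\<lambda>(m, n). a (m, n) * of_real (s ^ m * t ^ n)) has_sum u (z + Complex s t)) UNIV"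
    using assms unfolding real_analytic_on_def by blast
  obtain D where D: "\<And>s t. \<bar>s\<bar> < r \<Longrightarrow> \<bar>t\<bar> < r \<Longrightarrow> ((\<lambda>s. u (z + Complex s t)) has_vector_derivative D s t) (at s)"
    "\<And>s t. \<bar>s\<bar> < r \<Longrightarrow> \<bar>t\<bar> < r \<Longrightarrow>
       ((\<lambda>(m, n). of_nat (Suc m) * a (Suc m, n) * of_real (s ^ m * t ^ n)) has_sum D s t) UNIV"
    using double_series_derivative[of r a "\<lambda>s t. u (z + Complex s t)"] F by blast
  have "partial_x u (z + Complex s t) = D s t" if "\<bar>s\<bar> < r" "\<bar>t\<bar> < r" for s t
    unfolding partial_x_def
  proof (rule vector_derivative_at)
    have "((\<lambda>x. x - Re z) has_vector_derivative 1) (at (Re z + s))" by (auto intro!: derivative_eq_intros)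
    from vector_diff_chain_at[OF this, of "\<lambda>s. u (z + Complex s t)" "D s t"] D(1)[OF that]
    show "((\<lambda>x. u (Complex x (Im (z + Complex s t)))) has_vector_derivative D s t) (at (Re (z + Complex s t)))"
      by (simp add: o_def complex_eq_iff Complex_eq_0 plus_complex.ctr)
  qed
  then show "\<exists>r>0. \<exists>a. \<forall>s t. \<bar>s\<bar> < r \<longrightarrow> \<bar>t\<bar> < r \<longrightarrow>
     ((\<lambda>(m, n). a (m, n) * of_real (s ^ m * t ^ n)) has_sum partial_x u (z + Complex s t)) UNIV"
    using r D(2) by (intro exI[of _ r] conjI exI[of _ "\<lambda>(m, n). of_nat (Suc m) * a (Suc m, n)"]) auto
qed

lemma real_analytic_partial_y:
  assumes "real_analytic_on u S"
  shows "real_analytic_on (partial_y u) S"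
  unfolding real_analytic_on_def
proof
  fix z assume "z \<in> S"
  then obtain r a where r: "r > 0" and F: "\<And>s t. \<bar>s\<bar> < r \<Longrightarrow> \<bar>t\<bar> < r \<Longrightarrow>
        ((\<lambda>(m, n). a (m, n) * of_real (s ^ m * t ^ n)) has_sum u (z + Complex s t)) UNIV"
    using assms unfolding real_analytic_on_def by blast
  define a' where "a' = (\<lambda>(m, n). a (n, m))"
  have F': "((\<lambda>(m, n). a' (m, n) * of_real (s ^ m * t ^ n)) has_sum u (z + Complex t s)) UNIV"
      if "\<bar>s\<bar> < r" "\<bar>t\<bar> < r" for s t
  proof -
    have "((\<lambda>(m, n). a (m, n) * of_real (t ^ m * s ^ n)) has_sum u (z + Complex t s)) (UNIV \<times> UNIV)"
      using F[OF that(2,1)] by simp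
    then have "((\<lambda>(x, y). case (y, x) of (m, n) \<Rightarrow> a (m, n) * of_real (t ^ m * s ^ n)) has_sum u (z
        + Complex t s)) (UNIV \<times> UNIV)"
      by (subst (asm) has_sum_swap)
    then show ?thesis by (simp add: a'_def mult_ac)
  qed
  obtain D where D: "\<And>s t. \<bar>s\<bar> < r \<Longrightarrow> \<bar>t\<bar> < r \<Longrightarrow> ((\<lambda>s. u (z + Complex t s)) has_vector_derivative D s t) (at s)"
    "\<And>s t. \<bar>s\<bar> < r \<Longrightarrow> \<bar>t\<bar> < r \<Longrightarrow>
       ((\<lambda>(m, n). of_nat (Suc m) * a' (Suc m, n) * of_real (s ^ m * t ^ n)) has_sum D s t) UNIV"
    using double_series_derivative[of r a' "\<lambda>s t. u (z + Complex t s)"] F' by blast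
  have p: "partial_y u (z + Complex s t) = D t s" if "\<bar>s\<bar> < r" "\<bar>t\<bar> < r" for s t
    unfolding partial_y_def
  proof (rule vector_derivative_at)
    have "((\<lambda>x. x - Im z) has_vector_derivative 1) (at (Im z + t))" by (auto intro!: derivative_eq_intros)
    from vector_diff_chain_at[OF this, of "\<lambda>t. u (z + Complex s t)" "D t s"] D(1)[OF that(2,1)]
    show "((\<lambda>y. u (Complex (Re (z + Complex s t)) y)) has_vector_derivative D t s) (at (Im (z + Complex s t)))"
      by (simp add: o_def complex_eq_iff Complex_eq_0 plus_complex.ctr)
  qed
  have D2: "((\<lambda>(m, n). of_nat (Suc n) * a (m, Suc n) * of_real (s ^ m * t ^ n)) has_sum partial_y u (z
      + Complex s t)) UNIV"
    if st: "\<bar>s\<bar> < r" "\<bar>t\<bar> < r" for s t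
  proof -
    have "((\<lambda>(m, n). of_nat (Suc m) * a' (Suc m, n) * of_real (t ^ m * s ^ n)) has_sum D t s) (UNIV \<times> UNIV)"
      using D(2)[OF st(2,1)] by simp
    then have "((\<lambda>(x, y). case (y, x) of (m, n) \<Rightarrow> of_nat (Suc m) * a' (Suc m, n) * of_real (t ^ m * s ^ n))
        has_sum D t s) (UNIV \<times> UNIV)"
      by (subst (asm) has_sum_swap)
    then show ?thesis by (simp add: a'_def mult_ac p[OF st])
  qed
  then show "\<exists>r>0. \<exists>a. \<forall>s t. \<bar>s\<bar> < r \<longrightarrow> \<bar>t\<bar> < r \<longrightarrow>
     ((\<lambda>(m, n). a (m, n) * of_real (s ^ m * t ^ n)) has_sum partial_y u (z + Complex s t)) UNIV"
    using r by (intro exI[of _ r] conjI exI[of _ "\<lambda>(m, n). of_nat (Suc n) * a (m, Suc n)"]) auto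
qed

text \<open>
  All terms of degree at least two are together bounded by a constant times the square of the distance
  to the centre.
\<close>

lemma real_analytic_has_derivative:
  assumes "real_analytic_on u S" "z \<in> S"
  shows "(u has_derivative (\<lambda>h. of_real (Re h) * partial_x u z + of_real (Im h) * partial_y u z)) (at z)"
proof -
  obtain r a where r: "r > 0" and F: "\<And>s t. \<bar>s\<bar> < r \<Longrightarrow> \<bar>t\<bar> < r \<Longrightarrow>
        ((\<lambda>(m, n). a (m, n) * of_real (s ^ m * t ^ n)) has_sum u (z + Complex s t)) UNIV"
    using assms unfolding real_analytic_on_def by blast
  define \<rho> where "\<rho> = r / 2"
  have \<rho>: "\<rho> > 0" "\<rho> < r" using r by (auto simp: \<rho>_def)
  have S: "(\<lambda>(m, n). norm (a (m, n)) * (\<rho> ^ m * \<rho> ^ n)) summable_on UNIV"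
    by (rule double_series_abs_summable[of r a "\<lambda>s t. u (z + Complex s t)", OF F]) (use \<rho> in auto)
  \<comment> \<open>The exponents of the affine part of the series.\<close>
  define I where "I = {(0::nat, 0::nat), (1, 0), (0, 1)}"
  define K where "K = (\<Sum>\<^sub>\<infinity>(m, n)\<in>-I. norm (a (m, n)) * (\<rho> ^ m * \<rho> ^ n))"
  have SK: "(\<lambda>(m, n). norm (a (m, n)) * (\<rho> ^ m * \<rho> ^ n)) summable_on (-I)"
    by (rule summable_on_subset_banach[OF S]) simp
  have K: "((\<lambda>(m, n). norm (a (m, n)) * (\<rho> ^ m * \<rho> ^ n)) has_sum K) (-I)"
    unfolding K_def by (rule has_sum_infsum[OF SK])
  have K0: "K \<ge> 0" unfolding K_def by (rule infsum_nonneg) (use \<rho> in auto)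
  have bound: "norm (u (z + Complex s t) - (a (0,0) + of_real s * a (1,0) + of_real t * a (0,1))) \<le> (d / \<rho>)\<^sup>2 * K"
    if st: "\<bar>s\<bar> \<le> d" "\<bar>t\<bar> \<le> d" and d: "d \<le> \<rho>" for s t d
  proof -
    have d0: "d \<ge> 0" using st by auto
    have "((\<lambda>(m, n). a (m, n) * of_real (s ^ m * t ^ n)) has_sum (u (z + Complex s t)
        - sum (\<lambda>(m, n). a (m, n) * of_real (s ^ m * t ^ n)) I)) (UNIV - I)"
      by (rule has_sum_Diff[OF F has_sum_finite]) (use st d \<rho> in \<open>auto simp: I_def\<close>)
    also have "sum (\<lambda>(m, n). a (m, n) * of_real (s ^ m * t ^ n)) I = a (0,0) + of_real s * a (1,0)
        + of_real t * a (0,1)"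
      by (simp add: I_def)
    finally have h: "((\<lambda>(m, n). a (m, n) * of_real (s ^ m * t ^ n)) has_sum (u (z + Complex s t)
        - (a (0,0) + of_real s * a (1,0) + of_real t * a (0,1)))) (-I)"
      by (simp add: Compl_eq_Diff_UNIV)
    have le: "norm (case p of (m, n) \<Rightarrow> a (m, n) * of_real (s ^ m * t ^ n))
        \<le> (d / \<rho>)\<^sup>2 * (case p of (m, n) \<Rightarrow> norm (a (m, n)) * (\<rho> ^ m * \<rho> ^ n))"
      if p: "p \<in> - I" for p
    proof -
      obtain m n where mn: "p = (m, n)" by (cases p)
      have "m + n \<ge> 2" using p unfolding mn I_def by (cases m; cases n; auto)
      have "\<bar>s\<bar> ^ m * \<bar>t\<bar> ^ n \<le> d ^ m * d ^ n" using st d0 by (intro mult_mono power_mono) auto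
      also have "\<dots> = (d / \<rho>) ^ (m + n) * (\<rho> ^ m * \<rho> ^ n)" using \<rho> by (simp add: power_add power_divide)
      also have "\<dots> \<le> (d / \<rho>)\<^sup>2 * (\<rho> ^ m * \<rho> ^ n)"
        by (intro mult_right_mono power_decreasing \<open>m + n \<ge> 2\<close>) (use d0 d \<rho> in auto)
      finally have "norm (a (m, n)) * (\<bar>s\<bar> ^ m * \<bar>t\<bar> ^ n) \<le> norm (a (m, n)) * ((d / \<rho>)\<^sup>2 * (\<rho> ^ m * \<rho> ^ n))"
        by (intro mult_left_mono) auto
      then show ?thesis by (simp add: mn norm_mult norm_power mult_ac)
    qed
    have hK: "((\<lambda>p. (d / \<rho>)\<^sup>2 * (case p of (m, n) \<Rightarrow> norm (a (m, n)) * (\<rho> ^ m * \<rho> ^ n))) has_sum (d / \<rho>)\<^sup>2 * K) (-I)"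
      by (rule has_sum_cmult_right[OF K])
    have "(\<lambda>p. norm (case p of (m, n) \<Rightarrow> a (m, n) * of_real (s ^ m * t ^ n))) summable_on (-I)"
      by (rule summable_on_comparison_test[OF has_sum_imp_summable[OF hK]]) (use le in auto)
    then have hn: "((\<lambda>p. norm (case p of (m, n) \<Rightarrow> a (m, n) * of_real (s ^ m * t ^ n))) has_sum
       (\<Sum>\<^sub>\<infinity>p\<in>-I. norm (case p of (m, n) \<Rightarrow> a (m, n) * of_real (s ^ m * t ^ n)))) (-I)"
      by (rule has_sum_infsum)
    have "norm (u (z + Complex s t) - (a (0,0) + of_real s * a (1,0) + of_real t * a (0,1)))
        \<le> (\<Sum>\<^sub>\<infinity>p\<in>-I. norm (case p of (m, n) \<Rightarrow> a (m, n) * of_real (s ^ m * t ^ n)))"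
      by (rule norm_has_sum_bound[OF hn h])
    also have "\<dots> \<le> (d / \<rho>)\<^sup>2 * K"
      by (rule has_sum_mono[OF hn hK]) (rule le)
    finally show ?thesis .
  qed
  have a0: "u z = a (0,0)"
    using bound[of 0 0 0] \<rho> by (simp add: zero_complex.ctr[symmetric])
  have der: "(u has_derivative (\<lambda>h. of_real (Re h) * a (1,0) + of_real (Im h) * a (0,1))) (at z)"
    unfolding has_derivative_at_alt
  proof (intro conjI allI impI)
    show "bounded_linear (\<lambda>h. of_real (Re h) * a (1,0) + of_real (Im h) * a (0,1))"
      by (intro bounded_linear_add bounded_linear_mult_const bounded_linear_compose[OF bounded_linear_of_real]
          bounded_linear_Re bounded_linear_Im)
    fix e :: real assume e: "e > 0"
    define d where "d = min \<rho> (e * \<rho>\<^sup>2 / (K + 1))"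
    have d: "d > 0" using \<rho> e K0 by (simp add: d_def)
    show "\<exists>d>0. \<forall>y. norm (y - z) < d \<longrightarrow> norm (u y - u z - (of_real (Re (y - z)) * a (1,0)
        + of_real (Im (y - z)) * a (0,1))) \<le> e * norm (y - z)"
    proof (intro exI[of _ d] conjI d allI impI)
      fix y assume y: "norm (y - z) < d"
      define b where "b = norm (y - z)"
      have "norm (u (z + Complex (Re (y - z)) (Im (y - z))) - (a (0,0) + of_real (Re (y - z)) * a (1,0)
          + of_real (Im (y - z)) * a (0,1))) \<le> (b / \<rho>)\<^sup>2 * K"
        by (rule bound) (use y in \<open>auto simp: b_def d_def abs_Re_le_cmod[of "y
            - z", simplified] abs_Im_le_cmod[of "y - z", simplified]\<close>)
      also have "z + Complex (Re (y - z)) (Im (y - z)) = y" by (simp add: complex_eq_iff)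
      finally have 1: "norm (u y - u z - (of_real (Re (y - z)) * a (1,0) + of_real (Im (y - z)) * a (0,1)))
          \<le> (b / \<rho>)\<^sup>2 * K"
        by (simp add: a0 algebra_simps)
      have "b \<le> e * \<rho>\<^sup>2 / (K + 1)" "b \<ge> 0" using y by (auto simp: b_def d_def)
      then have "b * (K + 1) \<le> e * \<rho>\<^sup>2" using K0 by (simp add: field_simps)
      then have "b * K \<le> e * \<rho>\<^sup>2" using \<open>b \<ge> 0\<close> by (simp add: algebra_simps)
      then have "b * (b * K) \<le> b * (e * \<rho>\<^sup>2)" using \<open>b \<ge> 0\<close> by (intro mult_left_mono)
      then have "(b / \<rho>)\<^sup>2 * K \<le> e * b" using \<rho> by (simp add: power_divide field_simps power2_eq_square)
      with 1 show "norm (u y - u z - (of_real (Re (y - z)) * a (1,0) + of_real (Im (y - z)) * a (0,1)))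
          \<le> e * norm (y - z)"
        by (simp add: b_def)
    qed
  qed
  have "partial_x u z = a (1,0)"
    unfolding partial_x_def
  proof (rule vector_derivative_at)
    have 1: "((\<lambda>x. Complex x (Im z)) has_derivative (\<lambda>h. of_real h)) (at (Re z))"
      unfolding Complex_eq by (auto intro!: derivative_eq_intros)
    have "((\<lambda>x. u (Complex x (Im z))) has_derivative (\<lambda>h. of_real (Re (of_real h)) * a (1,0)
        + of_real (Im (of_real h)) * a (0,1))) (at (Re z))"
      by (rule has_derivative_compose[OF 1]) (use der in simp)
    then show "((\<lambda>x. u (Complex x (Im z))) has_vector_derivative a (1,0)) (at (Re z))"
      by (simp add: has_vector_derivative_def scaleR_conv_of_real)
  qed
  moreover have "partial_y u z = a (0,1)"
    unfolding partial_y_def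
  proof (rule vector_derivative_at)
    have 1: "((\<lambda>x. Complex (Re z) x) has_derivative (\<lambda>h. \<i> * of_real h)) (at (Im z))"
      unfolding Complex_eq by (auto intro!: derivative_eq_intros)
    have "((\<lambda>x. u (Complex (Re z) x)) has_derivative (\<lambda>h. of_real (Re (\<i> * of_real h)) * a (1,0)
        + of_real (Im (\<i> * of_real h)) * a (0,1))) (at (Im z))"
      by (rule has_derivative_compose[OF 1]) (use der in simp)
    then show "((\<lambda>x. u (Complex (Re z) x)) has_vector_derivative a (0,1)) (at (Im z))"
      by (simp add: has_vector_derivative_def scaleR_conv_of_real)
  qed
  ultimately show ?thesis using der by simp
qed

section \<open>Wirtinger derivatives and the slash operator\<close>

text \<open>
  Differentiability in the real sense, with the derivatives with respect to \<open>z\<close> and to the conjugate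
  of \<open>z\<close>.  In these terms a holomorphic substitution multiplies the two derivatives by \<open>\<phi>'\<close> and by its
  conjugate and does not mix them.
\<close>

definition wirtinger :: "(complex \<Rightarrow> complex) \<Rightarrow> complex \<Rightarrow> complex \<Rightarrow> complex \<Rightarrow> bool" where
  "wirtinger f p q z \<longleftrightarrow> (f has_derivative (\<lambda>h. p * h + q * cnj h)) (at z)"

lemma wirtinger_holomorphic: "(f has_field_derivative p) (at z) \<Longrightarrow> wirtinger f p 0 z"
  by (simp add: wirtinger_def has_field_derivative_def)

lemma wirtinger_antiholomorphic:
  assumes "(f has_field_derivative p) (at z)"
  shows "wirtinger (\<lambda>z. cnj (f z)) 0 (cnj p) z"
  using has_derivative_cnj[OF assms[unfolded has_field_derivative_def]]
  by (simp add: wirtinger_def)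

lemma wirtinger_const: "wirtinger (\<lambda>_. c) 0 0 z"
  by (simp add: wirtinger_def)

lemma wirtinger_add: "wirtinger f p q z \<Longrightarrow> wirtinger g r s z \<Longrightarrow> wirtinger (\<lambda>z. f z + g z) (p + r) (q + s) z"
  unfolding wirtinger_def by (drule (1) has_derivative_add) (simp add: algebra_simps)

lemma wirtinger_mult:
  "wirtinger f p q z \<Longrightarrow> wirtinger g r s z \<Longrightarrow> wirtinger (\<lambda>z. f z * g z) (f z * r + p * g z) (f z * s + q * g z) z"
  unfolding wirtinger_def by (drule (1) has_derivative_mult) (simp add: algebra_simps)

lemma wirtinger_compose_holomorphic:
  assumes "(\<phi> has_field_derivative \<phi>') (at z)" "wirtinger f p q (\<phi> z)"
  shows "wirtinger (\<lambda>z. f (\<phi> z)) (p * \<phi>') (q * cnj \<phi>') z"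
  using has_derivative_compose[OF assms(1)[unfolded has_field_derivative_def] assms(2)[unfolded wirtinger_def]]
  by (simp add: wirtinger_def mult.assoc)

lemma holomorphic_compose_wirtinger:
  assumes "wirtinger f p q z" "(g has_field_derivative g') (at (f z))"
  shows "wirtinger (\<lambda>z. g (f z)) (g' * p) (g' * q) z"
  using has_derivative_compose[OF assms(1)[unfolded wirtinger_def] assms(2)[unfolded has_field_derivative_def]]
  by (simp add: wirtinger_def algebra_simps)

lemma wirtinger_transform_open:
  assumes "wirtinger f p q z" "open S" "z \<in> S" "\<And>w. w \<in> S \<Longrightarrow> f w = g w"
  shows "wirtinger g p q z"
  using has_derivative_transform_within_open[OF assms(1)[unfolded wirtinger_def] assms(2-4)]
  by (simp add: wirtinger_def)

lemma wirtinger_has_vector_derivative: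
  assumes "wirtinger f p q (Complex x y)"
  shows "((\<lambda>x. f (Complex x y)) has_vector_derivative (p + q)) (at x)"
    and "((\<lambda>y. f (Complex x y)) has_vector_derivative \<i> * (p - q)) (at y)"
proof -
  have 1: "((\<lambda>x. Complex x y) has_derivative (\<lambda>h. of_real h)) (at x)"
    and 2: "((\<lambda>y. Complex x y) has_derivative (\<lambda>h. \<i> * of_real h)) (at y)"
    unfolding Complex_eq by (auto intro!: derivative_eq_intros)
  show "((\<lambda>x. f (Complex x y)) has_vector_derivative (p + q)) (at x)"
    using has_derivative_compose[OF 1 assms[unfolded wirtinger_def]]
    by (simp add: has_vector_derivative_def scaleR_conv_of_real algebra_simps)
  show "((\<lambda>y. f (Complex x y)) has_vector_derivative \<i> * (p - q)) (at y)"
    using has_derivative_compose[OF 2 assms[unfolded wirtinger_def]]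
    by (simp add: has_vector_derivative_def scaleR_conv_of_real algebra_simps)
qed

text \<open>
  Twice continuously differentiable functions: \<open>p\<close>, \<open>q\<close> are the two first derivatives, and a second
  letter records a further derivative in the same manner.  The mixed derivatives \<open>pq\<close> and \<open>qp\<close> are kept
  apart, as only their sum enters the Laplacian.
\<close>

definition wirtinger2 :: "(complex \<Rightarrow> complex) \<Rightarrow> (complex \<Rightarrow> complex) \<Rightarrow> (complex \<Rightarrow> complex) \<Rightarrow>
    (complex \<Rightarrow> complex) \<Rightarrow> (complex \<Rightarrow> complex) \<Rightarrow> (complex \<Rightarrow> complex) \<Rightarrow> (complex \<Rightarrow> complex) \<Rightarrow> complex set \<Rightarrow> bool" where
  "wirtinger2 u p q pp pq qp qq S \<longleftrightarrow>
     (\<forall>z\<in>S. wirtinger u (p z) (q z) z \<and> wirtinger p (pp z) (pq z) z \<and> wirtinger q (qp z) (qq z) z) \<and>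
     continuous_on S pp \<and> continuous_on S pq \<and> continuous_on S qp \<and> continuous_on S qq"

lemma wirtinger_continuous_on: "(\<And>z. z \<in> S \<Longrightarrow> wirtinger f (p z) (q z) z) \<Longrightarrow> continuous_on S f"
  unfolding wirtinger_def
  by (intro continuous_at_imp_continuous_on ballI) (blast intro: has_derivative_continuous)

lemma real_analytic_wirtinger:
  assumes "real_analytic_on u S" "z \<in> S"
  shows "wirtinger u ((partial_x u z - \<i> * partial_y u z) / 2) ((partial_x u z + \<i> * partial_y u z) / 2) z"
proof -
  have "of_real (Re h) * partial_x u z + of_real (Im h) * partial_y u z =
     (partial_x u z - \<i> * partial_y u z) / 2 * h + (partial_x u z + \<i> * partial_y u z) / 2 * cnj h" for h
  proof -
    have alg: "r * X + s * Y = (X - I * Y) / 2 * (r + I * s) + (X + I * Y) / 2 * (r - I * s)"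
      if "I * I = - 1" for r s X Y I :: complex
      using that by algebra
    have "h = of_real (Re h) + \<i> * of_real (Im h)" "cnj h = of_real (Re h) - \<i> * of_real (Im h)"
      by (simp_all add: complex_eq_iff)
    then show ?thesis using alg[of \<i> "of_real (Re h)" "partial_x u z" "of_real (Im h)" "partial_y u z"] by simp
  qed
  then show ?thesis
    using real_analytic_has_derivative[OF assms] by (simp add: wirtinger_def)
qed

lemma real_analytic_continuous_on: "real_analytic_on u S \<Longrightarrow> continuous_on S u"
  by (rule wirtinger_continuous_on) (rule real_analytic_wirtinger)

text \<open>
  With \<open>\<partial>\<^sub>x = \<partial> + \<partial>'\<close> and \<open>\<partial>\<^sub>y = i(\<partial> - \<partial>')\<close>, where \<open>\<partial>'\<close> is the derivative with respect to the conjugate,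
  the operator \<open>\<partial>\<^sub>x\<^sup>2 + \<partial>\<^sub>y\<^sup>2\<close> is \<open>2(\<partial>\<partial>' + \<partial>'\<partial>)\<close>.
\<close>

lemma real_analytic_wirtinger2:
  assumes "real_analytic_on u S"
  obtains p q pp pq qp qq where "wirtinger2 u p q pp pq qp qq S"
    "\<And>z. z \<in> S \<Longrightarrow> maass_laplacian k u z = - 2 * of_real ((Im z)\<^sup>2) * (pq z + qp z)
        + \<i> * k * of_real (Im z) * (p z + q z)"
proof -
  define ux uy where "ux = partial_x u" and "uy = partial_y u"
  define uxx uxy uyx uyy where "uxx = partial_x ux" and "uxy = partial_y ux" and "uyx = partial_x uy"
      and "uyy = partial_y uy"
  have an: "real_analytic_on ux S" "real_analytic_on uy S" "real_analytic_on uxx S" "real_analytic_on uxy S"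
    "real_analytic_on uyx S" "real_analytic_on uyy S"
    using assms by (simp_all add: ux_def uy_def uxx_def uxy_def uyx_def uyy_def real_analytic_partial_x
        real_analytic_partial_y)
  note c = an[THEN real_analytic_continuous_on]
  have lin: "wirtinger (\<lambda>z. (f z + e * g z) / 2) ((fp + e * gp) / 2) ((fq + e * gq) / 2) z"
    if "wirtinger f fp fq z" "wirtinger g gp gq z" for f fp fq g gp gq e z
    using wirtinger_mult[OF wirtinger_const[of "1/2"] wirtinger_add[OF that(1) wirtinger_mult[OF
        wirtinger_const[of e] that(2)]]]
    by simp
  have w: "wirtinger u ((ux z + - \<i> * uy z) / 2) ((ux z + \<i> * uy z) / 2) z"
    "wirtinger ux ((uxx z - \<i> * uxy z) / 2) ((uxx z + \<i> * uxy z) / 2) z"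
    "wirtinger uy ((uyx z - \<i> * uyy z) / 2) ((uyx z + \<i> * uyy z) / 2) z" if "z \<in> S" for z
    using real_analytic_wirtinger[OF assms that] real_analytic_wirtinger[OF an(1) that]
        real_analytic_wirtinger[OF an(2) that]
    by (simp_all add: ux_def uy_def uxx_def uxy_def uyx_def uyy_def)
  show thesis
  proof (rule that)
    show "wirtinger2 u (\<lambda>z. (ux z + - \<i> * uy z) / 2) (\<lambda>z. (ux z + \<i> * uy z) / 2)
       (\<lambda>z. ((uxx z - \<i> * uxy z) / 2 + - \<i> * ((uyx z - \<i> * uyy z) / 2)) / 2)
       (\<lambda>z. ((uxx z + \<i> * uxy z) / 2 + - \<i> * ((uyx z + \<i> * uyy z) / 2)) / 2)
       (\<lambda>z. ((uxx z - \<i> * uxy z) / 2 + \<i> * ((uyx z - \<i> * uyy z) / 2)) / 2)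
       (\<lambda>z. ((uxx z + \<i> * uxy z) / 2 + \<i> * ((uyx z + \<i> * uyy z) / 2)) / 2) S"
      unfolding wirtinger2_def
      by (intro conjI ballI w lin continuous_intros c; simp)
    show "maass_laplacian k u z = - 2 * of_real ((Im z)\<^sup>2) *
       (((uxx z + \<i> * uxy z) / 2 + - \<i> * ((uyx z + \<i> * uyy z) / 2)) / 2 +
        ((uxx z - \<i> * uxy z) / 2 + \<i> * ((uyx z - \<i> * uyy z) / 2)) / 2)
       + \<i> * k * of_real (Im z) * ((ux z + - \<i> * uy z) / 2 + (ux z + \<i> * uy z) / 2)" for z
    proof -
      have 1: "((uxx z + \<i> * uxy z) / 2 + - \<i> * ((uyx z + \<i> * uyy z) / 2)) / 2 +
        ((uxx z - \<i> * uxy z) / 2 + \<i> * ((uyx z - \<i> * uyy z) / 2)) / 2 = (uxx z + uyy z) / 2"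
        by (simp add: field_simps)
      have 2: "(ux z + - \<i> * uy z) / 2 + (ux z + \<i> * uy z) / 2 = ux z" by (simp add: field_simps)
      show ?thesis unfolding 1 2 maass_laplacian_def
        by (simp add: ux_def uy_def uxx_def uyy_def)
    qed
  qed
qed

text \<open>
  The invariance of \<open>\<Delta>\<^sub>k\<close> after division by the automorphy factor.  Here \<open>i1\<close> and \<open>i2\<close> are the inverses of
  \<open>j = cz + d\<close> and of its conjugate; their relation to \<open>y\<close> comes from \<open>j\<close> minus its conjugate being
  \<open>2icy\<close>.
\<close>

lemma slash_laplacian_identity:
  fixes k c y i1 i2 u p q pq qp I :: complex
  assumes D: "i2 - i1 = 2 * I * c * y * i1 * i2" and I: "I * I = - 1"
  shows "- 2 * y\<^sup>2 * ((k * c / 2 * i2 * (p * i1\<^sup>2 + - (k * c / 2) * i1 * u) + (pq * i1\<^sup>2 * i2\<^sup>2 +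
      - (k * c / 2) * i1 * (q * i2\<^sup>2))) +
      (- (k * c / 2) * i1 * (q * i2\<^sup>2 + k * c / 2 * i2 * u) + (qp * i1\<^sup>2 * i2\<^sup>2 + k * c / 2 * i2 * (p * i1\<^sup>2)))) +
    I * k * y * ((p * i1\<^sup>2 + - (k * c / 2) * i1 * u) + (q * i2\<^sup>2 + k * c / 2 * i2 * u))
    = - 2 * (y * i1 * i2)\<^sup>2 * (pq + qp) + I * k * (y * i1 * i2) * (p + q)"
proof -
  define h where "h = k / 2"
  have k: "k = 2 * h" by (simp add: h_def)
  have "- 2 * y\<^sup>2 * ((h * c * i2 * (p * i1\<^sup>2 + - (h * c) * i1 * u) + (pq * i1\<^sup>2 * i2\<^sup>2 +
      - (h * c) * i1 * (q * i2\<^sup>2))) +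
      (- (h * c) * i1 * (q * i2\<^sup>2 + h * c * i2 * u) + (qp * i1\<^sup>2 * i2\<^sup>2 + h * c * i2 * (p * i1\<^sup>2)))) +
    I * (2 * h) * y * ((p * i1\<^sup>2 + - (h * c) * i1 * u) + (q * i2\<^sup>2 + h * c * i2 * u))
    = - 2 * (y * i1 * i2)\<^sup>2 * (pq + qp) + I * (2 * h) * (y * i1 * i2) * (p + q)"
    using D I by algebra
  then show ?thesis unfolding k by simp
qed

lemma open_upper_half_plane: "open upper_half_plane"
  unfolding upper_half_plane_def by (rule open_halfspace_Im_gt)

lemma det_2_complex:
  fixes A :: "real^2^2"
  assumes "det A = 1"
  shows "complex_of_real (A $ 1 $ 1) * of_real (A $ 2 $ 2) - of_real (A $ 1 $ 2) * of_real (A $ 2 $ 1) = 1"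
proof -
  have "A $ 1 $ 1 * A $ 2 $ 2 - A $ 1 $ 2 * A $ 2 $ 1 = 1" using assms by (simp add: det_2)
  from arg_cong[OF this, of complex_of_real] show ?thesis by simp
qed

lemma cocycle_nonzero:
  assumes "det A = 1" "z \<in> upper_half_plane"
  shows "cocycle A z \<noteq> 0"
proof
  assume "cocycle A z = 0"
  then have 1: "A $ 2 $ 1 * Re z + A $ 2 $ 2 = 0" and 2: "A $ 2 $ 1 * Im z = 0"
    by (auto simp: cocycle_def complex_eq_iff)
  have "A $ 2 $ 1 = 0" using 2 assms(2) by (auto simp: upper_half_plane_def)
  then show False using 1 assms(1) by (simp add: det_2)
qed

lemma moebius_derivative:
  assumes A: "det A = 1" and z: "z \<in> upper_half_plane"
  shows "(moebius A has_field_derivative (1 / cocycle A z)\<^sup>2) (at z)"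
proof -
  have j: "of_real (A $ 2 $ 1) * z + of_real (A $ 2 $ 2) \<noteq> 0"
    using cocycle_nonzero[OF A z] by (simp add: cocycle_def)
  note d = det_2_complex[OF A]
  have "((\<lambda>z. (of_real (A $ 1 $ 1) * z + of_real (A $ 1 $ 2)) / (of_real (A $ 2 $ 1) * z + of_real (A $ 2 $ 2)))
      has_field_derivative
      (of_real (A $ 1 $ 1) * (of_real (A $ 2 $ 1) * z + of_real (A $ 2 $ 2)) - (of_real (A $ 1 $ 1) * z
          + of_real (A $ 1 $ 2)) * of_real (A $ 2 $ 1))
       / ((of_real (A $ 2 $ 1) * z + of_real (A $ 2 $ 2)) * (of_real (A $ 2 $ 1) * z + of_real (A $ 2 $ 2)))) (at z)"
  proof (rule DERIV_divide)
    have lin: "((\<lambda>z. a * z + b) has_field_derivative a) (at z)" for a b :: complex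
      by (auto intro!: derivative_eq_intros)
    show "((\<lambda>z. of_real (A $ 1 $ 1) * z + of_real (A $ 1 $ 2)) has_field_derivative of_real (A $ 1 $ 1)) (at z)"
      "((\<lambda>z. of_real (A $ 2 $ 1) * z + of_real (A $ 2 $ 2)) has_field_derivative of_real (A $ 2 $ 1)) (at z)"
      by (rule lin)+
    show "of_real (A $ 2 $ 1) * z + of_real (A $ 2 $ 2) \<noteq> 0" by (rule j)
  qed
  also have "of_real (A $ 1 $ 1) * (of_real (A $ 2 $ 1) * z + of_real (A $ 2 $ 2)) - (of_real (A $ 1 $ 1) * z
      + of_real (A $ 1 $ 2)) * of_real (A $ 2 $ 1) = 1"
    using d by (simp add: algebra_simps)
  finally show ?thesis
    unfolding moebius_def[abs_def] cocycle_def by (simp add: power2_eq_square)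
qed

lemma Im_moebius:
  assumes A: "det A = 1" and z: "z \<in> upper_half_plane"
  shows "complex_of_real (Im (moebius A z)) = of_real (Im z) * (1 / cocycle A z) * (1 / cnj (cocycle A z))"
proof -
  note d = det_2_complex[OF A]
  have I: "complex_of_real (Im w) = (w - cnj w) / (2 * \<i>)" for w by (simp add: complex_eq_iff)
  have j: "cocycle A z \<noteq> 0" by (rule cocycle_nonzero[OF A z])
  let ?n = "of_real (A $ 1 $ 1) * z + of_real (A $ 1 $ 2)"
  have "?n * cnj (cocycle A z) - cnj ?n * cocycle A z = (of_real (A $ 1 $ 1) * of_real (A $ 2 $ 2)
      - of_real (A $ 1 $ 2) * of_real (A $ 2 $ 1)) * (z - cnj z)"
    by (simp add: cocycle_def algebra_simps)
  then have n: "?n * cnj (cocycle A z) - cnj ?n * cocycle A z = z - cnj z" unfolding d by simp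
  have "moebius A z - cnj (moebius A z) = (?n * cnj (cocycle A z) - cnj ?n * cocycle A z) * (1 / cocycle A z) *
      (1 / cnj (cocycle A z))"
  proof -
    have alg: "n / j - m / l = (n * l - m * j) * (1 / j) * (1 / l)" if "j \<noteq> 0" "l \<noteq> 0" for n m j l :: complex
      using that by (simp add: field_simps)
    have "cnj (moebius A z) = cnj ?n / cnj (cocycle A z)" by (simp add: moebius_def)
    then show ?thesis unfolding moebius_def[of A z] using alg[OF j, of "cnj (cocycle A z)" ?n "cnj ?n"] j by simp
  qed
  then show ?thesis unfolding n I by simp
qed

lemma moebius_upper_half_plane:
  assumes A: "det A = 1" and z: "z \<in> upper_half_plane"
  shows "moebius A z \<in> upper_half_plane"
proof -
  have j: "cocycle A z \<noteq> 0" by (rule cocycle_nonzero[OF A z])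
  have "complex_of_real (Im (moebius A z)) = of_real (Im z / (norm (cocycle A z))\<^sup>2)"
    unfolding Im_moebius[OF A z] of_real_divide complex_norm_square by simp
  then have "Im (moebius A z) = Im z / (norm (cocycle A z))\<^sup>2" by (simp only: of_real_eq_iff)
  then show ?thesis using z j by (simp add: upper_half_plane_def)
qed

lemma cocycle_derivative: "(cocycle A has_field_derivative of_real (A $ 2 $ 1)) (at z)"
  unfolding cocycle_def[abs_def] by (auto intro!: derivative_eq_intros)

text \<open>
  For \<open>c \<noteq> 0\<close> the values of \<open>cz + d\<close> avoid the real axis, and the argument is \<open>(Ln j - cnj (Ln j)) / 2i\<close>, a
  holomorphic function plus an antiholomorphic one; for \<open>c = 0\<close> the factor is constant.
\<close>

lemma wirtinger_automorphy_factor: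
  fixes k :: complex
  assumes A: "det A = 1" and z: "z \<in> upper_half_plane"
  defines "J \<equiv> \<lambda>z. exp (- \<i> * k * of_real (Arg (cocycle A z)))"
  shows "wirtinger J (- (k * of_real (A $ 2 $ 1) / 2) * (1 / cocycle A z) * J z)
     (k * of_real (A $ 2 $ 1) / 2 * (1 / cnj (cocycle A z)) * J z) z"
proof (cases "A $ 2 $ 1 = 0")
  case True
  then have "J = (\<lambda>_. exp (- \<i> * k * of_real (Arg (of_real (A $ 2 $ 2)))))"
    by (simp add: J_def cocycle_def)
  then show ?thesis using True by (simp add: wirtinger_const)
next
  case False
  let ?j = "cocycle A z"
  have nz: "cocycle A w \<notin> \<real>\<^sub>\<le>\<^sub>0" if "w \<in> upper_half_plane" for w
    using that False by (auto simp: complex_nonpos_Reals_iff cocycle_def upper_half_plane_def)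
  have ln: "((\<lambda>z. Ln (cocycle A z)) has_field_derivative (1 / ?j * of_real (A $ 2 $ 1))) (at z)"
    using DERIV_chain2[OF has_field_derivative_Ln[OF nz[OF z]] cocycle_derivative]
    by (simp add: divide_inverse)
  have w: "wirtinger (\<lambda>z. (- k / 2) * (Ln (cocycle A z)) + (k / 2) * cnj (Ln (cocycle A z)))
     ((- k / 2) * (1 / ?j * of_real (A $ 2 $ 1))) ((k / 2) * cnj (1 / ?j * of_real (A $ 2 $ 1))) z"
    using wirtinger_add[OF wirtinger_mult[OF wirtinger_const[of "- k / 2"] wirtinger_holomorphic[OF ln]]
        wirtinger_mult[OF wirtinger_const[of "k / 2"] wirtinger_antiholomorphic[OF ln]]]
    by simp
  have J: "J w = exp ((- k / 2) * (Ln (cocycle A w)) + (k / 2) * cnj (Ln (cocycle A w)))"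
      if "w \<in> upper_half_plane" for w
  proof -
    have "cocycle A w \<noteq> 0" using nz[OF that] by auto
    then have "of_real (Arg (cocycle A w)) = (Ln (cocycle A w) - cnj (Ln (cocycle A w))) / (2 * \<i>)"
      by (simp add: Arg_eq_Im_Ln complex_eq_iff)
    moreover have "- \<i> * k * ((X - Y) / (2 * \<i>)) = (- k / 2) * X + (k / 2) * Y" for X Y
      by (simp add: field_simps)
    ultimately have "- \<i> * k * of_real (Arg (cocycle A w)) = (- k / 2) * (Ln (cocycle A w))
        + (k / 2) * cnj (Ln (cocycle A w))"
      by (simp only:)
    then show ?thesis by (simp add: J_def)
  qed
  have "wirtinger J (exp ((- k / 2) * (Ln (cocycle A z)) + (k / 2) * cnj (Ln (cocycle A z))) * ((- k / 2) *
      (1 / ?j * of_real (A $ 2 $ 1))))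
     (exp ((- k / 2) * (Ln (cocycle A z)) + (k / 2) * cnj (Ln (cocycle A z))) * ((k / 2) * cnj (1 / ?j * of_real
         (A $ 2 $ 1)))) z"
    by (rule wirtinger_transform_open[OF holomorphic_compose_wirtinger[OF w DERIV_exp] open_upper_half_plane z])
       (simp add: J)
  then show ?thesis unfolding J[OF z, symmetric] by (simp add: mult_ac)
qed

text \<open>
  The slash operator commutes with the weight \<open>k\<close> Laplacian.  With \<open>U = J \<cdot> (u \<circ> \<phi>)\<close>, each derivative of \<open>U\<close> is
  \<open>J\<close> times a polynomial in \<open>i1\<close>, \<open>i2\<close> and the derivatives of \<open>u\<close> at \<open>\<phi>(z)\<close>,
      and \<open>slash_laplacian_identity\<close> compares these
  expressions.
\<close>

lemma slash_wirtinger2: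
  assumes A: "det A = 1" and u: "wirtinger2 u p q pp pq qp qq upper_half_plane"
    and pde: "\<And>z. z \<in> upper_half_plane \<Longrightarrow>
      - 2 * of_real ((Im z)\<^sup>2) * (pq z + qp z) + \<i> * k * of_real (Im z) * (p z + q z) = lam * u z"
  obtains P Q PP PQ QP QQ where "wirtinger2 (slash k u A) P Q PP PQ QP QQ upper_half_plane"
    "\<And>z. z \<in> upper_half_plane \<Longrightarrow>
      - 2 * of_real ((Im z)\<^sup>2) * (PQ z + QP z) + \<i> * k * of_real (Im z) * (P z + Q z) = lam * slash k u A z"
proof -
  let ?H = upper_half_plane
  let ?\<phi> = "moebius A"
  define c where "c = complex_of_real (A $ 2 $ 1)"
  define J where "J = (\<lambda>z. exp (- \<i> * k * of_real (Arg (cocycle A z))))"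
  define i1 where "i1 = (\<lambda>z. 1 / cocycle A z)"
  define i2 where "i2 = (\<lambda>z. cnj (i1 z))"
  have \<phi>: "(?\<phi> has_field_derivative (i1 z)\<^sup>2) (at z)" if "z \<in> ?H" for z
    unfolding i1_def by (rule moebius_derivative[OF A that])
  have \<phi>H: "?\<phi> z \<in> ?H" if "z \<in> ?H" for z by (rule moebius_upper_half_plane[OF A that])
  have j: "cocycle A z \<noteq> 0" if "z \<in> ?H" for z by (rule cocycle_nonzero[OF A that])
  have wJ: "wirtinger J (- (k * c / 2) * i1 z * J z) (k * c / 2 * i2 z * J z) z" if "z \<in> ?H" for z
    using wirtinger_automorphy_factor[OF A that, of k] by (simp add: J_def c_def i1_def i2_def)
  have di1: "(i1 has_field_derivative - c * (i1 z)\<^sup>2) (at z)" if "z \<in> ?H" for z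
    unfolding i1_def
    by (rule derivative_eq_intros cocycle_derivative j[OF that] refl)+
       (simp add: c_def power2_eq_square)
  have w1: "wirtinger i1 (- c * (i1 z)\<^sup>2) 0 z" and w2: "wirtinger i2 0 (- c * (i2 z)\<^sup>2) z" if "z \<in> ?H" for z
  proof -
    show "wirtinger i1 (- c * (i1 z)\<^sup>2) 0 z" by (rule wirtinger_holomorphic[OF di1[OF that]])
    show "wirtinger i2 0 (- c * (i2 z)\<^sup>2) z"
      using wirtinger_antiholomorphic[OF di1[OF that]] by (simp add: i2_def c_def)
  qed
  have u1: "wirtinger u (p z) (q z) z" "wirtinger p (pp z) (pq z) z" "wirtinger q (qp z) (qq z) z" if "z \<in> ?H" for z
    using u that by (auto simp: wirtinger2_def)
  have i2sq: "cnj ((i1 z)\<^sup>2) = (i2 z)\<^sup>2" for z by (simp add: i2_def)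
  note comp = wirtinger_compose_holomorphic[OF \<phi>, unfolded i2sq]
  have wu: "wirtinger (\<lambda>z. u (?\<phi> z)) (p (?\<phi> z) * (i1 z)\<^sup>2) (q (?\<phi> z) * (i2 z)\<^sup>2) z"
    and wp: "wirtinger (\<lambda>z. p (?\<phi> z)) (pp (?\<phi> z) * (i1 z)\<^sup>2) (pq (?\<phi> z) * (i2 z)\<^sup>2) z"
    and wq: "wirtinger (\<lambda>z. q (?\<phi> z)) (qp (?\<phi> z) * (i1 z)\<^sup>2) (qq (?\<phi> z) * (i2 z)\<^sup>2) z" if "z \<in> ?H" for z
    using that by (auto intro!: comp u1 \<phi>H)
  define P where "P = (\<lambda>z. J z * (p (?\<phi> z) * (i1 z * i1 z) + - (k * c / 2) * (i1 z * u (?\<phi> z))))"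
  define Q where "Q = (\<lambda>z. J z * (q (?\<phi> z) * (i2 z * i2 z) + k * c / 2 * (i2 z * u (?\<phi> z))))"
  have wU: "wirtinger (slash k u A) (P z) (Q z) z" if "z \<in> ?H" for z
  proof -
    have "slash k u A = (\<lambda>z. J z * u (?\<phi> z))" by (simp add: slash_def J_def fun_eq_iff)
    moreover have "J z * (p (?\<phi> z) * (i1 z)\<^sup>2) + - (k * c / 2) * i1 z * J z * u (?\<phi> z) = P z"
      "J z * (q (?\<phi> z) * (i2 z)\<^sup>2) + k * c / 2 * i2 z * J z * u (?\<phi> z) = Q z"
      by (simp_all add: P_def Q_def algebra_simps power2_eq_square)
    ultimately show ?thesis using wirtinger_mult[OF wJ[OF that] wu[OF that]] by simp
  qed
  let ?X = "\<lambda>z. p (?\<phi> z) * (i1 z * i1 z) + - (k * c / 2) * (i1 z * u (?\<phi> z))"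
  let ?Y = "\<lambda>z. q (?\<phi> z) * (i2 z * i2 z) + k * c / 2 * (i2 z * u (?\<phi> z))"
  note wX = wirtinger_add[OF wirtinger_mult[OF wp wirtinger_mult[OF w1 w1]] wirtinger_mult[OF wirtinger_const[of
      "- (k * c / 2)"] wirtinger_mult[OF w1 wu]]]
  note wY = wirtinger_add[OF wirtinger_mult[OF wq wirtinger_mult[OF w2 w2]] wirtinger_mult[OF wirtinger_const[of
      "k * c / 2"] wirtinger_mult[OF w2 wu]]]
  define PP where "PP = (\<lambda>z. J z * (p (?\<phi> z) * (i1 z * (- c * (i1 z)\<^sup>2) + - c * (i1 z)\<^sup>2 * i1 z)
      + pp (?\<phi> z) * (i1 z)\<^sup>2 * (i1 z * i1 z)
      + (- (k * c / 2) * (i1 z * (p (?\<phi> z) * (i1 z)\<^sup>2) + - c * (i1 z)\<^sup>2 * u (?\<phi> z)) + 0 * (i1 z * u (?\<phi> z)))) +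
          - (k * c / 2) * i1 z * J z * ?X z)"
  define PQ where "PQ = (\<lambda>z. J z * (p (?\<phi> z) * (i1 z * 0 + 0 * i1 z) + pq (?\<phi> z) * (i2 z)\<^sup>2 * (i1 z * i1 z)
      + (- (k * c / 2) * (i1 z * (q (?\<phi> z) * (i2 z)\<^sup>2) + 0 * u (?\<phi> z)) + 0 * (i1 z * u (?\<phi> z))))
          + k * c / 2 * i2 z * J z * ?X z)"
  define QP where "QP = (\<lambda>z. J z * (q (?\<phi> z) * (i2 z * 0 + 0 * i2 z) + qp (?\<phi> z) * (i1 z)\<^sup>2 * (i2 z * i2 z)
      + (k * c / 2 * (i2 z * (p (?\<phi> z) * (i1 z)\<^sup>2) + 0 * u (?\<phi> z)) + 0 * (i2 z * u (?\<phi> z)))) +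
          - (k * c / 2) * i1 z * J z * ?Y z)"
  define QQ where "QQ = (\<lambda>z. J z * (q (?\<phi> z) * (i2 z * (- c * (i2 z)\<^sup>2) + - c * (i2 z)\<^sup>2 * i2 z)
      + qq (?\<phi> z) * (i2 z)\<^sup>2 * (i2 z * i2 z)
      + (k * c / 2 * (i2 z * (q (?\<phi> z) * (i2 z)\<^sup>2) + - c * (i2 z)\<^sup>2 * u (?\<phi> z)) + 0 * (i2 z * u (?\<phi> z))))
          + k * c / 2 * i2 z * J z * ?Y z)"
  have wP: "wirtinger P (PP z) (PQ z) z" if "z \<in> ?H" for z
    unfolding P_def PP_def PQ_def by (rule wirtinger_mult[OF wJ[OF that] wX[OF that that that that that]])
  have wQ: "wirtinger Q (QP z) (QQ z) z" if "z \<in> ?H" for z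
    unfolding Q_def QP_def QQ_def by (rule wirtinger_mult[OF wJ[OF that] wY[OF that that that that that]])
  have cont\<phi>: "continuous_on ?H ?\<phi>"
    using \<phi> by (intro continuous_at_imp_continuous_on ballI) (blast intro: DERIV_isCont)
  have cc: "continuous_on ?H (\<lambda>z. f (?\<phi> z))" if "continuous_on ?H f" for f
    by (rule continuous_on_compose2[OF that cont\<phi>]) (use \<phi>H in auto)
  have cu: "continuous_on ?H u" "continuous_on ?H p" "continuous_on ?H q" "continuous_on ?H J" "continuous_on ?H
      i1" "continuous_on ?H i2"
    by (rule wirtinger_continuous_on; rule u1 wJ w1 w2; assumption)+
  have cu2: "continuous_on ?H pp" "continuous_on ?H pq" "continuous_on ?H qp" "continuous_on ?H qq"
    using u by (auto simp: wirtinger2_def)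
  have W2: "wirtinger2 (slash k u A) P Q PP PQ QP QQ ?H"
    unfolding wirtinger2_def
  proof (intro conjI ballI wU wP wQ)
    show "continuous_on ?H PP" "continuous_on ?H PQ" "continuous_on ?H QP" "continuous_on ?H QQ"
      unfolding PP_def PQ_def QP_def QQ_def
      by (intro continuous_intros cu cu2 cc)+
  qed
  have "- 2 * of_real ((Im z)\<^sup>2) * (PQ z + QP z) + \<i> * k * of_real (Im z) * (P z + Q z) = lam * slash k u A z"
      if z: "z \<in> ?H" for z
  proof -
    define y where "y = complex_of_real (Im z)"
    define a b where "a = i1 z" and "b = i2 z"
    define w where "w = ?\<phi> z"
    have D: "b - a = 2 * \<i> * c * y * a * b"
    proof -
      have "cocycle A z - cnj (cocycle A z) = 2 * \<i> * c * y"
        by (simp add: cocycle_def c_def y_def complex_eq_iff)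
      moreover have "b - a = (cocycle A z - cnj (cocycle A z)) * a * b"
        using j[OF z] by (simp add: a_def b_def i1_def i2_def field_simps)
      ultimately show ?thesis by simp
    qed
    have Y: "of_real (Im w) = y * a * b"
      using Im_moebius[OF A z] by (simp add: w_def y_def a_def b_def i1_def i2_def)
    have e: "J z * (p w * a\<^sup>2 + - (k * c / 2) * a * u w) = P z" "J z * (q w * b\<^sup>2 + k * c / 2 * b * u w) = Q z"
      "J z * (k * c / 2 * b * (p w * a\<^sup>2 + - (k * c / 2) * a * u w) + (pq w * a\<^sup>2 * b\<^sup>2 +
          - (k * c / 2) * a * (q w * b\<^sup>2))) = PQ z"
      "J z * (- (k * c / 2) * a * (q w * b\<^sup>2 + k * c / 2 * b * u w) + (qp w * a\<^sup>2 * b\<^sup>2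
          + k * c / 2 * b * (p w * a\<^sup>2))) = QP z"
      unfolding P_def Q_def PQ_def QP_def w_def[symmetric] a_def[symmetric] b_def[symmetric]
      by (simp_all add: algebra_simps power2_eq_square)
    have "- 2 * of_real ((Im z)\<^sup>2) * (PQ z + QP z) + \<i> * k * of_real (Im z) * (P z + Q z)
      = J z * (- 2 * y\<^sup>2 * ((k * c / 2 * b * (p w * a\<^sup>2 + - (k * c / 2) * a * u w) + (pq w * a\<^sup>2 * b\<^sup>2 +
          - (k * c / 2) * a * (q w * b\<^sup>2))) +
      (- (k * c / 2) * a * (q w * b\<^sup>2 + k * c / 2 * b * u w) + (qp w * a\<^sup>2 * b\<^sup>2 + k * c / 2 * b * (p w * a\<^sup>2)))) +
    \<i> * k * y * ((p w * a\<^sup>2 + - (k * c / 2) * a * u w) + (q w * b\<^sup>2 + k * c / 2 * b * u w)))"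
      unfolding e[symmetric] y_def[symmetric] of_real_power by (simp only: distrib_left mult_ac)
    also have "\<dots> = J z * (- 2 * (y * a * b)\<^sup>2 * (pq w + qp w) + \<i> * k * (y * a * b) * (p w + q w))"
      by (subst slash_laplacian_identity[OF D]) simp_all
    also have "\<dots> = J z * (lam * u w)"
      using pde[OF \<phi>H[OF z]] unfolding w_def[symmetric] Y[symmetric] by simp
    also have "\<dots> = lam * slash k u A z" by (simp add: slash_def J_def w_def)
    finally show ?thesis .
  qed
  with W2 show thesis using that by blast
qed

section \<open>Translation and growth at a cusp\<close>

lemma matrix_mult_2:
  fixes A B :: "real^2^2"
  shows "(A ** B) $ i $ j = A $ i $ 1 * B $ 1 $ j + A $ i $ 2 * B $ 2 $ j"
  by (simp add: matrix_matrix_mult_def sum_2)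

lemma moebius_times_cocycle:
  "cocycle A z \<noteq> 0 \<Longrightarrow> moebius A z * cocycle A z = of_real (A $ 1 $ 1) * z + of_real (A $ 1 $ 2)"
  by (simp add: moebius_def)

lemma cocycle_mult:
  assumes "cocycle B z \<noteq> 0"
  shows "cocycle (A ** B) z = cocycle A (moebius B z) * cocycle B z"
proof -
  have "cocycle A (moebius B z) * cocycle B z
      = of_real (A $ 2 $ 1) * (moebius B z * cocycle B z) + of_real (A $ 2 $ 2) * cocycle B z"
    by (simp add: cocycle_def[of A] algebra_simps)
  also have "\<dots> = cocycle (A ** B) z"
    unfolding moebius_times_cocycle[OF assms] by (simp add: cocycle_def matrix_mult_2 algebra_simps)
  finally show ?thesis ..
qed

lemma moebius_mult:
  assumes "cocycle B z \<noteq> 0"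
  shows "moebius (A ** B) z = moebius A (moebius B z)"
proof -
  have "of_real ((A ** B) $ 1 $ 1) * z + of_real ((A ** B) $ 1 $ 2)
     = of_real (A $ 1 $ 1) * (moebius B z * cocycle B z) + of_real (A $ 1 $ 2) * cocycle B z"
    unfolding moebius_times_cocycle[OF assms] by (simp add: cocycle_def matrix_mult_2 algebra_simps)
  also have "\<dots> = (of_real (A $ 1 $ 1) * moebius B z + of_real (A $ 1 $ 2)) * cocycle B z"
    by (simp add: algebra_simps)
  finally show ?thesis
    using assms unfolding moebius_def[of "A ** B"] moebius_def[of A] cocycle_mult[OF assms] by simp
qed

text \<open>
  Arguments add up to a multiple of \<open>2\<pi>\<close>.  Unless it is 1, the factor \<open>q = 1 + s Im p / p\<close> has
  argument in \<open>(-\<pi>, 0)\<close>, and \<open>p\<close> and \<open>qp\<close> lie in the same open half-plane, so the multiple is zero.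
\<close>

lemma Arg_add_translated:
  fixes p q :: complex and s :: real
  assumes p: "p \<noteq> 0" and q: "q \<noteq> 0" and "s \<ge> 0"
    and pq: "q * p = p + of_real (s * Im p)"
  shows "Arg q + Arg p = Arg (q * p)"
proof (cases "Im p = 0 \<or> s = 0")
  case True
  then have "q = 1" using pq p by auto
  then show ?thesis by simp
next
  case False
  then have s: "s > 0" and I: "Im p \<noteq> 0" using assms by auto
  have "q = 1 + of_real (s * Im p) / p" using pq p by (simp add: field_simps)
  then have "Im q = - s * (Im p)\<^sup>2 / ((Re p)\<^sup>2 + (Im p)\<^sup>2)"
    by (simp add: Im_divide power2_eq_square)
  moreover have "(Re p)\<^sup>2 + (Im p)\<^sup>2 > 0" using I by (simp add: sum_power2_gt_zero_iff)
  ultimately have "Im q < 0" using s I by (simp add: divide_neg_pos)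
  then have q1: "Arg q < 0" using Arg_less_0[of q] by linarith
  have q2: "Arg q > - pi" using Arg_bounded[of q] by simp
  have Ipq: "Im (q * p) = Im p" unfolding pq by simp
  have sign: "0 \<le> Arg p \<longleftrightarrow> 0 \<le> Arg (q * p)" unfolding Arg_less_0 Ipq ..
  have b: "- pi < Arg p" "Arg p \<le> pi" using Arg_bounded[of p] by auto
  have "Arg (q * p) = (if Arg q + Arg p > pi then Arg q + Arg p - 2 * pi
     else if Arg q + Arg p \<le> - pi then Arg q + Arg p + 2 * pi else Arg q + Arg p)"
    using Arg_times'[OF q p] by (auto split: if_splits)
  then show ?thesis using q1 q2 b sign by (auto split: if_splits)
qed

text \<open>
  The matrices \<open>\<gamma>g\<close> and \<open>gT\<close> agree, where \<open>T\<close> is the translation by \<open>l\<close>; their cocycles give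
  \<open>j(\<gamma>, gz) j(g, z) = j(g, z + l)\<close>, and for these factors the arguments are additive.
\<close>

lemma slash_translation:
  fixes l :: real
  assumes g: "det g = 1" and \<gamma>: "det \<gamma> = 1" and l: "l \<ge> 0"
    and conj: "matrix_inv g ** \<gamma> ** g = vector [vector [1, l], vector [0, 1]]"
    and u: "\<And>z. z \<in> upper_half_plane \<Longrightarrow> slash k u \<gamma> z = c * u z"
    and z: "z \<in> upper_half_plane"
  shows "slash k u g (z + of_real l) = c * slash k u g z"
proof -
  define T :: "real^2^2" where "T = vector [vector [1, l], vector [0, 1]]"
  have T: "T $ 1 $ 1 = 1" "T $ 1 $ 2 = l" "T $ 2 $ 1 = 0" "T $ 2 $ 2 = 1"
    by (simp_all add: T_def)
  have "invertible g" using g by (simp add: invertible_det_nz)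
  then have "g ** matrix_inv g = mat 1 \<and> matrix_inv g ** g = mat 1"
    unfolding matrix_inv_def invertible_def by (rule someI_ex)
  then have "g ** (matrix_inv g ** \<gamma> ** g) = \<gamma> ** g"
    by (simp add: matrix_mul_assoc)
  then have gT: "g ** T = \<gamma> ** g" using conj by (simp add: T_def)
  have zT: "moebius T z = z + of_real l" "cocycle T z = 1"
    by (simp_all add: moebius_def cocycle_def T)
  have jg: "cocycle g z \<noteq> 0" by (rule cocycle_nonzero[OF g z])
  define w where "w = moebius g z"
  have w: "w \<in> upper_half_plane" unfolding w_def by (rule moebius_upper_half_plane[OF g z])
  have j\<gamma>: "cocycle \<gamma> w \<noteq> 0" by (rule cocycle_nonzero[OF \<gamma> w])
  have m: "moebius g (z + of_real l) = moebius \<gamma> w"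
    using moebius_mult[of T z g] moebius_mult[OF jg, of \<gamma>] by (simp add: gT zT w_def)
  have c: "cocycle g (z + of_real l) = cocycle \<gamma> w * cocycle g z"
    using cocycle_mult[of T z g] cocycle_mult[OF jg, of \<gamma>] by (simp add: gT zT w_def)
  have Iz: "Im z > 0" using z by (simp add: upper_half_plane_def)
  have "cocycle \<gamma> w * cocycle g z = cocycle g z + of_real (l / Im z * Im (cocycle g z))"
    unfolding c[symmetric] using Iz by (simp add: cocycle_def algebra_simps)
  then have arg: "Arg (cocycle \<gamma> w) + Arg (cocycle g z) = Arg (cocycle g (z + of_real l))"
    unfolding c by (intro Arg_add_translated[OF jg j\<gamma>, of "l / Im z"]) (use l Iz in auto)
  have "slash k u g (z + of_real l) = exp (- \<i> * k * of_real (Arg (cocycle \<gamma> w) + Arg (cocycle g z))) * u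
      (moebius \<gamma> w)"
    unfolding slash_def m arg ..
  also have "\<dots> = exp (- \<i> * k * of_real (Arg (cocycle g z))) * slash k u \<gamma> w"
    by (simp add: slash_def algebra_simps flip: exp_add)
  finally show ?thesis unfolding u[OF w] by (simp add: slash_def w_def)
qed

text \<open>
  Arguments are bounded, hence so is the automorphy factor, also for complex weight.
\<close>

lemma slash_growth:
  assumes "(\<lambda>z. u (moebius g z)) \<in> O[filtercomap Im at_top](\<lambda>z. of_real (exp (c * Im z)))"
  obtains C Y where "\<And>z. Im z \<ge> Y \<Longrightarrow> norm (slash k u g z) \<le> C * exp (c * Im z)" "C \<ge> 0"
proof -
  from assms obtain D where D: "D > 0" "\<forall>\<^sub>F z in filtercomap Im at_top. norm (u (moebius g z))
      \<le> D * norm (complex_of_real (exp (c * Im z)))"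
    by (elim landau_o.bigE)
  from D(2) obtain Y where Y: "\<And>z. Im z \<ge> Y \<Longrightarrow> norm (u (moebius g z)) \<le> D * exp (c * Im z)"
    unfolding eventually_filtercomap eventually_at_top_linorder by (auto simp del: of_real_exp)
  have "norm (slash k u g z) \<le> exp (\<bar>Im k\<bar> * pi) * D * exp (c * Im z)" if "Im z \<ge> Y" for z
  proof -
    have "Im k * Arg (cocycle g z) \<le> \<bar>Im k\<bar> * \<bar>Arg (cocycle g z)\<bar>" by (metis abs_ge_self abs_mult)
    also have "\<dots> \<le> \<bar>Im k\<bar> * pi"
      using Arg_bounded[of "cocycle g z"] by (intro mult_left_mono) auto
    finally have "norm (exp (- \<i> * k * of_real (Arg (cocycle g z)))) \<le> exp (\<bar>Im k\<bar> * pi)"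
      by simp
    then show ?thesis
      unfolding slash_def norm_mult mult.assoc by (intro mult_mono Y that) auto
  qed
  then show thesis using that[of Y "exp (\<bar>Im k\<bar> * pi) * D"] D(1) by simp
qed

section \<open>Fourier coefficients of quasi-periodic eigenfunctions\<close>

lemma fchar_quasi:
  assumes "n - \<kappa> \<in> \<int>"
  shows "fchar \<kappa> 1 * fchar (- n) 1 = 1"
proof -
  obtain m :: int where "n - \<kappa> = of_int m" using assms by (elim Ints_cases)
  then have "\<kappa> + - n = of_int (- m)" by simp
  then have "fchar (\<kappa> + - n) 1 = 1" by (simp only: fchar_int)
  then show ?thesis by (simp only: fchar_add)
qed

text \<open>
  For a quasi-periodic function and a frequency congruent to \<open>\<kappa>\<close> modulo 1 the boundary term of the
  integration by parts vanishes.
\<close>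

lemma fourier_coeff_derivative_quasi:
  assumes "\<And>t. t \<in> {0..1} \<Longrightarrow> (f has_vector_derivative f' t) (at t)" "continuous_on {0..1} f'"
    and "f 1 = fchar \<kappa> 1 * f 0" "n - \<kappa> \<in> \<int>"
  shows "fourier_coeff f' n = 2 * of_real pi * \<i> * of_real n * fourier_coeff f n"
  using fourier_coeff_derivative[OF assms(1,2)] fchar_quasi[OF assms(4)]
  by (simp add: assms(3) mult_ac)

lemma fourier_coeff_lincomb:
  assumes "continuous_on {0..1} f" "continuous_on {0..1} g" "continuous_on {0..1} h"
  shows "fourier_coeff (\<lambda>t. a * f t + b * g t + c * h t) n = a * fourier_coeff f n + b * fourier_coeff g n
      + c * fourier_coeff h n"
proof -
  have i: "((\<lambda>t. F t * fchar (- n) t) has_integral fourier_coeff F n) {0..1}" if "continuous_on {0..1} F" for F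
    unfolding fourier_coeff_def by (intro integrable_integral integrable_continuous_interval continuous_intros that)
  have "((\<lambda>t. a * (f t * fchar (- n) t) + b * (g t * fchar (- n) t) + c * (h t * fchar (- n) t)) has_integral
     (a * fourier_coeff f n + b * fourier_coeff g n + c * fourier_coeff h n)) {0..1}"
    by (intro has_integral_add has_integral_mult_right i assms)
  then have "((\<lambda>t. (a * f t + b * g t + c * h t) * fchar (- n) t) has_integral
     (a * fourier_coeff f n + b * fourier_coeff g n + c * fourier_coeff h n)) {0..1}"
    by (simp add: algebra_simps)
  then show ?thesis unfolding fourier_coeff_def[of "\<lambda>t. a * f t + b * g t + c * h t"] by (rule integral_unique)
qed

lemma fourier_coeff_parameter_derivative:
  fixes l :: real
  assumes F: "\<And>x y. y > 0 \<Longrightarrow> ((\<lambda>y. F (Complex x y)) has_vector_derivative F' (Complex x y)) (at y)"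
    and c: "continuous_on upper_half_plane F" "continuous_on upper_half_plane F'" and y: "y > 0"
  shows "((\<lambda>y. fourier_coeff (\<lambda>t. F (Complex (l * t) y)) n) has_vector_derivative
     fourier_coeff (\<lambda>t. F' (Complex (l * t) y)) n) (at y)"
proof -
  have "((\<lambda>y. integral (cbox 0 1) (\<lambda>t. F (Complex (l * t) y) * fchar (- n) t)) has_vector_derivative
     integral (cbox 0 1) (\<lambda>t. F' (Complex (l * t) y) * fchar (- n) t)) (at y within {0<..})"
  proof (rule leibniz_rule_vector_derivative)
    fix y t :: real assume "y \<in> {0<..}"
    then show "((\<lambda>y. F (Complex (l * t) y) * fchar (- n) t) has_vector_derivative F' (Complex (l * t) y) * fchar
        (- n) t) (at y within {0<..})"
      by (intro has_vector_derivative_at_within[OF has_vector_derivative_mult_left] F) simp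
  next
    fix y :: real assume y: "y \<in> {0<..}"
    have "continuous_on (cbox 0 1) (\<lambda>t. F (Complex (l * t) y))"
      by (rule continuous_on_compose2[OF c(1)])
         (use y in \<open>auto simp: Complex_eq upper_half_plane_def intro!: continuous_intros\<close>)
    then show "(\<lambda>t. F (Complex (l * t) y) * fchar (- n) t) integrable_on cbox 0 1"
      by (intro integrable_continuous continuous_intros)
  next
    have "continuous_on ({0<..} \<times> cbox 0 1) (\<lambda>p. F' (Complex (l * snd p) (fst p)))"
      by (rule continuous_on_compose2[OF c(2)])
         (auto simp: Complex_eq upper_half_plane_def intro!: continuous_intros)
    moreover have "continuous_on ({0<..} \<times> cbox 0 1) (\<lambda>p::real \<times> real. fchar (- n) (snd p))"
      by (rule continuous_on_compose2[OF continuous_on_fchar[of UNIV]]) (auto intro!: continuous_intros)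
    ultimately show "continuous_on ({0<..} \<times> cbox 0 1) (\<lambda>(y, t). F' (Complex (l * t) y) * fchar (- n) t)"
      unfolding case_prod_unfold by (intro continuous_intros)
  qed (use y in auto)
  moreover have "at y within {0<..} = at y" using y by (intro at_within_open) auto
  ultimately show ?thesis by (simp add: fourier_coeff_def cbox_interval)
qed

lemma has_vector_derivative_scaled_line:
  fixes l :: real
  assumes "wirtinger f p q (Complex (l * t) y)"
  shows "((\<lambda>t. f (Complex (l * t) y)) has_vector_derivative of_real l * (p + q)) (at t)"
proof -
  have "((\<lambda>t. l * t) has_vector_derivative l) (at t)" by (auto intro!: derivative_eq_intros)
  from vector_diff_chain_at[OF this wirtinger_has_vector_derivative(1)[OF assms]]
  show ?thesis by (simp add: o_def scaleR_conv_of_real)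
qed

text \<open>
  Multiplying by \<open>e\<^sup>-\<^sup>2\<^sup>\<pi>\<^sup>i\<^sup>\<kappa>\<^sup>t\<close> makes \<open>t \<mapsto> u(lt + iy)\<close> periodic.  Each coefficient satisfies an ordinary
  differential equation: \<open>\<partial>\<^sub>y\<close> acts under the integral, and on the coefficient of frequency \<open>n\<close> the operator \<open>\<partial>\<^sub>x\<close> is
  multiplication by \<open>2\<pi>in/l\<close>.
\<close>

lemma fourier_expansion_quasi_periodic:
  fixes l \<kappa> :: real and k lam :: complex
  assumes W: "wirtinger2 u p q pp pq qp qq upper_half_plane"
    and pde: "\<And>z. z \<in> upper_half_plane \<Longrightarrow>
      - 2 * of_real ((Im z)\<^sup>2) * (pq z + qp z) + \<i> * k * of_real (Im z) * (p z + q z) = lam * u z"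
    and l: "l > 0" and quasi: "\<And>z. z \<in> upper_half_plane \<Longrightarrow> u (z + of_real l) = fchar \<kappa> 1 * u z"
  defines "a \<equiv> \<lambda>n y. fourier_coeff (\<lambda>t. u (Complex (l * t) y)) n"
  shows "\<And>x y. y > 0 \<Longrightarrow> ((\<lambda>m::int. a (\<kappa> + of_int m) y * fchar (\<kappa> + of_int m) (x / l)) has_sum u (Complex x y)) UNIV"
    and "\<And>n. n - \<kappa> \<in> \<int> \<Longrightarrow> \<exists>a'. \<forall>y>0. (a n has_vector_derivative a' y) (at y) \<and>
       (a' has_vector_derivative ((2 * of_real pi * of_real n / of_real l)\<^sup>2
           - k * (2 * of_real pi * of_real n / of_real l) / of_real y - lam / of_real y ^ 2) * a n y) (at y)"
proof -
  let ?H = upper_half_plane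
  define Ux where "Ux = (\<lambda>z. p z + q z)"
  define Uxx where "Uxx = (\<lambda>z. (pp z + qp z) + (pq z + qq z))"
  define Uy where "Uy = (\<lambda>z. \<i> * p z + - \<i> * q z)"
  define Uyy where "Uyy = (\<lambda>z. \<i> * ((\<i> * pp z + - \<i> * qp z) - (\<i> * pq z + - \<i> * qq z)))"
  have w: "wirtinger u (p z) (q z) z" "wirtinger p (pp z) (pq z) z" "wirtinger q (qp z) (qq z) z" if "z \<in> ?H" for z
    using W that by (auto simp: wirtinger2_def)
  have wx: "wirtinger Ux (pp z + qp z) (pq z + qq z) z" if "z \<in> ?H" for z
    unfolding Ux_def by (rule wirtinger_add[OF w(2,3)[OF that]])
  have wy: "wirtinger Uy (\<i> * pp z + - \<i> * qp z) (\<i> * pq z + - \<i> * qq z) z" if "z \<in> ?H" for z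
    using wirtinger_add[OF wirtinger_mult[OF wirtinger_const[of \<i>] w(2)[OF that]] wirtinger_mult[OF
        wirtinger_const[of "- \<i>"] w(3)[OF that]]]
    by (simp add: Uy_def)
  have c: "continuous_on ?H pp" "continuous_on ?H pq" "continuous_on ?H qp" "continuous_on ?H qq"
    using W by (auto simp: wirtinger2_def)
  have cU: "continuous_on ?H u" "continuous_on ?H Ux" "continuous_on ?H Uy" "continuous_on ?H Uxx"
      "continuous_on ?H Uyy"
    unfolding Uxx_def Uyy_def
    by (rule wirtinger_continuous_on, erule w wx wy)+ (intro continuous_intros c)+
  have H: "Complex x y \<in> ?H" if "y > 0" for x y using that by (simp add: upper_half_plane_def)
  have line: "continuous_on S (\<lambda>t. f (Complex (l * t) y))" if "continuous_on ?H f" "y > 0" for f y S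
    by (rule continuous_on_compose2[OF that(1)])
       (use that in \<open>auto simp: Complex_eq upper_half_plane_def intro!: continuous_intros\<close>)
  have d1: "((\<lambda>t. u (Complex (l * t) y)) has_vector_derivative of_real l * Ux (Complex (l * t) y)) (at t)"
      if "y > 0" for y t
    unfolding Ux_def by (rule has_vector_derivative_scaled_line[OF w(1)[OF H[OF that]]])
  have d2: "((\<lambda>t. Ux (Complex (l * t) y)) has_vector_derivative of_real l * Uxx (Complex (l * t) y)) (at t)"
      if "y > 0" for y t
    unfolding Uxx_def by (rule has_vector_derivative_scaled_line[OF wx[OF H[OF that]]])
  have shift: "Complex (l * (t + 1)) y = Complex (l * t) y + of_real l" for t y
    by (simp add: complex_eq_iff algebra_simps)
  have q0: "u (Complex (l * (t + 1)) y) = fchar \<kappa> 1 * u (Complex (l * t) y)" if "y > 0" for t y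
    unfolding shift by (rule quasi[OF H[OF that]])
  have q1: "Ux (Complex (l * (t + 1)) y) = fchar \<kappa> 1 * Ux (Complex (l * t) y)" if y: "y > 0" for t y
  proof -
    have "((\<lambda>t. t + 1) has_vector_derivative 1) (at t)" by (auto intro!: derivative_eq_intros)
    from vector_diff_chain_at[OF this d1[OF y]]
    have "((\<lambda>t. u (Complex (l * (t + 1)) y)) has_vector_derivative of_real l * Ux (Complex (l * (t + 1)) y)) (at t)"
      by (simp add: o_def)
    moreover have "((\<lambda>t. fchar \<kappa> 1 * u (Complex (l * t) y))
        has_vector_derivative fchar \<kappa> 1 * (of_real l * Ux (Complex (l * t) y))) (at t)"
      by (rule has_vector_derivative_mult_right[OF d1[OF y]])
    ultimately have "of_real l * Ux (Complex (l * (t + 1)) y) = fchar \<kappa> 1 * (of_real l * Ux (Complex (l * t) y))"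
      unfolding q0[OF y] by (rule vector_derivative_unique_at)
    then show ?thesis using l by simp
  qed
  show "((\<lambda>m::int. a (\<kappa> + of_int m) y * fchar (\<kappa> + of_int m) (x / l)) has_sum u (Complex x y)) UNIV"
      if y: "y > 0" for x y
  proof -
    define w where "w = 2 * of_real pi * \<i> * complex_of_real (- \<kappa>)"
    define U where "U = (\<lambda>t. u (Complex (l * t) y))"
    define U' where "U' = (\<lambda>t. of_real l * Ux (Complex (l * t) y))"
    define U'' where "U'' = (\<lambda>t. of_real l * (of_real l * Uxx (Complex (l * t) y)))"
    have DU: "(U has_vector_derivative U' t) (at t)" "(U' has_vector_derivative U'' t) (at t)" for t
      unfolding U_def U'_def U''_def by (intro d1 y has_vector_derivative_mult_right d2)+
    have Df: "(fchar (- \<kappa>) has_vector_derivative w * fchar (- \<kappa>) t) (at t)" for t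
      unfolding w_def by (rule fchar_derivative)
    have cU'': "continuous_on UNIV U''" "continuous_on UNIV U'" "continuous_on UNIV U"
      unfolding U_def U'_def U''_def by (intro continuous_intros line cU y)+
    have "((\<lambda>m::int. fourier_coeff (\<lambda>t. U t * fchar (- \<kappa>) t) (of_int m) * fchar (of_int m) (x / l))
        has_sum (U (x / l) * fchar (- \<kappa>) (x / l))) UNIV"
    proof (rule fourier_series_pointwise)
      fix t
      show "((\<lambda>t. U t * fchar (- \<kappa>) t) has_vector_derivative U t * (w * fchar (- \<kappa>) t) + U' t * fchar (- \<kappa>) t) (at t)"
        by (intro has_vector_derivative_mult DU Df)
      show "((\<lambda>t. U t * (w * fchar (- \<kappa>) t) + U' t * fchar (- \<kappa>) t) has_vector_derivative
         (U t * (w * (w * fchar (- \<kappa>) t)) + U' t * (w * fchar (- \<kappa>) t)) + (U' t * (w * fchar (- \<kappa>) t)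
             + U'' t * fchar (- \<kappa>) t)) (at t)"
        by (intro has_vector_derivative_add has_vector_derivative_mult has_vector_derivative_mult_right DU Df)
      have "fchar \<kappa> 1 * fchar (- \<kappa>) 1 = 1" by (rule fchar_quasi) simp
      then show "U (t + 1) * fchar (- \<kappa>) (t + 1) = U t * fchar (- \<kappa>) t"
        unfolding U_def q0[OF y] fchar_add(2) by (simp add: algebra_simps)
    qed (intro continuous_intros cU'')
    from has_sum_cmult_right[OF this, of "fchar \<kappa> (x / l)"]
    have 1: "((\<lambda>m::int. fchar \<kappa> (x / l) * (fourier_coeff (\<lambda>t. U t * fchar (- \<kappa>) t) (of_int m) * fchar (of_int m)
        (x / l)))
       has_sum (fchar \<kappa> (x / l) * (U (x / l) * fchar (- \<kappa>) (x / l)))) UNIV" .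
    have "fourier_coeff (\<lambda>t. U t * fchar (- \<kappa>) t) (of_int m) = a (\<kappa> + of_int m) y" for m
    proof -
      have "fchar (- \<kappa>) t * fchar (- of_int m) t = fchar (- (\<kappa> + of_int m)) t" for t
        by (simp add: fchar_add(1)[symmetric])
      then show ?thesis by (simp add: fourier_coeff_def a_def U_def mult.assoc)
    qed
    then have "fchar \<kappa> (x / l) * (fourier_coeff (\<lambda>t. U t * fchar (- \<kappa>) t) (of_int m) * fchar (of_int m) (x / l))
       = a (\<kappa> + of_int m) y * fchar (\<kappa> + of_int m) (x / l)" for m
      by (simp add: fchar_add(1))
    moreover have "fchar \<kappa> (x / l) * (U (x / l) * fchar (- \<kappa>) (x / l)) = u (Complex x y)"
      using l by (simp add: U_def fchar_minus)
    ultimately show ?thesis using 1 by simp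
  qed
  show "\<exists>a'. \<forall>y>0. (a n has_vector_derivative a' y) (at y) \<and>
       (a' has_vector_derivative ((2 * of_real pi * of_real n / of_real l)\<^sup>2
           - k * (2 * of_real pi * of_real n / of_real l) / of_real y - lam / of_real y ^ 2) * a n y) (at y)"
    if n: "n - \<kappa> \<in> \<int>" for n
  proof (intro exI allI impI conjI)
    fix y :: real assume y: "y > 0"
    have dy1: "((\<lambda>y. u (Complex x y)) has_vector_derivative Uy (Complex x y)) (at y)" if "y > 0" for x y
      using wirtinger_has_vector_derivative(2)[OF w(1)[OF H[OF that]]] by (simp add: Uy_def algebra_simps)
    have dy2: "((\<lambda>y. Uy (Complex x y)) has_vector_derivative Uyy (Complex x y)) (at y)" if "y > 0" for x y
      using wirtinger_has_vector_derivative(2)[OF wy[OF H[OF that]]] by (simp add: Uyy_def)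
    show "(a n has_vector_derivative fourier_coeff (\<lambda>t. Uy (Complex (l * t) y)) n) (at y)"
      unfolding a_def by (rule fourier_coeff_parameter_derivative[OF dy1 cU(1,3) y])
    have e: "fourier_coeff (\<lambda>t. Uyy (Complex (l * t) y)) n = ((2 * of_real pi * of_real n / of_real l)\<^sup>2
        - k * (2 * of_real pi * of_real n / of_real l) / of_real y - lam / of_real y ^ 2) * a n y"
    proof -
      define w where "w = 2 * of_real pi * \<i> * complex_of_real n"
      have Uyy: "Uyy z = (- 1) * Uxx z + (\<i> * k / of_real (Im z)) * Ux z + (- lam / of_real (Im z) ^ 2) * u z"
          if "z \<in> ?H" for z
      proof -
        have y0: "complex_of_real (Im z) \<noteq> 0" using that by (simp add: upper_half_plane_def)
        have "Uyy z + Uxx z = 2 * (pq z + qp z)"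
          by (simp add: Uyy_def Uxx_def algebra_simps)
        moreover have "2 * (pq z + qp z) = (\<i> * k / of_real (Im z)) * Ux z + (- lam / of_real (Im z) ^ 2) * u z"
        proof -
          have alg: "2 * s = i / Y * x + (- L / Y ^ 2) * v" if "- 2 * Y\<^sup>2 * s + i * Y * x = L * v" "Y \<noteq> 0"
              for s i Y x L v :: complex
          proof -
            have "L * v / Y ^ 2 = (- 2 * Y\<^sup>2 * s + i * Y * x) / Y ^ 2" using that(1) by simp
            also have "\<dots> = - 2 * s + i / Y * x" using that(2) by (simp add: field_simps power2_eq_square)
            finally show ?thesis by simp
          qed
          show ?thesis by (rule alg) (use pde[OF that] y0 in \<open>simp_all add: Ux_def\<close>)
        qed
        ultimately have "Uyy z + Uxx z = (\<i> * k / of_real (Im z)) * Ux z + (- lam / of_real (Im z) ^ 2) * u z"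
          by (simp only:)
        moreover have "b = (- 1) * a + c + d" if "b + a = c + d" for a b c d :: complex
          using that by algebra
        ultimately show ?thesis by blast
      qed
      have "fourier_coeff (\<lambda>t. Uyy (Complex (l * t) y)) n =
        fourier_coeff (\<lambda>t. (- 1) * Uxx (Complex (l * t) y) + (\<i> * k / of_real y) * Ux (Complex (l * t) y)
            + (- lam / of_real y ^ 2) * u (Complex (l * t) y)) n"
        using Uyy[OF H[OF y]] by simp
      also have "\<dots> = (- 1) * fourier_coeff (\<lambda>t. Uxx (Complex (l * t) y)) n
          + (\<i> * k / of_real y) * fourier_coeff (\<lambda>t. Ux (Complex (l * t) y)) n
         + (- lam / of_real y ^ 2) * a n y"
        unfolding a_def by (intro fourier_coeff_lincomb line cU y)
      also have "fourier_coeff (\<lambda>t. Ux (Complex (l * t) y)) n = w / of_real l * a n y"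
      proof -
        have "fourier_coeff (\<lambda>t. of_real l * Ux (Complex (l * t) y)) n = w * a n y"
          unfolding w_def a_def
          by (rule fourier_coeff_derivative_quasi[OF d1[OF y] _ _ n])
             (use q0[OF y, of 0] in \<open>auto intro!: continuous_intros line cU y\<close>)
        moreover have "fourier_coeff (\<lambda>t. of_real l * Ux (Complex (l * t) y)) n
            = of_real l * fourier_coeff (\<lambda>t. Ux (Complex (l * t) y)) n"
          unfolding fourier_coeff_def by (simp add: mult.assoc)
        ultimately show ?thesis using l by (simp add: field_simps)
      qed
      also have "fourier_coeff (\<lambda>t. Uxx (Complex (l * t) y)) n = w / of_real l * (w / of_real l * a n y)"
      proof -
        have "fourier_coeff (\<lambda>t. of_real l * Uxx (Complex (l * t) y)) n
            = w * fourier_coeff (\<lambda>t. Ux (Complex (l * t) y)) n"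
          unfolding w_def
          by (rule fourier_coeff_derivative_quasi[OF d2[OF y] _ _ n])
             (use q1[OF y, of 0] in \<open>auto intro!: continuous_intros line cU y\<close>)
        moreover have "fourier_coeff (\<lambda>t. of_real l * Uxx (Complex (l * t) y)) n
            = of_real l * fourier_coeff (\<lambda>t. Uxx (Complex (l * t) y)) n"
          unfolding fourier_coeff_def by (simp add: mult.assoc)
        ultimately have "of_real l * fourier_coeff (\<lambda>t. Uxx (Complex (l * t) y)) n = w * (w / of_real l * a n y)"
          using \<open>fourier_coeff (\<lambda>t. Ux (Complex (l * t) y)) n = w / of_real l * a n y\<close> by simp
        then show ?thesis using l by (simp add: field_simps)
      qed
      also have "(- 1) * (w / of_real l * (w / of_real l * a n y))
          + (\<i> * k / of_real y) * (w / of_real l * a n y) + (- lam / of_real y ^ 2) * a n y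
        = ((2 * of_real pi * of_real n / of_real l)\<^sup>2 - k * (2 * of_real pi * of_real n / of_real l) / of_real y
            - lam / of_real y ^ 2) * a n y"
      proof -
        define N where "N = 2 * of_real pi * complex_of_real n / of_real l"
        have "w / of_real l = \<i> * N" by (simp add: w_def N_def)
        then show ?thesis unfolding N_def[symmetric]
          by (simp add: algebra_simps power2_eq_square) 
      qed
      finally show ?thesis .
    qed
    show "((\<lambda>y. fourier_coeff (\<lambda>t. Uy (Complex (l * t) y)) n) has_vector_derivative
      ((2 * of_real pi * of_real n / of_real l)\<^sup>2 - k * (2 * of_real pi * of_real n / of_real l) / of_real y
          - lam / of_real y ^ 2) * a n y) (at y)"
      unfolding e[symmetric] by (rule fourier_coeff_parameter_derivative[OF dy2 cU(3,5) y])
  qed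
qed

section \<open>The Whittaker-Fourier expansion\<close>

text \<open>
  Euler's equation \<open>f'' = -\<lambda> y\<^sup>-\<^sup>2 f\<close>, whose exponents \<open>1/2 \<plusminus> \<nu>\<close> coincide for \<open>\<nu> = 0\<close>.
\<close>

lemma zeroth_coefficient:
  fixes \<nu> lam :: complex
  assumes lam: "lam = 1/4 - \<nu>\<^sup>2"
    and f: "\<And>y. y > 0 \<Longrightarrow> (f has_vector_derivative f' y) (at y)"
      "\<And>y. y > 0 \<Longrightarrow> (f' has_vector_derivative (- lam / of_real y ^ 2) * f y) (at y)"
  shows "\<exists>Cp Cm. \<forall>y>0. f y = Cp * of_real y powr (1/2 + \<nu>) +
     Cm * (if \<nu> = 0 then of_real y powr (1/2) * of_real (ln y) else of_real y powr (1/2 - \<nu>))"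
proof -
  let ?P = "\<lambda>s y. complex_of_real y powr s"
  have D: "(?P s has_vector_derivative s * ?P (s - 1) y) (at y)" if "y > 0" for s y
    by (rule has_vector_derivative_real_field) (use that in \<open>auto intro!: derivative_eq_intros\<close>)
  have red: "?P (s - 1) y = ?P s y / of_real y" "?P (s - 1 - 1) y = ?P s y / of_real y ^ 2" if "y > 0" for s y
    using that by (simp_all add: powr_diff power2_eq_square)
  have D2: "((\<lambda>y. s * ?P (s - 1) y) has_vector_derivative (- lam / of_real y ^ 2) * ?P s y) (at y)"
    if y: "y > 0" and s: "s * (s - 1) = - lam" for s y
  proof -
    have "((\<lambda>y. s * ?P (s - 1) y) has_vector_derivative s * ((s - 1) * ?P (s - 1 - 1) y)) (at y)"
      by (intro has_vector_derivative_mult_right D y)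
    also have "s * ((s - 1) * ?P (s - 1 - 1) y) = (- lam / of_real y ^ 2) * ?P s y"
      unfolding red(2)[OF y] s[symmetric] by simp
    finally show ?thesis .
  qed
  have s1: "(1/2 + \<nu>) * (1/2 + \<nu> - 1) = - lam" and s2: "(1/2 - \<nu>) * (1/2 - \<nu> - 1) = - lam"
    by (simp_all add: lam power2_eq_square field_simps)
  show ?thesis
  proof (cases "\<nu> = 0")
    case False
    have w: "wronskian (?P (1/2 + \<nu>)) (\<lambda>y. (1/2 + \<nu>) * ?P (1/2 + \<nu> - 1) y) (?P (1/2 - \<nu>)) (\<lambda>y. (1/2
        - \<nu>) * ?P (1/2 - \<nu> - 1) y) 1 \<noteq> 0"
      using False by (simp add: wronskian_def)
    have "\<exists>Cp Cm. \<forall>y>0. f y = Cp * ?P (1/2 + \<nu>) y + Cm * ?P (1/2 - \<nu>) y"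
      by (rule exI, rule exI, rule fundamental_system[of f f' "\<lambda>y. - lam / of_real y ^ 2", OF f D D2[OF _ s1] D
          D2[OF _ s2] zero_less_one w])
    then show ?thesis using False by simp
  next
    case True
    have s: "(1/2) * (1/2 - 1) = - lam" using s1 True by simp
    define L where "L = (\<lambda>y. ?P (1/2) y * of_real (ln y))"
    define L' where "L' = (\<lambda>y. 1/2 * ?P (1/2 - 1) y * of_real (ln y) + ?P (1/2 - 1) y)"
    have Dln: "((\<lambda>y. complex_of_real (ln y)) has_vector_derivative 1 / of_real y) (at y)" if "y > 0" for y
    proof -
      have "((\<lambda>y. complex_of_real (ln y)) has_vector_derivative of_real (1 / y)) (at y)"
        by (rule has_vector_derivative_of_real[OF DERIV_ln_divide[OF that]])
      then show ?thesis by simp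
    qed
    have DL: "(L has_vector_derivative L' y) (at y)" if y: "y > 0" for y
    proof -
      have "(L has_vector_derivative ?P (1/2) y * (1 / of_real y) + 1/2 * ?P (1/2 - 1) y * of_real (ln y)) (at y)"
        unfolding L_def by (intro has_vector_derivative_mult D Dln y)
      then show ?thesis unfolding L'_def red(1)[OF y] by (simp add: algebra_simps)
    qed
    have DL': "(L' has_vector_derivative (- lam / of_real y ^ 2) * L y) (at y)" if y: "y > 0" for y
    proof -
      have "(L' has_vector_derivative (1/2 * ?P (1/2 - 1) y * (1 / of_real y)
          + (- lam / of_real y ^ 2) * ?P (1/2) y * of_real (ln y)) + (1/2 - 1) * ?P (1/2 - 1 - 1) y) (at y)"
        unfolding L'_def by (intro has_vector_derivative_add has_vector_derivative_mult D D2 Dln y s)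
      moreover have "(1/2 * ?P (1/2 - 1) y * (1 / of_real y) + (- lam / of_real y ^ 2) * ?P (1/2) y * of_real
          (ln y)) + (1/2 - 1) * ?P (1/2 - 1 - 1) y
        = (- lam / of_real y ^ 2) * L y"
        unfolding red[OF y] L_def by (simp add: power2_eq_square)
      ultimately show ?thesis by simp
    qed
    have w: "wronskian (?P (1/2)) (\<lambda>y. 1/2 * ?P (1/2 - 1) y) L L' 1 \<noteq> 0"
      by (simp add: wronskian_def L_def L'_def)
    have "\<exists>Cp Cm. \<forall>y>0. f y = Cp * ?P (1/2) y + Cm * L y"
      by (rule exI, rule exI, rule fundamental_system[of f f' "\<lambda>y. - lam / of_real y ^ 2", OF f D D2[OF _ s] DL
          DL' zero_less_one w])
    then show ?thesis using True by (simp add: L_def)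
  qed
qed

text \<open>
  In the variable \<open>t = 4\<pi>|n|y/l\<close> the equation of the coefficient is Whittaker's with parameter
  \<open>sgn(n)k/2\<close>, and the growth rate \<open>c\<close> becomes \<open>c l / (4\<pi>|n|)\<close>, to be compared with \<open>1/2\<close>.
\<close>

lemma nonzero_coefficient:
  fixes n l c :: real and k \<nu> :: complex
  assumes n: "n \<noteq> 0" and l: "l > 0"
    and \<nu>: "1 + 2 * \<nu> \<notin> \<int>\<^sub>\<le>\<^sub>0" and k: "1/2 + \<nu> - of_real (sgn n) * k / 2 \<notin> \<int>\<^sub>\<le>\<^sub>0"
    and f: "\<And>y. y > 0 \<Longrightarrow> (f has_vector_derivative f' y) (at y)"
      "\<And>y. y > 0 \<Longrightarrow> (f' has_vector_derivative ((2 * of_real pi * of_real n / of_real l)\<^sup>2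
          - k * (2 * of_real pi * of_real n / of_real l) / of_real y - (1/4 - \<nu>\<^sup>2) / of_real y ^ 2) * f y) (at y)"
    and growth: "\<And>y. y \<ge> Y \<Longrightarrow> y > 0 \<Longrightarrow> norm (f y) \<le> C * exp (c * y)"
  shows "\<exists>\<alpha> \<beta>. (\<forall>y>0. f y = \<alpha> * whittaker_W_tilde (of_real (sgn n) * k / 2) \<nu> (4 * pi * \<bar>n\<bar> / l * y)
       + \<beta> * whittaker_M_tilde (of_real (sgn n) * k / 2) \<nu> (4 * pi * \<bar>n\<bar> / l * y))
     \<and> (c < 2 * pi * \<bar>n\<bar> / l \<longrightarrow> \<beta> = 0)"
proof -
  define s where "s = 4 * pi * \<bar>n\<bar> / l"
  have s: "s > 0" using n l by (simp add: s_def)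
  define \<kappa> where "\<kappa> = of_real (sgn n) * k / 2"
  have N: "2 * of_real pi * of_real n / of_real l = complex_of_real (sgn n * s / 2)"
    by (simp add: s_def sgn_if)
  have pair: "whittaker_pair \<kappa> \<nu> (\<lambda>t. f (t / s)) (\<lambda>t. of_real (1 / s) * f' (t / s))"
    unfolding whittaker_pair_def
  proof (intro allI impI conjI)
    fix t :: real assume t: "t > 0"
    have d: "((\<lambda>t. t / s) has_vector_derivative 1 / s) (at t)" by (auto intro!: derivative_eq_intros)
    have ts: "t / s > 0" using t s by simp
    show "((\<lambda>t. f (t / s)) has_vector_derivative of_real (1 / s) * f' (t / s)) (at t)"
      using vector_diff_chain_at[OF d f(1)[OF ts]] by (simp add: o_def scaleR_conv_of_real)
    have "((\<lambda>t. of_real (1 / s) * f' (t / s)) has_vector_derivative of_real (1 / s) * (of_real (1 / s) *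
        (((2 * of_real pi * of_real n / of_real l)\<^sup>2
          - k * (2 * of_real pi * of_real n / of_real l) / of_real (t / s)
              - (1/4 - \<nu>\<^sup>2) / of_real (t / s) ^ 2) * f (t / s)))) (at t)"
      using has_vector_derivative_mult_right[OF vector_diff_chain_at[OF d f(2)[OF ts]], of "of_real (1 / s)"]
      by (simp add: o_def scaleR_conv_of_real)
    moreover have "of_real (1 / s) * (of_real (1 / s) * (((2 * of_real pi * of_real n / of_real l)\<^sup>2
          - k * (2 * of_real pi * of_real n / of_real l) / of_real (t / s)
              - (1/4 - \<nu>\<^sup>2) / of_real (t / s) ^ 2) * f (t / s)))
        = (1/4 - \<kappa> / of_real t - (1/4 - \<nu>\<^sup>2) / of_real (t\<^sup>2)) * f (t / s)"
    proof -
      have alg: "1 / S * (1 / S * (((\<sigma> * S / 2)\<^sup>2 - k * (\<sigma> * S / 2) / (T / S) - m / (T / S)\<^sup>2) * v))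
         = (1/4 - (\<sigma> * k / 2) / T - m / T\<^sup>2) * v" if "\<sigma>\<^sup>2 = 1" "S \<noteq> 0" "T \<noteq> 0" for S T \<sigma> m v :: complex
      proof -
        have 1: "(\<sigma> * S / 2)\<^sup>2 = S\<^sup>2 / 4" using that(1) by (simp add: power_divide power_mult_distrib)
        show ?thesis unfolding 1 using that(2,3) by (simp add: field_simps power2_eq_square)
      qed
      have sg: "(complex_of_real (sgn n))\<^sup>2 = 1" using n by (simp add: sgn_if)
      show ?thesis
        unfolding N \<kappa>_def using alg[OF sg, of "of_real s" "of_real t" "1/4 - \<nu>\<^sup>2" "f (t / s)"] s t by simp
    qed
    ultimately show "((\<lambda>t. of_real (1 / s) * f' (t / s)) has_vector_derivative
       (1/4 - \<kappa> / of_real t - (1/4 - \<nu>\<^sup>2) / of_real (t\<^sup>2)) * f (t / s)) (at t)"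
      by simp
  qed
  obtain \<alpha> \<beta> where ab: "\<And>t. t > 0 \<Longrightarrow> f (t / s) = \<alpha> * whittaker_W_tilde \<kappa> \<nu> t + \<beta> * whittaker_M_tilde \<kappa> \<nu> t"
    and b: "\<And>C c. c < 1/2 \<Longrightarrow> \<forall>\<^sub>F t in at_top. norm (f (t / s)) \<le> C * exp (c * t) \<Longrightarrow> \<beta> = 0"
    using whittaker_expansion[OF \<nu> k[folded \<kappa>_def] pair] by blast
  have "\<beta> = 0" if "c < 2 * pi * \<bar>n\<bar> / l"
  proof (rule b[of "c / s" C])
    have "c < s / 2" using that by (simp add: s_def)
    then show "c / s < 1/2" using s by (simp add: field_simps)
    show "\<forall>\<^sub>F t in at_top. norm (f (t / s)) \<le> C * exp (c / s * t)"
      using eventually_ge_at_top[of "Y * s"] eventually_gt_at_top[of 0]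
    proof eventually_elim
      case (elim t)
      then show ?case using growth[of "t / s"] s by (simp add: field_simps)
    qed
  qed
  moreover have "f y = \<alpha> * whittaker_W_tilde \<kappa> \<nu> (s * y) + \<beta> * whittaker_M_tilde \<kappa> \<nu> (s * y)" if "y > 0" for y
    using ab[of "s * y"] s that by simp
  ultimately show ?thesis unfolding s_def \<kappa>_def by blast
qed

lemma finite_fourier_indices_bounded:
  "finite {n \<in> fourier_indices \<kappa>. \<bar>n\<bar> < R}"
proof (rule finite_subset)
  show "{n \<in> fourier_indices \<kappa>. \<bar>n\<bar> < R} \<subseteq> (\<lambda>m. \<kappa> + of_int m) ` {\<lfloor>- R - \<kappa>\<rfloor>..\<lceil>R - \<kappa>\<rceil>}"
  proof
    fix n assume "n \<in> {n \<in> fourier_indices \<kappa>. \<bar>n\<bar> < R}"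
    then have n: "n - \<kappa> \<in> \<int>" "\<bar>n\<bar> < R" by (auto simp: fourier_indices_def)
    then obtain m where m: "n - \<kappa> = of_int m" by (elim Ints_cases)
    have "n = \<kappa> + of_int m" using m by simp
    moreover have "m \<in> {\<lfloor>- R - \<kappa>\<rfloor>..\<lceil>R - \<kappa>\<rceil>}"
      using n(2) m by (auto simp: floor_le_iff le_ceiling_iff)
    ultimately show "n \<in> (\<lambda>m. \<kappa> + of_int m) ` {\<lfloor>- R - \<kappa>\<rfloor>..\<lceil>R - \<kappa>\<rceil>}" by blast
  qed
qed simp

theorem proposition4p5:
  fixes \<Gamma> :: "(real^2^2) set"
    and C :: "real option set"
    and \<gamma> g :: "real option \<Rightarrow> real^2^2"
    and l :: "real option \<Rightarrow> nat"
    and k lam \<nu> :: complex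
    and v :: "real^2^2 \<Rightarrow> complex"
    and u :: "complex \<Rightarrow> complex"
    and q :: "real option"
    and \<kappa> :: real
  assumes "finite_index_subgroup \<Gamma>"
    and "cusp_system \<Gamma> C \<gamma> g l"
    and "multiplier_system \<Gamma> k v"
    and "weakly_parabolic \<Gamma> v"
    and "lam = 1/4 - \<nu>\<^sup>2"
    and "\<And>m::nat. m \<ge> 1 \<Longrightarrow> \<nu> \<noteq> - of_nat m / 2"
    and "\<And>m::nat. k / 2 - \<nu> \<noteq> of_nat m + 1/2"
    and "\<And>m::nat. - k / 2 - \<nu> \<noteq> of_nat m + 1/2"
    and "u \<in> generalized_maass_forms \<Gamma> C g k v lam"
    and "q \<in> C"
    and "v (\<gamma> q) = exp (2 * of_real pi * \<i> * of_real \<kappa>)"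
  shows "\<exists>(M :: real) (A :: real \<Rightarrow> complex) (B :: real \<Rightarrow> complex) (Cplus :: complex) (Cminus :: complex).
    (\<forall>x y :: real. y > 0 \<longrightarrow>
      (\<lambda>n. A n * of_real (\<bar>n\<bar> powr (- 1/2))
             * whittaker_W_tilde (of_real (sgn n) * k / 2) \<nu> (4 * pi * \<bar>n\<bar> / real (l q) * y)
             * exp (2 * of_real pi * \<i> * of_real n / of_nat (l q) * of_real x))
        summable_on fourier_indices \<kappa> \<and>
      slash k u (g q) (Complex x y) =
        (\<Sum>\<^sub>\<infinity>n\<in>fourier_indices \<kappa>.
           A n * of_real (\<bar>n\<bar> powr (- 1/2))
             * whittaker_W_tilde (of_real (sgn n) * k / 2) \<nu> (4 * pi * \<bar>n\<bar> / real (l q) * y)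
             * exp (2 * of_real pi * \<i> * of_real n / of_nat (l q) * of_real x))
      + (\<Sum>n\<in>{n \<in> fourier_indices \<kappa>. 2 * pi * \<bar>n\<bar> / real (l q) < M}.
           B n * of_real (\<bar>n\<bar> powr (- 1/2))
             * whittaker_M_tilde (of_real (sgn n) * k / 2) \<nu> (4 * pi * \<bar>n\<bar> / real (l q) * y)
             * exp (2 * of_real pi * \<i> * of_real n / of_nat (l q) * of_real x))
      + Cplus * of_real y powr (1/2 + \<nu>)
      + Cminus * (if \<nu> = 0 then of_real y powr (1/2) * of_real (ln y)
                  else of_real y powr (1/2 - \<nu>))) \<and>
    (v (\<gamma> q) \<noteq> 1 \<longrightarrow> Cplus = 0 \<and> Cminus = 0)"
proof -
  define L where "L = real (l q)"
  define U where "U = slash k u (g q)"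
  have sub: "\<Gamma> \<subseteq> carrier SL2Z"
    using assms(1) by (auto simp: finite_index_subgroup_def dest: subgroup.subset)
  have cs: "\<gamma> q \<in> \<Gamma>" "g q \<in> carrier SL2Z" "L > 0"
    "matrix_inv (g q) ** \<gamma> q ** g q = vector [vector [1, L], vector [0, 1]]"
    using assms(2,10) by (auto simp: cusp_system_def L_def)
  have det: "det (g q) = 1" "det (\<gamma> q) = 1"
    using cs sub by (auto simp: SL2Z_def SL2R_def)
  have an: "real_analytic_on u upper_half_plane"
    and inv: "\<And>A z. A \<in> \<Gamma> \<Longrightarrow> z \<in> upper_half_plane \<Longrightarrow> slash k u A z = v A * u z"
    and pde0: "\<And>z. z \<in> upper_half_plane \<Longrightarrow> maass_laplacian k u z = lam * u z"
    and "\<exists>c. (\<lambda>z. u (moebius (g q) z)) \<in> O[filtercomap Im at_top](\<lambda>z. of_real (exp (c * Im z)))"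
    using assms(9,10) unfolding generalized_maass_forms_def by auto
  then obtain c where "(\<lambda>z. u (moebius (g q) z)) \<in> O[filtercomap Im at_top](\<lambda>z. of_real (exp (c * Im z)))"
    by blast
  from slash_growth[OF this] obtain K Y where K: "\<And>z. Im z \<ge> Y \<Longrightarrow> norm (U z) \<le> K * exp (c * Im z)"
    unfolding U_def by metis
  obtain p0 q0 pp0 pq0 qp0 qq0 where W0: "wirtinger2 u p0 q0 pp0 pq0 qp0 qq0 upper_half_plane"
    and pde1: "\<And>z. z \<in> upper_half_plane \<Longrightarrow> maass_laplacian k u z = - 2 * of_real ((Im z)\<^sup>2) * (pq0 z + qp0 z)
        + \<i> * k * of_real (Im z) * (p0 z + q0 z)"
    using real_analytic_wirtinger2[OF an, of k] by metis
  obtain p' q' pp pq qp qq where W: "wirtinger2 U p' q' pp pq qp qq upper_half_plane"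
    and pde: "\<And>z. z \<in> upper_half_plane \<Longrightarrow>
      - 2 * of_real ((Im z)\<^sup>2) * (pq z + qp z) + \<i> * k * of_real (Im z) * (p' z + q' z) = lam * U z"
    unfolding U_def by (rule slash_wirtinger2[OF det(1) W0, of k lam]) (use pde0 pde1 in auto)
  have v: "v (\<gamma> q) = fchar \<kappa> 1" using assms(11) by (simp add: fchar_def)
  have quasi: "U (z + of_real L) = fchar \<kappa> 1 * U z" if "z \<in> upper_half_plane" for z
    unfolding U_def v[symmetric]
    by (rule slash_translation[OF det _ cs(4) inv[OF cs(1)] that]) (use cs(3) in auto)
  define a where "a = (\<lambda>n y. fourier_coeff (\<lambda>t. U (Complex (L * t) y)) n)"
  have fe1: "((\<lambda>m::int. a (\<kappa> + of_int m) y * fchar (\<kappa> + of_int m) (x / L)) has_sum U (Complex x y)) UNIV"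
    if "y > 0" for x y
    unfolding a_def by (rule fourier_expansion_quasi_periodic(1)[OF W pde cs(3) quasi that])
  have fe2: "\<exists>a'. \<forall>y>0. (a n has_vector_derivative a' y) (at y) \<and>
       (a' has_vector_derivative ((2 * of_real pi * of_real n / of_real L)\<^sup>2
           - k * (2 * of_real pi * of_real n / of_real L) / of_real y - lam / of_real y ^ 2) * a n y) (at y)"
    if "n - \<kappa> \<in> \<int>" for n
    unfolding a_def by (rule fourier_expansion_quasi_periodic(2)[OF W pde cs(3) quasi that])
  have growth: "norm (a n y) \<le> K * exp (c * y)" if "y \<ge> Y" "y > 0" for n y
    unfolding a_def
  proof (rule fourier_coeff_bound)
    have "continuous_on upper_half_plane U"
      by (rule wirtinger_continuous_on[of _ _ p' q']) (use W in \<open>auto simp: wirtinger2_def\<close>)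
    then show "continuous_on {0..1} (\<lambda>t. U (Complex (L * t) y))"
      by (rule continuous_on_compose2)
         (use that in \<open>auto simp: Complex_eq upper_half_plane_def intro!: continuous_intros\<close>)
    show "norm (U (Complex (L * t) y)) \<le> K * exp (c * y)" for t
      using K[of "Complex (L * t) y"] that by simp
  qed
  have \<nu>: "1 + 2 * \<nu> \<notin> \<int>\<^sub>\<le>\<^sub>0"
  proof
    assume "1 + 2 * \<nu> \<in> \<int>\<^sub>\<le>\<^sub>0"
    then obtain m where "1 + 2 * \<nu> = - of_nat m" by (auto elim!: nonpos_Ints_cases')
    then have "\<nu> = - (of_nat m + 1) / 2" by algebra
    then have "\<nu> = - of_nat (Suc m) / 2" by (simp add: add.commute)
    then show False using assms(6)[of "Suc m"] by simp
  qed
  have kn: "1/2 + \<nu> - of_real (sgn n) * k / 2 \<notin> \<int>\<^sub>\<le>\<^sub>0" if "n \<noteq> 0" for n :: real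
  proof
    assume "1/2 + \<nu> - of_real (sgn n) * k / 2 \<in> \<int>\<^sub>\<le>\<^sub>0"
    then obtain m where "1/2 + \<nu> - of_real (sgn n) * k / 2 = - of_nat m" by (auto elim!: nonpos_Ints_cases')
    note eq = this
    have "of_real (sgn n) * k / 2 - \<nu> = 1/2 - (1/2 + \<nu> - of_real (sgn n) * k / 2)" by simp
    also have "\<dots> = of_nat m + 1/2" unfolding eq by simp
    finally have m: "of_real (sgn n) * k / 2 - \<nu> = of_nat m + 1/2" .
    show False
    proof (cases "n > 0")
      case True
      then show False using m assms(7)[of m] by simp
    next
      case False
      then have "sgn n = -1" using that by simp
      then show False using m assms(8)[of m] by simp
    qed
  qed
  let ?W = "\<lambda>n y. whittaker_W_tilde (of_real (sgn n) * k / 2) \<nu> (4 * pi * \<bar>n\<bar> / L * y)"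
  let ?M = "\<lambda>n y. whittaker_M_tilde (of_real (sgn n) * k / 2) \<nu> (4 * pi * \<bar>n\<bar> / L * y)"
  have "\<exists>\<alpha> \<beta>. (\<forall>y>0. a n y = \<alpha> * ?W n y + \<beta> * ?M n y) \<and> (c < 2 * pi * \<bar>n\<bar> / L \<longrightarrow> \<beta> = 0)"
    if n: "n \<in> fourier_indices \<kappa>" for n
  proof -
    have n0: "n \<noteq> 0" "n - \<kappa> \<in> \<int>" using n by (auto simp: fourier_indices_def)
    obtain a' where a': "\<And>y. y > 0 \<Longrightarrow> (a n has_vector_derivative a' y) (at y)"
      "\<And>y. y > 0 \<Longrightarrow> (a' has_vector_derivative ((2 * of_real pi * of_real n / of_real L)\<^sup>2
          - k * (2 * of_real pi * of_real n / of_real L) / of_real y - (1/4 - \<nu>\<^sup>2) / of_real y ^ 2) * a n y) (at y)"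
      using fe2[OF n0(2)] unfolding assms(5) by blast
    show ?thesis
      by (rule nonzero_coefficient[OF n0(1) cs(3) \<nu> kn[OF n0(1)] a' growth])
  qed
  then obtain \<alpha> \<beta> where ab: "\<And>n y. n \<in> fourier_indices \<kappa> \<Longrightarrow> y > 0 \<Longrightarrow> a n y = \<alpha> n * ?W n y + \<beta> n * ?M n y"
    and b0: "\<And>n. n \<in> fourier_indices \<kappa> \<Longrightarrow> c < 2 * pi * \<bar>n\<bar> / L \<Longrightarrow> \<beta> n = 0"
    by metis
  let ?Z = "\<lambda>Cp Cm y. Cp * of_real y powr (1/2 + \<nu>) + Cm * (if \<nu> = 0 then of_real y powr (1/2) * of_real (ln y)
      else complex_of_real y powr (1/2 - \<nu>))"
  \<comment> \<open>The frequency 0 occurs precisely for integral \<open>\<kappa>\<close>; otherwise the zeroth term is empty.\<close>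
  have zero: "\<exists>Cp Cm. (\<forall>y>0. (if \<kappa> \<in> \<int> then a 0 y else 0) = ?Z Cp Cm y) \<and> (\<kappa> \<notin> \<int> \<longrightarrow> Cp = 0 \<and> Cm = 0)"
  proof (cases "\<kappa> \<in> \<int>")
    case True
    then have "0 - \<kappa> \<in> \<int>" by simp
    then obtain a' where a': "\<And>y. y > 0 \<Longrightarrow> (a 0 has_vector_derivative a' y) (at y)"
      "\<And>y. y > 0 \<Longrightarrow> (a' has_vector_derivative (- lam / of_real y ^ 2) * a 0 y) (at y)"
      using fe2[of 0] by auto
    show ?thesis using zeroth_coefficient[OF assms(5) a'] True by simp
  next
    case False
    then show ?thesis by (intro exI[of _ 0]) auto
  qed
  then obtain Cp Cm where Z: "\<And>y. y > 0 \<Longrightarrow> (if \<kappa> \<in> \<int> then a 0 y else 0) = ?Z Cp Cm y"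
    and Z0: "\<kappa> \<notin> \<int> \<Longrightarrow> Cp = 0 \<and> Cm = 0" by blast
  \<comment> \<open>The factor \<open>|n|\<^sup>-\<^sup>1\<^sup>/\<^sup>2\<close> of the statement is a normalisation of the coefficients only.\<close>
  define A where "A = (\<lambda>n. \<alpha> n * of_real (\<bar>n\<bar> powr (1/2)))"
  define B where "B = (\<lambda>n. \<beta> n * of_real (\<bar>n\<bar> powr (1/2)))"
  let ?I = "fourier_indices \<kappa>"
  \<comment> \<open>Any bound above \<open>c\<close> serves as \<open>M\<close>: the terms with \<open>2\<pi>|n|/l > c\<close> have \<open>\<beta> = 0\<close>.\<close>
  let ?F = "{n \<in> ?I. 2 * pi * \<bar>n\<bar> / L < c + 1}"
  have fin: "finite ?F"
  proof -
    have "?F = {n \<in> ?I. \<bar>n\<bar> < (c + 1) * L / (2 * pi)}" using cs(3) by (auto simp: field_simps)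
    then show ?thesis using finite_fourier_indices_bounded by simp
  qed
  let ?e = "\<lambda>n x. exp (2 * of_real pi * \<i> * of_real n / of_nat (l q) * of_real x)"
  have e: "?e n x = fchar n (x / L)" for n x
    by (simp add: fchar_def L_def)
  have AB: "A n * of_real (\<bar>n\<bar> powr (- 1/2)) = \<alpha> n" "B n * of_real (\<bar>n\<bar> powr (- 1/2)) = \<beta> n" if "n \<in> ?I" for n
  proof -
    have "n \<noteq> 0" using that by (simp add: fourier_indices_def)
    then have "\<bar>n\<bar> powr (1/2) * \<bar>n\<bar> powr (- 1/2) = 1" by (simp add: powr_add[symmetric])
    then have "complex_of_real (\<bar>n\<bar> powr (1/2)) * of_real (\<bar>n\<bar> powr (- 1/2)) = 1" by (metis of_real_1 of_real_mult)
    then show "A n * of_real (\<bar>n\<bar> powr (- 1/2)) = \<alpha> n" "B n * of_real (\<bar>n\<bar> powr (- 1/2)) = \<beta> n"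
      by (simp_all only: A_def B_def mult.assoc mult_1_right)
  qed
  have main: "((\<lambda>n. A n * of_real (\<bar>n\<bar> powr (- 1/2)) * ?W n y * ?e n x) has_sum
     (U (Complex x y) - ?Z Cp Cm y - (\<Sum>n\<in>?F. B n * of_real (\<bar>n\<bar> powr (- 1/2)) * ?M n y * ?e n x))) ?I"
         if y: "y > 0" for x y
  proof -
    have inj: "inj (\<lambda>m::int. \<kappa> + of_int m)" by (simp add: inj_on_def)
    have ran: "range (\<lambda>m::int. \<kappa> + of_int m) = {n. n - \<kappa> \<in> \<int>}"
    proof (intro equalityI subsetI)
      fix n assume "n \<in> {n. n - \<kappa> \<in> \<int>}"
      then obtain m where "n - \<kappa> = of_int m" by (auto elim: Ints_cases)
      then have "n = \<kappa> + of_int m" by simp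
      then show "n \<in> range (\<lambda>m::int. \<kappa> + of_int m)" by blast
    qed auto
    have 1: "((\<lambda>n. a n y * fchar n (x / L)) has_sum U (Complex x y)) {n. n - \<kappa> \<in> \<int>}"
      using fe1[OF y, of x] unfolding ran[symmetric] has_sum_reindex[OF inj] by (simp add: o_def)
    have 2: "((\<lambda>n. a n y * fchar n (x / L)) has_sum (U (Complex x y) - ?Z Cp Cm y)) ?I"
    proof (cases "\<kappa> \<in> \<int>")
      case True
      have "((\<lambda>n. a n y * fchar n (x / L)) has_sum (U (Complex x y) - (\<Sum>n\<in>{0}. a n y * fchar n (x / L)))) ({n. n
          - \<kappa> \<in> \<int>} - {0})"
        by (rule has_sum_Diff[OF 1 has_sum_finite]) (use True in auto)
      moreover have "{n. n - \<kappa> \<in> \<int>} - {0} = ?I" by (auto simp: fourier_indices_def)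
      moreover have "(\<Sum>n\<in>{0}. a n y * fchar n (x / L)) = ?Z Cp Cm y" using Z[OF y] True by simp
      ultimately show ?thesis by (simp only:)
    next
      case False
      have "{n. n - \<kappa> \<in> \<int>} = ?I" using False by (auto simp: fourier_indices_def)
      moreover have "?Z Cp Cm y = 0" using Z0[OF False] by simp
      ultimately show ?thesis using 1 by simp
    qed
    have 3: "((\<lambda>n. B n * of_real (\<bar>n\<bar> powr (- 1/2)) * ?M n y * ?e n x) has_sum
       (\<Sum>n\<in>?F. B n * of_real (\<bar>n\<bar> powr (- 1/2)) * ?M n y * ?e n x)) ?I"
    proof (rule has_sum_finite_neutralI[OF fin])
      fix n assume "n \<in> ?I - ?F"
      then have "n \<in> ?I" "\<beta> n = 0" by (auto intro!: b0)
      then show "B n * of_real (\<bar>n\<bar> powr (- 1/2)) * ?M n y * ?e n x = 0" using AB(2) by simp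
    qed auto
    have 4: "((\<lambda>n. - (B n * of_real (\<bar>n\<bar> powr (- 1/2)) * ?M n y * ?e n x)) has_sum
       - (\<Sum>n\<in>?F. B n * of_real (\<bar>n\<bar> powr (- 1/2)) * ?M n y * ?e n x)) ?I"
      using has_sum_cmult_right[OF 3, of "- 1"] by (simp only: mult_minus_left mult_1_left)
    have "((\<lambda>n. a n y * fchar n (x / L) - B n * of_real (\<bar>n\<bar> powr (- 1/2)) * ?M n y * ?e n x) has_sum
      (U (Complex x y) - ?Z Cp Cm y - (\<Sum>n\<in>?F. B n * of_real (\<bar>n\<bar> powr (- 1/2)) * ?M n y * ?e n x))) ?I"
      using has_sum_add[OF 2 4] by (simp only: add_uminus_conv_diff)
    moreover have "a n y * fchar n (x / L) - B n * of_real (\<bar>n\<bar> powr (- 1/2)) * ?M n y * ?e n x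
       = A n * of_real (\<bar>n\<bar> powr (- 1/2)) * ?W n y * ?e n x" if "n \<in> ?I" for n
      unfolding e AB[OF that] ab[OF that y] by (simp add: algebra_simps)
    ultimately show ?thesis by (simp cong: has_sum_cong)
  qed
  have Ints: "\<kappa> \<notin> \<int>" if "v (\<gamma> q) \<noteq> 1"
    using that unfolding v by (metis Ints_cases fchar_int)
  show ?thesis
  proof (rule exI[of _ "c + 1"], rule exI[of _ A], rule exI[of _ B], rule exI[of _ Cp], rule exI[of _ Cm],
      intro conjI allI impI)
    fix x y :: real assume y: "y > 0"
    note m = main[OF y, of x, unfolded L_def U_def]
    show "(\<lambda>n. A n * of_real (\<bar>n\<bar> powr (- 1/2))
             * whittaker_W_tilde (of_real (sgn n) * k / 2) \<nu> (4 * pi * \<bar>n\<bar> / real (l q) * y) * ?e n x) summable_on ?I"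
      by (rule has_sum_imp_summable[OF m])
    show "slash k u (g q) (Complex x y) =
        (\<Sum>\<^sub>\<infinity>n\<in>fourier_indices \<kappa>.
           A n * of_real (\<bar>n\<bar> powr (- 1/2))
             * whittaker_W_tilde (of_real (sgn n) * k / 2) \<nu> (4 * pi * \<bar>n\<bar> / real (l q) * y) * ?e n x)
      + (\<Sum>n\<in>{n \<in> fourier_indices \<kappa>. 2 * pi * \<bar>n\<bar> / real (l q) < c + 1}.
           B n * of_real (\<bar>n\<bar> powr (- 1/2))
             * whittaker_M_tilde (of_real (sgn n) * k / 2) \<nu> (4 * pi * \<bar>n\<bar> / real (l q) * y) * ?e n x)
      + Cp * of_real y powr (1/2 + \<nu>)
      + Cm * (if \<nu> = 0 then of_real y powr (1/2) * of_real (ln y) else of_real y powr (1/2 - \<nu>))"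
      unfolding infsumI[OF m] by (simp add: algebra_simps)
  next
    assume "v (\<gamma> q) \<noteq> 1"
    from Z0[OF Ints[OF this]] show "Cp = 0" "Cm = 0" by auto
  qed
qed

end
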